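(* Let $k$ be a finite field and let $\mathcal{C}$ be a $k$-additive triangulated category with translation $[1]$ such that: (1) $\mathrm{Hom}(X,Y)$ is a finite dimensional $k$-space for all objects $X,Y$; (2) $\mathrm{End}\,X$ is a finite dimensional local $k$-algebra for every indecomposable object $X$; (3) $\sum_{i\ge 0}\dim_k\mathrm{Hom}(X[i],Y)<\infty$ for all objects $X,Y$. Let $\mathcal{H}$ be the $\mathbb{Q}$-vector space with basis $\{u_{[X]}\mid X\in\mathcal{C}\}$ indexed by the isomorphism classes $[X]$ of objects of $\mathcal{C}$. For $X,Y,L\in\mathcal{C}$ put $$F_{XY}^{L}=\{X,Y\}\cdot\sum_{\alpha\in V(X,Y;L)}\frac{|\mathrm{End}\,X_1(\alpha)|}{|\mathrm{Aut}\,X_1(\alpha)|}.$$ Then $\mathcal{H}$, with the multiplication $$u_{[X]}*u_{[Y]}=\sum_{[L]}F_{XY}^{L}\,u_{[L]},$$ is an associative algebra with unit $u_{0}=u_{[0]}$.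
   Context: Conventions: $fg$ denotes the composition of $f:X\to Y$ followed by $g:Y\to Z$; "triangle" means distinguished triangle; $|A|$ is the cardinality of a finite set $A$. Conditions (1) and (2) imply that the Krull-Schmidt theorem holds in $\mathcal{C}$. For $X,Y\in\mathcal{C}$, $\{X,Y\}=\prod_{i>0}|\mathrm{Hom}(X[i],Y)|^{(-1)^{i}}$ (a finite product of nontrivial factors by (3)). $W(X,Y;L)$ is the set of triples $(f,g,h)\in\mathrm{Hom}(X,L)\times\mathrm{Hom}(L,Y)\times\mathrm{Hom}(Y,X[1])$ such that $X\xrightarrow{f}L\xrightarrow{g}Y\xrightarrow{h}X[1]$ is a triangle. The group $\mathrm{Aut}\,X\times\mathrm{Aut}\,Y$ acts on it by $(a,c)\cdot(f,g,h)=(af,\,gc^{-1},\,ch(a[1])^{-1})$, and $V(X,Y;L)$ is the set of orbits $(f,g,h)^{\wedge}$. The radical $\mathrm{radHom}(X,Y)$ is the set of $f\in\mathrm{Hom}(X,Y)$ such that $gfh$ is not an isomorphism for any $g:A\to X$, $h:Y\to A$ with $A$ indecomposable. For $\alpha=(f,g,h)^{\wedge}\in V(X,Y;L)$ there are decompositions $Y=Y_1(\alpha)\oplus Y_2(\alpha)$, $X=X_1(\alpha)\oplus X_2(\alpha)$ and automorphisms $c\in\mathrm{Aut}\,Y$, $a\in\mathrm{Aut}\,X$ such that $ch(a[1])^{-1}=\begin{pmatrix}h_{11}&0\\0&h_{22}\end{pmatrix}$ with $h_{11}:Y_1(\alpha)\to X_1(\alpha)[1]$ an isomorphism and $h_{22}\in\mathrm{radHom}(Y_2(\alpha),X_2(\alpha)[1])$.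 The isomorphism class of $X_1(\alpha)$ depends only on $\alpha$. Since $\mathrm{Hom}(Y,X[1])$ is finite, the sum defining $u_{[X]}*u_{[Y]}$ has only finitely many nonzero terms. *)

theory Defs
  imports
    "HOL-Algebra.Group_Action"
    "HOL-Algebra.Ideal"
    "HOL-Library.Poly_Mapping"
    "Jordan_Normal_Form.VS_Connect"
begin

section \<open>Linear categories with a translation and a class of triangles\<close>

text \<open>
  Composition is written in diagrammatic order: \<open>f \<cdot>\<^bsub>C\<^esub> g\<close> is \<open>f : X \<rightarrow> Y\<close> followed by
  \<open>g : Y \<rightarrow> Z\<close>.  Every axiom and definition names source and target, so hom-sets need not be
  pairwise disjoint; since any category can be given pairwise disjoint hom-sets, it is no
  restriction that composition and the translation of morphisms do not take the objects as
  arguments.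

  Of the record \<open>Hom C X Y\<close> only the vector space structure is meaningful; its ring
  multiplication and unit are unspecified (see \<open>End_ring\<close>).
\<close>

record ('o, 'm, 'k) tri_data =
  Obj :: "'o set"
  Hom :: "'o \<Rightarrow> 'o \<Rightarrow> ('k, 'm) module"
  cmp :: "'m \<Rightarrow> 'm \<Rightarrow> 'm"  (infixl \<open>\<cdot>\<index>\<close> 70)
  idt :: "'o \<Rightarrow> 'm"
  shift :: "'o \<Rightarrow> 'o"
  shift_mor :: "'m \<Rightarrow> 'm"
  Tri :: "'o \<Rightarrow> 'o \<Rightarrow> 'o \<Rightarrow> 'm \<Rightarrow> 'm \<Rightarrow> 'm \<Rightarrow> bool"
    \<comment> \<open>\<open>Tri C X Y Z f g h\<close>: the sequence \<open>X \<rightarrow> Y \<rightarrow> Z \<rightarrow> X[1]\<close> given by \<open>f\<close>, \<open>g\<close>, \<open>h\<close> is a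
      distinguished triangle\<close>

abbreviation mor :: "('o, 'm, 'k) tri_data \<Rightarrow> 'o \<Rightarrow> 'o \<Rightarrow> 'm set" where
  "mor C X Y \<equiv> carrier (Hom C X Y)"

definition is_iso :: "('o, 'm, 'k) tri_data \<Rightarrow> 'o \<Rightarrow> 'o \<Rightarrow> 'm \<Rightarrow> bool" where
  "is_iso C X Y f \<longleftrightarrow> f \<in> mor C X Y \<and>
     (\<exists>g \<in> mor C Y X. f \<cdot>\<^bsub>C\<^esub> g = idt C X \<and> g \<cdot>\<^bsub>C\<^esub> f = idt C Y)"

definition isomorphic :: "('o, 'm, 'k) tri_data \<Rightarrow> 'o \<Rightarrow> 'o \<Rightarrow> bool" where
  "isomorphic C X Y \<longleftrightarrow> (\<exists>f. is_iso C X Y f)"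

definition is_zero_obj :: "('o, 'm, 'k) tri_data \<Rightarrow> 'o \<Rightarrow> bool" where
  "is_zero_obj C Z \<longleftrightarrow> Z \<in> Obj C \<and>
     (\<forall>X \<in> Obj C. (\<exists>!f. f \<in> mor C Z X) \<and> (\<exists>!f. f \<in> mor C X Z))"

text \<open>\<open>X = X1 \<oplus> X2\<close> with inclusions \<open>i1, i2\<close> and projections \<open>p1, p2\<close>.\<close>

definition is_biprod ::
  "('o, 'm, 'k) tri_data \<Rightarrow> 'o \<Rightarrow> 'o \<Rightarrow> 'o \<Rightarrow> 'm \<Rightarrow> 'm \<Rightarrow> 'm \<Rightarrow> 'm \<Rightarrow> bool" where
  "is_biprod C X X1 X2 i1 i2 p1 p2 \<longleftrightarrow>
     X \<in> Obj C \<and> X1 \<in> Obj C \<and> X2 \<in> Obj C \<and>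
     i1 \<in> mor C X1 X \<and> i2 \<in> mor C X2 X \<and> p1 \<in> mor C X X1 \<and> p2 \<in> mor C X X2 \<and>
     i1 \<cdot>\<^bsub>C\<^esub> p1 = idt C X1 \<and> i2 \<cdot>\<^bsub>C\<^esub> p2 = idt C X2 \<and>
     i1 \<cdot>\<^bsub>C\<^esub> p2 = \<zero>\<^bsub>Hom C X1 X2\<^esub> \<and> i2 \<cdot>\<^bsub>C\<^esub> p1 = \<zero>\<^bsub>Hom C X2 X1\<^esub> \<and>
     (p1 \<cdot>\<^bsub>C\<^esub> i1) \<oplus>\<^bsub>Hom C X X\<^esub> (p2 \<cdot>\<^bsub>C\<^esub> i2) = idt C X"

definition indecomposable :: "('o, 'm, 'k) tri_data \<Rightarrow> 'o \<Rightarrow> bool" where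
  "indecomposable C X \<longleftrightarrow> X \<in> Obj C \<and> \<not> is_zero_obj C X \<and>
     (\<forall>X1 X2 i1 i2 p1 p2. is_biprod C X X1 X2 i1 i2 p1 p2 \<longrightarrow>
        is_zero_obj C X1 \<or> is_zero_obj C X2)"

definition End_ring :: "('o, 'm, 'k) tri_data \<Rightarrow> 'o \<Rightarrow> ('k, 'm) module" where
  "End_ring C X = (Hom C X X)\<lparr>monoid.mult := cmp C, one := idt C X\<rparr>"

text \<open>A possibly non-commutative ring is local if its non-units form a two-sided ideal; this
  excludes the zero ring, because an ideal is non-empty.\<close>

definition local_ring :: "('a, 'b) ring_scheme \<Rightarrow> bool" where
  "local_ring R \<longleftrightarrow> ring R \<and> ideal (carrier R - Units R) R"


section \<open>Triangulated categories\<close>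

locale linear_category =
  fixes k :: "'k ring" and C :: "('o, 'm, 'k) tri_data"
  assumes hom_vectorspace: "\<lbrakk>X \<in> Obj C; Y \<in> Obj C\<rbrakk> \<Longrightarrow> vectorspace k (Hom C X Y)"
    and idt_closed: "X \<in> Obj C \<Longrightarrow> idt C X \<in> mor C X X"
    and cmp_linear_right:
      "\<lbrakk>X \<in> Obj C; Y \<in> Obj C; Z \<in> Obj C; f \<in> mor C X Y\<rbrakk> \<Longrightarrow>
        (\<lambda>g. f \<cdot>\<^bsub>C\<^esub> g) \<in> LinearCombinations.module_hom k (Hom C Y Z) (Hom C X Z)"
    and cmp_linear_left:
      "\<lbrakk>X \<in> Obj C; Y \<in> Obj C; Z \<in> Obj C; g \<in> mor C Y Z\<rbrakk> \<Longrightarrow>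
        (\<lambda>f. f \<cdot>\<^bsub>C\<^esub> g) \<in> LinearCombinations.module_hom k (Hom C X Y) (Hom C X Z)"
    and cmp_assoc:
      "\<lbrakk>W \<in> Obj C; X \<in> Obj C; Y \<in> Obj C; Z \<in> Obj C;
        f \<in> mor C W X; g \<in> mor C X Y; h \<in> mor C Y Z\<rbrakk> \<Longrightarrow>
        f \<cdot>\<^bsub>C\<^esub> g \<cdot>\<^bsub>C\<^esub> h = f \<cdot>\<^bsub>C\<^esub> (g \<cdot>\<^bsub>C\<^esub> h)"
    and idt_left: "\<lbrakk>X \<in> Obj C; Y \<in> Obj C; f \<in> mor C X Y\<rbrakk> \<Longrightarrow> idt C X \<cdot>\<^bsub>C\<^esub> f = f"
    and idt_right: "\<lbrakk>X \<in> Obj C; Y \<in> Obj C; f \<in> mor C X Y\<rbrakk> \<Longrightarrow> f \<cdot>\<^bsub>C\<^esub> idt C Y = f"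

locale additive_linear_category = linear_category +
  assumes zero_obj_ex: "\<exists>Z. is_zero_obj C Z"
    and biprod_ex:
      "\<lbrakk>X1 \<in> Obj C; X2 \<in> Obj C\<rbrakk> \<Longrightarrow> \<exists>X i1 i2 p1 p2. is_biprod C X X1 X2 i1 i2 p1 p2"

text \<open>The translation is required to be a linear auto-equivalence; a linear automorphism is the
  special case in which \<open>shift C\<close> is bijective on objects.\<close>

locale translation_category = additive_linear_category +
  assumes shift_obj: "X \<in> Obj C \<Longrightarrow> shift C X \<in> Obj C"
    and shift_linear:
      "\<lbrakk>X \<in> Obj C; Y \<in> Obj C\<rbrakk> \<Longrightarrow>
        shift_mor C \<in> LinearCombinations.module_hom k (Hom C X Y) (Hom C (shift C X) (shift C Y))"
    and shift_idt: "X \<in> Obj C \<Longrightarrow> shift_mor C (idt C X) = idt C (shift C X)"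
    and shift_cmp:
      "\<lbrakk>X \<in> Obj C; Y \<in> Obj C; Z \<in> Obj C; f \<in> mor C X Y; g \<in> mor C Y Z\<rbrakk> \<Longrightarrow>
        shift_mor C (f \<cdot>\<^bsub>C\<^esub> g) = shift_mor C f \<cdot>\<^bsub>C\<^esub> shift_mor C g"
    and shift_fully_faithful:
      "\<lbrakk>X \<in> Obj C; Y \<in> Obj C\<rbrakk> \<Longrightarrow>
        bij_betw (shift_mor C) (mor C X Y) (mor C (shift C X) (shift C Y))"
    and shift_ess_surj: "Y \<in> Obj C \<Longrightarrow> \<exists>X \<in> Obj C. isomorphic C (shift C X) Y"

text \<open>Verdier's axioms.\<close>

locale triangulated_category = translation_category +
  assumes tri_closed:
      "Tri C X Y Z f g h \<Longrightarrow>
        X \<in> Obj C \<and> Y \<in> Obj C \<and> Z \<in> Obj C \<and>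
        f \<in> mor C X Y \<and> g \<in> mor C Y Z \<and> h \<in> mor C Z (shift C X)"
    and TR1_iso:
      "\<lbrakk>Tri C X Y Z f g h; X' \<in> Obj C; Y' \<in> Obj C; Z' \<in> Obj C;
        f' \<in> mor C X' Y'; g' \<in> mor C Y' Z'; h' \<in> mor C Z' (shift C X');
        is_iso C X X' u; is_iso C Y Y' v; is_iso C Z Z' w;
        f \<cdot>\<^bsub>C\<^esub> v = u \<cdot>\<^bsub>C\<^esub> f'; g \<cdot>\<^bsub>C\<^esub> w = v \<cdot>\<^bsub>C\<^esub> g';
        h \<cdot>\<^bsub>C\<^esub> shift_mor C u = w \<cdot>\<^bsub>C\<^esub> h'\<rbrakk> \<Longrightarrow>
        Tri C X' Y' Z' f' g' h'"
    and TR1_idt: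
      "\<lbrakk>X \<in> Obj C; is_zero_obj C Z\<rbrakk> \<Longrightarrow>
        Tri C X X Z (idt C X) \<zero>\<^bsub>Hom C X Z\<^esub> \<zero>\<^bsub>Hom C Z (shift C X)\<^esub>"
    and TR1_complete:
      "\<lbrakk>X \<in> Obj C; Y \<in> Obj C; f \<in> mor C X Y\<rbrakk> \<Longrightarrow> \<exists>Z g h. Tri C X Y Z f g h"
    and TR2:
      "\<lbrakk>X \<in> Obj C; Y \<in> Obj C; Z \<in> Obj C;
        f \<in> mor C X Y; g \<in> mor C Y Z; h \<in> mor C Z (shift C X)\<rbrakk> \<Longrightarrow>
        Tri C X Y Z f g h \<longleftrightarrow>
        Tri C Y Z (shift C X) g h (\<ominus>\<^bsub>Hom C (shift C X) (shift C Y)\<^esub> shift_mor C f)"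
    and TR3:
      "\<lbrakk>Tri C X Y Z f g h; Tri C X' Y' Z' f' g' h';
        u \<in> mor C X X'; v \<in> mor C Y Y'; f \<cdot>\<^bsub>C\<^esub> v = u \<cdot>\<^bsub>C\<^esub> f'\<rbrakk> \<Longrightarrow>
        \<exists>w \<in> mor C Z Z'. g \<cdot>\<^bsub>C\<^esub> w = v \<cdot>\<^bsub>C\<^esub> g' \<and>
          h \<cdot>\<^bsub>C\<^esub> shift_mor C u = w \<cdot>\<^bsub>C\<^esub> h'"
    and TR4:
      "\<lbrakk>Tri C X Y Z' f x x'; Tri C Y Z X' g y y'; Tri C X Z Y' (f \<cdot>\<^bsub>C\<^esub> g) z z'\<rbrakk> \<Longrightarrow>
        \<exists>u v. Tri C Z' Y' X' u v (y' \<cdot>\<^bsub>C\<^esub> shift_mor C x) \<and>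
          x \<cdot>\<^bsub>C\<^esub> u = g \<cdot>\<^bsub>C\<^esub> z \<and> u \<cdot>\<^bsub>C\<^esub> z' = x' \<and>
          z \<cdot>\<^bsub>C\<^esub> v = y \<and> v \<cdot>\<^bsub>C\<^esub> y' = z' \<cdot>\<^bsub>C\<^esub> shift_mor C f"


section \<open>The structure constants\<close>

definition hom_bracket :: "('o, 'm, 'k) tri_data \<Rightarrow> 'o \<Rightarrow> 'o \<Rightarrow> rat" where
  "hom_bracket C X Y =
     (\<Prod>i | 0 < i \<and> card (mor C ((shift C ^^ i) X) Y) \<noteq> 1.
        of_nat (card (mor C ((shift C ^^ i) X) Y)) powi ((- 1) ^ i))"

definition tri_W :: "('o, 'm, 'k) tri_data \<Rightarrow> 'o \<Rightarrow> 'o \<Rightarrow> 'o \<Rightarrow> ('m \<times> 'm \<times> 'm) set" where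
  "tri_W C X Y L =
     {(f, g, h). f \<in> mor C X L \<and> g \<in> mor C L Y \<and> h \<in> mor C Y (shift C X) \<and> Tri C X L Y f g h}"

abbreviation Aut :: "('o, 'm, 'k) tri_data \<Rightarrow> 'o \<Rightarrow> 'm monoid" where
  "Aut C X \<equiv> units_of (End_ring C X)"

definition tri_action ::
  "('o, 'm, 'k) tri_data \<Rightarrow> 'o \<Rightarrow> 'o \<Rightarrow> 'm \<times> 'm \<Rightarrow> 'm \<times> 'm \<times> 'm \<Rightarrow> 'm \<times> 'm \<times> 'm" where
  "tri_action C X Y = (\<lambda>(a, c) (f, g, h).
     (a \<cdot>\<^bsub>C\<^esub> f,
      g \<cdot>\<^bsub>C\<^esub> inv\<^bsub>End_ring C Y\<^esub> c,
      c \<cdot>\<^bsub>C\<^esub> h \<cdot>\<^bsub>C\<^esub> inv\<^bsub>End_ring C (shift C X)\<^esub> (shift_mor C a)))"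

definition tri_V :: "('o, 'm, 'k) tri_data \<Rightarrow> 'o \<Rightarrow> 'o \<Rightarrow> 'o \<Rightarrow> ('m \<times> 'm \<times> 'm) set set" where
  "tri_V C X Y L = orbits (Aut C X \<times>\<times> Aut C Y) (tri_W C X Y L) (tri_action C X Y)"

definition radHom :: "('o, 'm, 'k) tri_data \<Rightarrow> 'o \<Rightarrow> 'o \<Rightarrow> 'm set" where
  "radHom C X Y = {f \<in> mor C X Y. \<forall>A. indecomposable C A \<longrightarrow>
     (\<forall>g \<in> mor C A X. \<forall>h \<in> mor C Y A. \<not> is_iso C A A (g \<cdot>\<^bsub>C\<^esub> f \<cdot>\<^bsub>C\<^esub> h))}"

text \<open>
  \<open>is_X1 C X Y \<alpha> X1\<close>: for some representative \<open>(f, g, h)\<close> of the orbit \<open>\<alpha>\<close> there are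
  decompositions \<open>Y = Y1 \<oplus> Y2\<close>, \<open>X = X1 \<oplus> X2\<close> and automorphisms \<open>c\<close>, \<open>a\<close> such that
  \<open>c h (a[1])\<^sup>-\<^sup>1\<close> is diagonal with entries an isomorphism \<open>h11 : Y1 \<rightarrow> X1[1]\<close> and a radical
  morphism \<open>h22 : Y2 \<rightarrow> X2[1]\<close>.  The diagonal matrix is the morphism
  \<open>q1 h11 (i1[1]) + q2 h22 (i2[1])\<close>, for the projections \<open>q1, q2\<close> of \<open>Y\<close> and the
  inclusions \<open>i1, i2\<close> into \<open>X\<close>.
\<close>

definition is_X1 ::
  "('o, 'm, 'k) tri_data \<Rightarrow> 'o \<Rightarrow> 'o \<Rightarrow> ('m \<times> 'm \<times> 'm) set \<Rightarrow> 'o \<Rightarrow> bool" where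
  "is_X1 C X Y \<alpha> X1 \<longleftrightarrow>
     (\<exists>f g h X2 Y1 Y2 i1 i2 p1 p2 j1 j2 q1 q2 a c h11 h22.
        (f, g, h) \<in> \<alpha> \<and>
        is_biprod C X X1 X2 i1 i2 p1 p2 \<and> is_biprod C Y Y1 Y2 j1 j2 q1 q2 \<and>
        a \<in> carrier (Aut C X) \<and> c \<in> carrier (Aut C Y) \<and>
        is_iso C Y1 (shift C X1) h11 \<and> h22 \<in> radHom C Y2 (shift C X2) \<and>
        c \<cdot>\<^bsub>C\<^esub> h \<cdot>\<^bsub>C\<^esub> inv\<^bsub>End_ring C (shift C X)\<^esub> (shift_mor C a) =
          (q1 \<cdot>\<^bsub>C\<^esub> h11 \<cdot>\<^bsub>C\<^esub> shift_mor C i1) \<oplus>\<^bsub>Hom C Y (shift C X)\<^esub>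
          (q2 \<cdot>\<^bsub>C\<^esub> h22 \<cdot>\<^bsub>C\<^esub> shift_mor C i2))"

definition X1_of :: "('o, 'm, 'k) tri_data \<Rightarrow> 'o \<Rightarrow> 'o \<Rightarrow> ('m \<times> 'm \<times> 'm) set \<Rightarrow> 'o" where
  "X1_of C X Y \<alpha> = (SOME X1. is_X1 C X Y \<alpha> X1)"

definition hall_number :: "('o, 'm, 'k) tri_data \<Rightarrow> 'o \<Rightarrow> 'o \<Rightarrow> 'o \<Rightarrow> rat" where
  "hall_number C X Y L = hom_bracket C X Y *
     (\<Sum>\<alpha> \<in> tri_V C X Y L.
        of_nat (card (carrier (End_ring C (X1_of C X Y \<alpha>)))) /
        of_nat (card (carrier (Aut C (X1_of C X Y \<alpha>)))))"


section \<open>The algebra\<close>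

definition iso_rel :: "('o, 'm, 'k) tri_data \<Rightarrow> 'o rel" where
  "iso_rel C = {(X, Y). X \<in> Obj C \<and> Y \<in> Obj C \<and> isomorphic C X Y}"

definition iso_classes :: "('o, 'm, 'k) tri_data \<Rightarrow> 'o set set" where
  "iso_classes C = Obj C // iso_rel C"

definition iso_class :: "('o, 'm, 'k) tri_data \<Rightarrow> 'o \<Rightarrow> 'o set" where
  "iso_class C X = iso_rel C `` {X}"

definition hall_basis :: "('o, 'm, 'k) tri_data \<Rightarrow> 'o \<Rightarrow> 'o set \<Rightarrow>\<^sub>0 rat" where
  "hall_basis C X = Poly_Mapping.single (iso_class C X) 1"

definition class_hall_number ::
  "('o, 'm, 'k) tri_data \<Rightarrow> 'o set \<Rightarrow> 'o set \<Rightarrow> 'o set \<Rightarrow> rat" where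
  "class_hall_number C x y l = hall_number C (SOME X. X \<in> x) (SOME Y. Y \<in> y) (SOME L. L \<in> l)"

text \<open>
  The rational vector space with basis the isomorphism classes is realised by the finitely
  supported functions on \<open>iso_classes C\<close>, and the multiplication is the bilinear extension of the
  formula for basis elements.  If infinitely many structure constants were non-zero, the
  innermost sum would be \<open>0\<close> by the convention for infinite index sets.
\<close>

definition hall_mult ::
  "('o, 'm, 'k) tri_data \<Rightarrow> ('o set \<Rightarrow>\<^sub>0 rat) \<Rightarrow> ('o set \<Rightarrow>\<^sub>0 rat) \<Rightarrow> ('o set \<Rightarrow>\<^sub>0 rat)" where
  "hall_mult C p q =
     (\<Sum>x \<in> Poly_Mapping.keys p. \<Sum>y \<in> Poly_Mapping.keys q.
        \<Sum>l | l \<in> iso_classes C \<and> class_hall_number C x y l \<noteq> 0.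
          Poly_Mapping.single l
            (Poly_Mapping.lookup p x * Poly_Mapping.lookup q y * class_hall_number C x y l))"

definition hall_algebra :: "('o, 'm, 'k) tri_data \<Rightarrow> (rat, 'o set \<Rightarrow>\<^sub>0 rat) module" where
  "hall_algebra C =
     \<lparr>carrier = {p. Poly_Mapping.keys p \<subseteq> iso_classes C},
      monoid.mult = hall_mult C,
      one = hall_basis C (SOME Z. is_zero_obj C Z),
      zero = 0,
      add = (+),
      smult = (\<lambda>r. Poly_Mapping.map ((*) r))\<rparr>"

text \<open>Unlike the library locale \<open>algebra\<close>, this does not require commutativity.\<close>

locale unital_assoc_algebra = vectorspace K A + A: ring A for K and A (structure) +
  assumes smult_mult_left:
      "\<lbrakk>r \<in> carrier K; x \<in> carrier A; y \<in> carrier A\<rbrakk> \<Longrightarrow> (r \<odot> x) \<otimes> y = r \<odot> (x \<otimes> y)"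
    and smult_mult_right:
      "\<lbrakk>r \<in> carrier K; x \<in> carrier A; y \<in> carrier A\<rbrakk> \<Longrightarrow> x \<otimes> (r \<odot> y) = r \<odot> (x \<otimes> y)"

end

theory Submission
  imports Defs
begin

text \<open>
  Write \<open>{X, Y}\<close> for \<open>hom_bracket\<close>.  Let a triangle \<open>X \<rightarrow> L \<rightarrow> Y \<rightarrow> X[1]\<close> with maps
  \<open>f, g, h\<close> represent the orbit \<open>\<alpha>\<close>.  By uniqueness of cones, \<open>\<alpha>\<close> is determined by the
  \<open>Aut X\<close>-orbit of \<open>f\<close>, and likewise by the \<open>Aut Y\<close>-orbit of \<open>g\<close>.  The stabiliser of \<open>f\<close>
  consists of the invertible \<open>1 + a\<close> with \<open>a f = 0\<close>.  These \<open>a\<close> are, up to translation, the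
  \<open>s h\<close> with \<open>s : X[1] \<rightarrow> Y\<close>, and after splitting off the isomorphism part of \<open>h\<close> the
  proportion of \<open>s\<close> with \<open>1 + s h\<close> invertible is \<open>|Aut X1| / |End X1|\<close>.  Since \<open>1 + s h\<close> is
  invertible iff \<open>1 + h s\<close> is, the same proportion governs the stabiliser of \<open>g\<close>.  Long exact
  sequences give \<open>|{a. a f = 0}| = {X, L} / ({X, X} {X, Y})\<close> and its dual, so that
    \<open>F(X, Y; L) = |{f. cone f = Y}| {X, L} / ({X, X} |Aut X|)
                = |{g. cocone g = X}| {L, Y} / ({Y, Y} |Aut Y|)\<close>,
  and the two counts agree orbit by orbit.

  Using the second formula for \<open>F(X, Y; L)\<close> and the first for \<open>F(L, Z; M)\<close>, the coefficient of
  \<open>M\<close> in \<open>(X * Y) * Z\<close> counts maps \<open>L \<rightarrow> M \<oplus> Y\<close> whose components have cone \<open>Z\<close> and cocone \<open>X\<close>.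
  Dually, \<open>X * (Y * Z)\<close> leads to maps \<open>M \<oplus> Y \<rightarrow> L'\<close>.  Opposite sides of a homotopy cartesian
  square have isomorphic cones, so both sides count the same orbits of triangles
  \<open>L \<rightarrow> M \<oplus> Y \<rightarrow> L' \<rightarrow> L[1]\<close>.
\<close>

text \<open>Cones are not functorial, so pairs of triangles cannot be compared directly. Single maps
  are counted instead, because the isomorphism class of the cone is a property of one map. Passing
  from orbits to maps has two costs. Composition with \<open>f\<close> is not injective, and its
  kernel is reached only through the whole long exact sequence; the alternating product {X, Y}
  records the orders along it. And \<open>1 + a\<close> with \<open>a f = 0\<close> need not be
  invertible; the factor |End X1| / |Aut X1| compensates exactly for this. The mixed choice of
  formulas produces {L, Y} {L, M} = {L, M \<oplus> Y}. Up to the constant 1 / ({Y, Y} |Aut Y|), the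
  two sides of associativity are then sums over pairs (L, L') of the two formulas for F(L, L'; M
  \<oplus> Y), restricted to the orbits whose maps have the required cones. This restriction is why
  the counts must be compared orbit by orbit. Decompositions into indecomposables are replaced by
  |End X| as a measure of size.\<close>

lemma card_by_class:
  assumes "finite A" "finite I" "\<And>a. a \<in> A \<Longrightarrow> \<exists>!l. l \<in> I \<and> R a l"
  shows "card A = (\<Sum>l\<in>I. card {a \<in> A. R a l})"
proof -
  have "A = (\<Union>l\<in>I. {a \<in> A. R a l})" using assms(3) by blast
  then have "card A = card (\<Union>l\<in>I. {a \<in> A. R a l})" by (rule arg_cong)
  also have "\<dots> = (\<Sum>l\<in>I. card {a \<in> A. R a l})"
    by (rule card_UN_disjoint) (use assms in auto)
  finally show ?thesis .
qed

lemma card_preimage: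
  assumes "bij_betw \<phi> A B" "S \<subseteq> B"
  shows "card {a \<in> A. \<phi> a \<in> S} = card S"
proof -
  have "bij_betw \<phi> {a \<in> A. \<phi> a \<in> S} S"
    using assms unfolding bij_betw_def inj_on_def by blast
  then show ?thesis by (rule bij_betw_same_card)
qed

lemma card_preimage_Times:
  assumes "bij_betw \<phi> A (B \<times> D)" "S \<subseteq> B" "T \<subseteq> D"
  shows "card {a \<in> A. \<phi> a \<in> S \<times> T} = card S * card T"
  using card_preimage[OF assms(1) Sigma_mono[OF assms(2,3)]] by (simp only: card_cartesian_product)

subsection \<open>Arrows with source and target\<close>

text \<open>Hom-sets need not be disjoint, so a morphism is packed with its source and target; typing
  conditions then become equations between sources and targets that rewriting can discharge.\<close>

datatype ('o, 'm) arrow = Arrow (dm: 'o) (mp: 'm) (cd: 'o)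

lemma arrow_eqI: "dm a = dm b \<Longrightarrow> cd a = cd b \<Longrightarrow> mp a = mp b \<Longrightarrow> a = b"
  by (rule arrow.expand) simp

locale triangulated_arrows = triangulated_category k C
  for k :: "'k ring" and C :: "('o, 'm, 'k) tri_data"
begin

definition arr :: "('o, 'm) arrow \<Rightarrow> bool" where
  "arr a \<longleftrightarrow> dm a \<in> Obj C \<and> cd a \<in> Obj C \<and> mp a \<in> mor C (dm a) (cd a)"

definition comp :: "('o, 'm) arrow \<Rightarrow> ('o, 'm) arrow \<Rightarrow> ('o, 'm) arrow" (infixr \<open>;;\<close> 70) where
  "a ;; b = Arrow (dm a) (mp a \<cdot>\<^bsub>C\<^esub> mp b) (cd b)"

definition plus_arr :: "('o, 'm) arrow \<Rightarrow> ('o, 'm) arrow \<Rightarrow> ('o, 'm) arrow" (infixr \<open>\<boxplus>\<close> 65) where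
  "a \<boxplus> b = Arrow (dm a) (mp a \<oplus>\<^bsub>Hom C (dm a) (cd a)\<^esub> mp b) (cd a)"

definition neg :: "('o, 'm) arrow \<Rightarrow> ('o, 'm) arrow" where
  "neg a = Arrow (dm a) (\<ominus>\<^bsub>Hom C (dm a) (cd a)\<^esub> mp a) (cd a)"

definition zr :: "'o \<Rightarrow> 'o \<Rightarrow> ('o, 'm) arrow" where
  "zr X Y = Arrow X \<zero>\<^bsub>Hom C X Y\<^esub> Y"

definition ident :: "'o \<Rightarrow> ('o, 'm) arrow" where
  "ident X = Arrow X (idt C X) X"

definition sh :: "('o, 'm) arrow \<Rightarrow> ('o, 'm) arrow" where
  "sh a = Arrow (shift C (dm a)) (shift_mor C (mp a)) (shift C (cd a))"

abbreviation typed :: "('o, 'm) arrow \<Rightarrow> 'o \<Rightarrow> 'o \<Rightarrow> bool" (\<open>_ : _ \<rightharpoonup> _\<close> [51, 51, 51] 50) where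
  "a : X \<rightharpoonup> Y \<equiv> arr a \<and> dm a = X \<and> cd a = Y"

definition Mor :: "'o \<Rightarrow> 'o \<Rightarrow> ('o, 'm) arrow set" where
  "Mor X Y = {a. a : X \<rightharpoonup> Y}"

definition tri :: "('o, 'm) arrow \<Rightarrow> ('o, 'm) arrow \<Rightarrow> ('o, 'm) arrow \<Rightarrow> bool" where
  "tri f g h \<longleftrightarrow> arr f \<and> arr g \<and> arr h \<and> dm g = cd f \<and> dm h = cd g \<and> cd h = shift C (dm f) \<and>
     Tri C (dm f) (cd f) (cd g) (mp f) (mp g) (mp h)"

lemma abelian_group_Hom: "X \<in> Obj C \<Longrightarrow> Y \<in> Obj C \<Longrightarrow> abelian_group (Hom C X Y)"
  by (metis Module.module.axioms(2) hom_vectorspace vectorspace.axioms(1))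

lemma cmp_closed:
  "X \<in> Obj C \<Longrightarrow> Y \<in> Obj C \<Longrightarrow> Z \<in> Obj C \<Longrightarrow> f \<in> mor C X Y \<Longrightarrow> g \<in> mor C Y Z \<Longrightarrow> f \<cdot>\<^bsub>C\<^esub> g \<in> mor C X Z"
  using cmp_linear_right[of X Y Z f] unfolding LinearCombinations.module_hom_def by auto

lemma shift_mor_closed:
  "X \<in> Obj C \<Longrightarrow> Y \<in> Obj C \<Longrightarrow> f \<in> mor C X Y \<Longrightarrow> shift_mor C f \<in> mor C (shift C X) (shift C Y)"
  using shift_linear[of X Y] unfolding LinearCombinations.module_hom_def by auto

lemma dm_cd_simps [simp]:
  "dm (a ;; b) = dm a" "cd (a ;; b) = cd b"
  "dm (a \<boxplus> b) = dm a" "cd (a \<boxplus> b) = cd a"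
  "dm (neg a) = dm a" "cd (neg a) = cd a"
  "dm (zr X Y) = X" "cd (zr X Y) = Y"
  "dm (ident X) = X" "cd (ident X) = X"
  "dm (sh a) = shift C (dm a)" "cd (sh a) = shift C (cd a)"
  by (simp_all add: comp_def plus_arr_def neg_def zr_def ident_def sh_def)

lemma arr_obj [simp]: "arr a \<Longrightarrow> dm a \<in> Obj C" "arr a \<Longrightarrow> cd a \<in> Obj C"
  by (simp_all add: arr_def)

declare shift_obj [simp]

lemma arr_comp [simp]: "arr a \<Longrightarrow> arr b \<Longrightarrow> cd a = dm b \<Longrightarrow> arr (a ;; b)"
  by (auto simp del: arr_obj simp: arr_def comp_def intro: cmp_closed)

lemma arr_plus [simp]: "arr a \<Longrightarrow> arr b \<Longrightarrow> dm a = dm b \<Longrightarrow> cd a = cd b \<Longrightarrow> arr (a \<boxplus> b)"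
  by (simp del: arr_obj add: arr_def plus_arr_def abelian_monoid.a_closed abelian_group.axioms(1) abelian_group_Hom)

lemma arr_neg [simp]: "arr a \<Longrightarrow> arr (neg a)"
  by (simp del: arr_obj add: arr_def neg_def abelian_group.a_inv_closed abelian_group_Hom)

lemma arr_zr [simp]: "X \<in> Obj C \<Longrightarrow> Y \<in> Obj C \<Longrightarrow> arr (zr X Y)"
  by (simp del: arr_obj add: arr_def zr_def abelian_monoid.zero_closed abelian_group.axioms(1) abelian_group_Hom)

lemma arr_ident [simp]: "X \<in> Obj C \<Longrightarrow> arr (ident X)"
  by (simp del: arr_obj add: arr_def ident_def idt_closed)

lemma arr_sh [simp]: "arr a \<Longrightarrow> arr (sh a)"
  by (simp del: arr_obj add: arr_def sh_def shift_mor_closed)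

lemma comp_assoc [simp]:
  "arr a \<Longrightarrow> arr b \<Longrightarrow> arr c \<Longrightarrow> cd a = dm b \<Longrightarrow> cd b = dm c \<Longrightarrow> (a ;; b) ;; c = a ;; b ;; c"
  by (auto simp del: arr_obj simp: arr_def comp_def intro: cmp_assoc)

lemma comp_ident [simp]:
  "arr a \<Longrightarrow> X = dm a \<Longrightarrow> ident X ;; a = a"
  "arr a \<Longrightarrow> X = cd a \<Longrightarrow> a ;; ident X = a"
  by (auto simp del: arr_obj simp: arr_def comp_def ident_def idt_left idt_right arrow.collapse)

lemma comp_plus_left:
  assumes "arr a" "arr b" "arr c" "dm a = dm b" "cd a = cd b" "cd a = dm c"
  shows "(a \<boxplus> b) ;; c = a ;; c \<boxplus> b ;; c"
  using assms cmp_linear_left[of "dm a" "cd a" "cd c" "mp c"]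
  by (auto simp del: arr_obj simp: arr_def comp_def plus_arr_def LinearCombinations.module_hom_def)

lemma comp_plus_right:
  assumes "arr a" "arr b" "arr c" "dm b = dm c" "cd b = cd c" "cd a = dm b"
  shows "a ;; (b \<boxplus> c) = a ;; b \<boxplus> a ;; c"
  using assms cmp_linear_right[of "dm a" "cd a" "cd b" "mp a"]
  by (auto simp del: arr_obj simp: arr_def comp_def plus_arr_def LinearCombinations.module_hom_def)

lemma sh_plus:
  assumes "arr a" "arr b" "dm a = dm b" "cd a = cd b"
  shows "sh (a \<boxplus> b) = sh a \<boxplus> sh b"
  using assms shift_linear[of "dm a" "cd a"]
  by (auto simp del: arr_obj simp: arr_def sh_def plus_arr_def LinearCombinations.module_hom_def)

lemma plus_assoc:
  assumes "arr a" "arr b" "arr c" "dm a = dm b" "cd a = cd b" "dm b = dm c" "cd b = cd c"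
  shows "(a \<boxplus> b) \<boxplus> c = a \<boxplus> b \<boxplus> c"
  using assms
  by (simp del: arr_obj add: arr_def plus_arr_def abelian_monoid.a_assoc abelian_group.axioms(1) abelian_group_Hom)

lemma plus_commute:
  assumes "arr a" "arr b" "dm a = dm b" "cd a = cd b"
  shows "a \<boxplus> b = b \<boxplus> a"
  using assms
  by (simp del: arr_obj add: arr_def plus_arr_def abelian_monoid.a_comm abelian_group.axioms(1) abelian_group_Hom)

lemma plus_left_commute:
  assumes "arr a" "arr b" "arr c" "dm a = dm b" "cd a = cd b" "dm b = dm c" "cd b = cd c"
  shows "a \<boxplus> b \<boxplus> c = b \<boxplus> a \<boxplus> c"
  using assms plus_assoc[of a b c] plus_assoc[of b a c] plus_commute[of a b] by simp

lemma plus_zr [simp]: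
  assumes "arr a" "X = dm a" "Y = cd a"
  shows "zr X Y \<boxplus> a = a" "a \<boxplus> zr X Y = a"
  using assms
  by (auto simp del: arr_obj simp: arr_def plus_arr_def zr_def arrow.collapse
      abelian_monoid.l_zero abelian_monoid.r_zero abelian_group.axioms(1) abelian_group_Hom)

lemma plus_neg [simp]:
  assumes "arr a"
  shows "a \<boxplus> neg a = zr (dm a) (cd a)" "neg a \<boxplus> a = zr (dm a) (cd a)"
  using assms
  by (auto simp del: arr_obj simp: arr_def plus_arr_def neg_def zr_def
      abelian_group.r_neg abelian_group.l_neg abelian_group_Hom)

lemma plus_neg_cancel [simp]:
  assumes "arr a" "arr b" "dm a = dm b" "cd a = cd b"
  shows "a \<boxplus> neg a \<boxplus> b = b" "neg a \<boxplus> a \<boxplus> b = b"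
  using assms plus_assoc[of a "neg a" b] plus_assoc[of "neg a" a b] by simp_all

lemma plus_cancel:
  assumes "arr a" "arr b" "arr c" "dm a = dm b" "cd a = cd b" "dm b = dm c" "cd b = cd c"
  shows "a \<boxplus> b = a \<boxplus> c \<longleftrightarrow> b = c"
  using assms plus_neg_cancel(2)[of a b] plus_neg_cancel(2)[of a c] by metis

lemma neg_unique:
  assumes "arr a" "arr b" "dm a = dm b" "cd a = cd b" "a \<boxplus> b = zr (dm a) (cd a)"
  shows "b = neg a"
  using assms plus_neg_cancel(2)[of a b] by simp

lemma neg_neg [simp]: "arr a \<Longrightarrow> neg (neg a) = a"
  using neg_unique[of "neg a" a] by simp

lemma neg_zr [simp]: "X \<in> Obj C \<Longrightarrow> Y \<in> Obj C \<Longrightarrow> neg (zr X Y) = zr X Y"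
  using neg_unique[of "zr X Y" "zr X Y"] by simp

lemma zr_unique: "arr a \<Longrightarrow> a \<boxplus> a = a \<Longrightarrow> a = zr (dm a) (cd a)"
  using plus_neg_cancel(2)[of a a] by simp

lemma comp_zr [simp]:
  assumes "arr a"
  shows "cd a = Y \<Longrightarrow> Z \<in> Obj C \<Longrightarrow> a ;; zr Y Z = zr (dm a) Z"
    and "dm a = Y \<Longrightarrow> X \<in> Obj C \<Longrightarrow> zr X Y ;; a = zr X (cd a)"
proof -
  assume "cd a = Y" "Z \<in> Obj C"
  with assms show "a ;; zr Y Z = zr (dm a) Z"
    using comp_plus_right[of a "zr Y Z" "zr Y Z"] zr_unique[of "a ;; zr Y Z"] by auto
next
  assume "dm a = Y" "X \<in> Obj C"
  with assms show "zr X Y ;; a = zr X (cd a)"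
    using comp_plus_left[of "zr X Y" "zr X Y" a] zr_unique[of "zr X Y ;; a"] by auto
qed

lemma sh_zr [simp]: "X \<in> Obj C \<Longrightarrow> Y \<in> Obj C \<Longrightarrow> sh (zr X Y) = zr (shift C X) (shift C Y)"
  using sh_plus[of "zr X Y" "zr X Y"] zr_unique[of "sh (zr X Y)"] by simp

lemma neg_comp [simp]:
  assumes "arr a" "arr b" "cd a = dm b"
  shows "neg a ;; b = neg (a ;; b)" "a ;; neg b = neg (a ;; b)"
  using assms neg_unique[of "a ;; b" "neg a ;; b"] neg_unique[of "a ;; b" "a ;; neg b"]
    comp_plus_left[of a "neg a" b] comp_plus_right[of a b "neg b"] by simp_all

lemma neg_plus:
  assumes "arr a" "arr b" "dm a = dm b" "cd a = cd b"
  shows "neg (a \<boxplus> b) = neg a \<boxplus> neg b"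
proof -
  have "(a \<boxplus> b) \<boxplus> neg a \<boxplus> neg b = b \<boxplus> neg b"
    using assms plus_commute[of a b] by (simp add: plus_assoc)
  then show ?thesis
    using assms neg_unique[of "a \<boxplus> b" "neg a \<boxplus> neg b"] by simp
qed

lemma neg_eq_zr [simp]: "arr a \<Longrightarrow> X = dm a \<Longrightarrow> Y = cd a \<Longrightarrow> neg a = zr X Y \<longleftrightarrow> a = zr X Y"
  by (metis neg_neg neg_zr arr_obj)

lemmas distribs = comp_plus_left comp_plus_right sh_plus neg_plus
lemma sh_comp [simp]: "arr a \<Longrightarrow> arr b \<Longrightarrow> cd a = dm b \<Longrightarrow> sh (a ;; b) = sh a ;; sh b"
  by (auto simp del: arr_obj simp: arr_def comp_def sh_def intro: shift_cmp)

lemma sh_ident [simp]: "X \<in> Obj C \<Longrightarrow> sh (ident X) = ident (shift C X)"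
  by (simp add: ident_def sh_def shift_idt)

text \<open>Full faithfulness is given for bare morphisms; it is conjugated by the bijections that
  pack them with their endpoints.\<close>

lemma sh_bij: "X \<in> Obj C \<Longrightarrow> Y \<in> Obj C \<Longrightarrow> bij_betw sh (Mor X Y) (Mor (shift C X) (shift C Y))"
proof -
  assume XY: "X \<in> Obj C" "Y \<in> Obj C"
  have "bij_betw (\<lambda>f. Arrow Z f Z') (mor C Z Z') (Mor Z Z')" if "Z \<in> Obj C" "Z' \<in> Obj C" for Z Z'
    by (rule bij_betw_byWitness[where f' = mp])
      (use that in \<open>auto simp: Mor_def arr_def simp del: arr_obj\<close>)
  from bij_betw_trans[OF bij_betw_trans[OF bij_betw_inv_into[OF this[OF XY]] shift_fully_faithful[OF XY]] this]
  have *: "bij_betw ((\<lambda>f. Arrow (shift C X) f (shift C Y)) \<circ> (shift_mor C \<circ> inv_into (mor C X Y) (\<lambda>f. Arrow X f Y)))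
      (Mor X Y) (Mor (shift C X) (shift C Y))"
    using XY by (simp add: o_assoc)
  show ?thesis
  proof (rule bij_betw_cong[THEN iffD1, OF _ *])
    fix a assume a: "a \<in> Mor X Y"
    have "inv_into (mor C X Y) (\<lambda>f. Arrow X f Y) (Arrow X (mp a) Y) = mp a"
      by (rule inv_into_f_f) (use a in \<open>auto simp: inj_on_def Mor_def arr_def simp del: arr_obj\<close>)
    moreover have "(Arrow X (mp a) Y) = a" using a arrow.collapse[of a] by (simp add: Mor_def)
    ultimately show "((\<lambda>f. Arrow (shift C X) f (shift C Y)) \<circ> (shift_mor C \<circ> inv_into (mor C X Y) (\<lambda>f. Arrow X f Y))) a = sh a"
      using a by (simp add: sh_def Mor_def)
  qed
qed

lemma sh_inj: "arr a \<Longrightarrow> arr b \<Longrightarrow> dm a = dm b \<Longrightarrow> cd a = cd b \<Longrightarrow> sh a = sh b \<longleftrightarrow> a = b"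
  using sh_bij[of "dm a" "cd a"] unfolding bij_betw_def inj_on_def Mor_def by auto

lemma sh_full:
  assumes "X \<in> Obj C" "Y \<in> Obj C" "b : shift C X \<rightharpoonup> shift C Y"
  obtains a where "a : X \<rightharpoonup> Y" "sh a = b"
proof -
  have "b \<in> sh ` Mor X Y"
    using sh_bij[OF assms(1,2)] assms(3) by (simp add: bij_betw_def Mor_def)
  then show thesis using that by (auto simp: Mor_def)
qed

section \<open>Invertible arrows\<close>

definition iso :: "('o, 'm) arrow \<Rightarrow> bool" where
  "iso a \<longleftrightarrow> arr a \<and> (\<exists>b. b : cd a \<rightharpoonup> dm a \<and> a ;; b = ident (dm a) \<and> b ;; a = ident (cd a))"

definition inverse :: "('o, 'm) arrow \<Rightarrow> ('o, 'm) arrow" where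
  "inverse a = (SOME b. b : cd a \<rightharpoonup> dm a \<and> a ;; b = ident (dm a) \<and> b ;; a = ident (cd a))"

lemma isoI: "a : X \<rightharpoonup> Y \<Longrightarrow> b : Y \<rightharpoonup> X \<Longrightarrow> a ;; b = ident X \<Longrightarrow> b ;; a = ident Y \<Longrightarrow> iso a"
  by (auto simp: iso_def)

lemma iso_arr [simp]: "iso a \<Longrightarrow> arr a"
  by (simp add: iso_def)

lemma inverse_props:
  assumes "iso a"
  shows "inverse a : cd a \<rightharpoonup> dm a \<and> a ;; inverse a = ident (dm a) \<and> inverse a ;; a = ident (cd a)"
  using assms unfolding iso_def inverse_def by (rule_tac someI_ex) blast

lemma inverse_simps [simp]:
  assumes "iso a"
  shows "arr (inverse a)" "dm (inverse a) = cd a" "cd (inverse a) = dm a"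
    "a ;; inverse a = ident (dm a)" "inverse a ;; a = ident (cd a)"
    "arr b \<Longrightarrow> dm b = dm a \<Longrightarrow> a ;; inverse a ;; b = b"
    "arr b \<Longrightarrow> dm b = cd a \<Longrightarrow> inverse a ;; a ;; b = b"
  using inverse_props[OF assms] comp_assoc[of a "inverse a" b] comp_assoc[of "inverse a" a b] assms
  by simp_all

lemma iso_inverse [simp]: "iso a \<Longrightarrow> iso (inverse a)"
  by (rule isoI[of _ "cd a" "dm a" a]) simp_all

lemma iso_ident [simp]: "X \<in> Obj C \<Longrightarrow> iso (ident X)"
  by (rule isoI[of _ X X "ident X"]) simp_all

lemma iso_comp [simp]: "iso a \<Longrightarrow> iso b \<Longrightarrow> cd a = dm b \<Longrightarrow> iso (a ;; b)"
  by (rule isoI[of _ "dm a" "cd b" "inverse b ;; inverse a"]) simp_all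

lemma iso_neg [simp]: "iso a \<Longrightarrow> iso (neg a)"
  by (rule isoI[of _ "dm a" "cd a" "neg (inverse a)"]) simp_all

lemma iso_sh [simp]: "arr a \<Longrightarrow> iso (sh a) \<longleftrightarrow> iso a"
proof
  assume a: "arr a" "iso (sh a)"
  obtain b where b: "b : cd a \<rightharpoonup> dm a" "sh b = inverse (sh a)"
    using sh_full[of "cd a" "dm a" "inverse (sh a)"] a by auto
  have "sh (a ;; b) = sh (ident (dm a))" "sh (b ;; a) = sh (ident (cd a))"
    using a b by simp_all
  then show "iso a" using a(1) b(1) by (auto simp: sh_inj simp del: sh_comp sh_ident intro!: isoI[of a "dm a" "cd a" b])
next
  assume "arr a" "iso a"
  then show "iso (sh a)"
    by (intro isoI[of _ "shift C (dm a)" "shift C (cd a)" "sh (inverse a)"]) (simp_all flip: sh_comp)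
qed

lemma inverse_unique:
  assumes "arr a" "b : cd a \<rightharpoonup> dm a" "a ;; b = ident (dm a)" "b ;; a = ident (cd a)"
  shows "inverse a = b"
proof -
  have i: "iso a" using assms by (intro isoI[of a "dm a" "cd a" b]) auto
  have "inverse a = inverse a ;; (a ;; b)" using assms i by simp
  also have "\<dots> = b" using assms(1,2) i by simp
  finally show ?thesis .
qed

lemma inverse_sh: "iso a \<Longrightarrow> inverse (sh a) = sh (inverse a)"
  by (rule inverse_unique) (simp_all flip: sh_comp)

text \<open>\<open>a\<close> acquires the right inverse \<open>r\<close> and the left inverse
  \<open>l\<close>, and the two agree by associativity.\<close>

lemma iso_from_both:
  assumes "arr a" "b : cd a \<rightharpoonup> dm a" "iso (a ;; b)" "iso (b ;; a)"
  shows "iso a"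
proof -
  define r where "r = b ;; inverse (a ;; b)"
  define l where "l = inverse (b ;; a) ;; b"
  have r: "r : cd a \<rightharpoonup> dm a" "a ;; r = ident (dm a)"
    using assms inverse_simps(4)[OF assms(3)] comp_assoc[of a b "inverse (a ;; b)"] by (simp_all add: r_def del: comp_assoc)
  have l: "l : cd a \<rightharpoonup> dm a" "l ;; a = ident (cd a)"
    using assms inverse_simps(5)[OF assms(4)] by (simp_all add: l_def)
  have "l = l ;; (a ;; r)" using r l assms(1) by simp
  also have "\<dots> = r" using r(1) l assms(1) comp_assoc[of l a r] by simp
  finally show ?thesis using r l assms(1) by (intro isoI[of a "dm a" "cd a" r]) auto
qed

text \<open>With \<open>u\<close> the inverse of \<open>1 + a b\<close>, the inverse of
  \<open>1 + b a\<close> is \<open>1 - b u a\<close>. The exchange moves questions of invertibility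
  between an object and its summand, and between the two ends of \<open>h\<close>.\<close>

lemma iso_one_plus_swap:
  assumes "a : X \<rightharpoonup> Y" "b : Y \<rightharpoonup> X" "iso (ident X \<boxplus> a ;; b)"
  shows "iso (ident Y \<boxplus> b ;; a)"
proof -
  define u where "u = inverse (ident X \<boxplus> a ;; b)"
  have [simp]: "X \<in> Obj C" "Y \<in> Obj C" using assms by auto
  note [simp] = assms(1,2)
  have u: "u : X \<rightharpoonup> X" using assms by (simp add: u_def)
  note [simp] = u
  have "(ident X \<boxplus> a ;; b) ;; u = ident X" "u ;; (ident X \<boxplus> a ;; b) = ident X"
    using inverse_simps(4,5)[OF assms(3)] by (simp_all add: u_def)
  then have e: "u \<boxplus> a ;; b ;; u = ident X" "u \<boxplus> u ;; a ;; b = ident X"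
    by (simp_all add: distribs)
  \<comment> \<open>Sandwiched between \<open>b\<close> and \<open>a\<close>, the equations for
    \<open>u\<close> reduce both products below to \<open>1 + b a - b a\<close>.\<close>
  have e1: "b ;; u ;; a \<boxplus> b ;; a ;; b ;; u ;; a = b ;; a"
    using arg_cong[OF e(1), of "\<lambda>x. b ;; x ;; a"] by (simp add: distribs)
  have e2: "b ;; u ;; a \<boxplus> b ;; u ;; a ;; b ;; a = b ;; a"
    using arg_cong[OF e(2), of "\<lambda>x. b ;; x ;; a"] by (simp add: distribs)
  have "(ident Y \<boxplus> b ;; a) ;; (ident Y \<boxplus> neg (b ;; u ;; a))
      = (ident Y \<boxplus> b ;; a) \<boxplus> neg (b ;; u ;; a \<boxplus> b ;; a ;; b ;; u ;; a)"
    by (simp add: comp_plus_left comp_plus_right neg_plus plus_assoc)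
  moreover have "(ident Y \<boxplus> neg (b ;; u ;; a)) ;; (ident Y \<boxplus> b ;; a)
      = (ident Y \<boxplus> b ;; a) \<boxplus> neg (b ;; u ;; a \<boxplus> b ;; u ;; a ;; b ;; a)"
    using plus_left_commute[of "neg (b ;; u ;; a)" "b ;; a" "neg (b ;; u ;; a ;; b ;; a)"]
    by (simp add: comp_plus_left comp_plus_right neg_plus plus_assoc)
  ultimately show ?thesis
    unfolding e1 e2 by (intro isoI[of _ Y Y "ident Y \<boxplus> neg (b ;; u ;; a)"]) (simp_all add: plus_assoc)
qed

subsection \<open>Triangles\<close>

lemma neg_inj: "arr a \<Longrightarrow> arr b \<Longrightarrow> dm a = dm b \<Longrightarrow> cd a = cd b \<Longrightarrow> neg a = neg b \<longleftrightarrow> a = b"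
  using neg_neg[of a] neg_neg[of b] by metis

lemma arr_Arrow: "arr (Arrow X f Y) \<longleftrightarrow> X \<in> Obj C \<and> Y \<in> Obj C \<and> f \<in> mor C X Y"
  by (simp add: arr_def)

lemma arrow_cases:
  assumes "a : X \<rightharpoonup> Y"
  shows "a = Arrow X (mp a) Y" "X \<in> Obj C" "Y \<in> Obj C" "mp a \<in> mor C X Y"
  using assms by (auto simp: arr_def simp del: arr_obj)

lemma is_iso_iff:
  assumes "X \<in> Obj C" "Y \<in> Obj C"
  shows "is_iso C X Y f \<longleftrightarrow> iso (Arrow X f Y)"
proof
  assume "is_iso C X Y f"
  then obtain g where g: "f \<in> mor C X Y" "g \<in> mor C Y X" "f \<cdot>\<^bsub>C\<^esub> g = idt C X" "g \<cdot>\<^bsub>C\<^esub> f = idt C Y"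
    unfolding is_iso_def by blast
  then show "iso (Arrow X f Y)"
    using assms by (intro isoI[of _ X Y "Arrow Y g X"]) (simp_all add: arr_Arrow comp_def ident_def)
next
  assume i: "iso (Arrow X f Y)"
  let ?g = "inverse (Arrow X f Y)"
  have "?g : Y \<rightharpoonup> X" using inverse_simps(1-3)[OF i] by simp
  then have "mp ?g \<in> mor C Y X" using arrow_cases(4) by blast
  moreover have "f \<cdot>\<^bsub>C\<^esub> mp ?g = idt C X" "mp ?g \<cdot>\<^bsub>C\<^esub> f = idt C Y"
    using inverse_simps(4,5)[OF i] by (simp_all add: comp_def ident_def)
  moreover have "f \<in> mor C X Y" using iso_arr[OF i] by (simp add: arr_Arrow)
  ultimately show "is_iso C X Y f" unfolding is_iso_def by blast
qed

lemma iso_is_iso: "iso a \<Longrightarrow> is_iso C (dm a) (cd a) (mp a)"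
  by (simp add: is_iso_iff)

lemma isomorphic_iff:
  assumes "X \<in> Obj C" "Y \<in> Obj C"
  shows "isomorphic C X Y \<longleftrightarrow> (\<exists>a. iso a \<and> dm a = X \<and> cd a = Y)"
proof
  assume "isomorphic C X Y"
  then show "\<exists>a. iso a \<and> dm a = X \<and> cd a = Y"
    unfolding isomorphic_def is_iso_iff[OF assms] by (metis arrow.sel(1,3))
next
  assume "\<exists>a. iso a \<and> dm a = X \<and> cd a = Y"
  then show "isomorphic C X Y" unfolding isomorphic_def using iso_is_iso by blast
qed

lemma tri_typed:
  assumes "tri f g h"
  shows "arr f" "arr g" "arr h" "dm g = cd f" "dm h = cd g" "cd h = shift C (dm f)"
  using assms by (simp_all add: tri_def)

lemma tri_rotate: "tri f g h \<Longrightarrow> tri g h (neg (sh f))"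
  unfolding tri_def
  using TR2[of "dm f" "cd f" "cd g" "mp f" "mp g" "mp h"]
  by (auto simp: arr_def neg_def sh_def shift_mor_closed abelian_group.a_inv_closed abelian_group_Hom
      simp del: arr_obj)

lemma tri_unrotate:
  assumes "arr f" "cd f = dm g" "cd h = shift C (dm f)" "tri g h (neg (sh f))"
  shows "tri f g h"
  using assms TR2[of "dm f" "cd f" "cd g" "mp f" "mp g" "mp h"]
  unfolding tri_def
  by (auto simp: arr_def neg_def sh_def simp del: arr_obj)

lemma tri_iso:
  assumes "tri f g h" "f' : X \<rightharpoonup> Y" "g' : Y \<rightharpoonup> Z" "h' : Z \<rightharpoonup> shift C X"
    and "iso u" "iso v" "iso w" "dm u = dm f" "cd u = X" "dm v = cd f" "cd v = Y" "dm w = cd g" "cd w = Z"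
    and "f ;; v = u ;; f'" "g ;; w = v ;; g'" "h ;; sh u = w ;; h'"
  shows "tri f' g' h'"
proof -
  have *: "Tri C (dm f) (cd f) (cd g) (mp f) (mp g) (mp h)" using assms(1) by (simp add: tri_def)
  have "Tri C X Y Z (mp f') (mp g') (mp h')"
    by (rule TR1_iso[OF *, of _ _ _ _ _ _ "mp u" "mp v" "mp w"])
      (use assms arrow_cases(4)[OF assms(2)] arrow_cases(4)[OF assms(3)] arrow_cases(4)[OF assms(4)]
        iso_is_iso[of u] iso_is_iso[of v] iso_is_iso[of w] in \<open>auto simp: comp_def sh_def\<close>)
  then show ?thesis using assms by (simp add: tri_def)
qed

lemma tri_ident:
  assumes "X \<in> Obj C" "is_zero_obj C Z"
  shows "tri (ident X) (zr X Z) (zr Z (shift C X))"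
  using TR1_idt[OF assms] assms by (simp add: tri_def is_zero_obj_def) (simp add: ident_def zr_def)

lemma tri_complete:
  assumes "arr f"
  obtains g h where "tri f g h"
proof -
  obtain Z g h where T: "Tri C (dm f) (cd f) Z (mp f) g h"
    using TR1_complete[of "dm f" "cd f" "mp f"] assms by (auto simp: arr_def simp del: arr_obj)
  have "tri f (Arrow (cd f) g Z) (Arrow Z h (shift C (dm f)))"
    using tri_closed[OF T] T assms by (simp add: tri_def arr_Arrow)
  then show thesis by (rule that)
qed

lemma tri_morphism:
  assumes "tri f g h" "tri f' g' h'" "u : dm f \<rightharpoonup> dm f'" "v : cd f \<rightharpoonup> cd f'" "f ;; v = u ;; f'"
  obtains w where "w : cd g \<rightharpoonup> cd g'" "g ;; w = v ;; g'" "h ;; sh u = w ;; h'"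
proof -
  have "\<exists>w \<in> mor C (cd g) (cd g'). mp g \<cdot>\<^bsub>C\<^esub> w = mp v \<cdot>\<^bsub>C\<^esub> mp g' \<and>
      mp h \<cdot>\<^bsub>C\<^esub> shift_mor C (mp u) = w \<cdot>\<^bsub>C\<^esub> mp h'"
    by (rule TR3[of "dm f" "cd f" _ "mp f" _ _ "dm f'" "cd f'" _ "mp f'"])
      (use assms arrow_cases(4)[OF assms(3)] arrow_cases(4)[OF assms(4)] in \<open>auto simp: tri_def comp_def\<close>)
  then obtain w where w: "w \<in> mor C (cd g) (cd g')" "mp g \<cdot>\<^bsub>C\<^esub> w = mp v \<cdot>\<^bsub>C\<^esub> mp g'"
      "mp h \<cdot>\<^bsub>C\<^esub> shift_mor C (mp u) = w \<cdot>\<^bsub>C\<^esub> mp h'" by blast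
  show thesis
    by (rule that[of "Arrow (cd g) w (cd g')"])
      (use assms w in \<open>simp_all add: arr_Arrow comp_def sh_def tri_def\<close>)
qed

lemma tri_octahedron:
  assumes "tri f x x'" "tri g y y'" "tri (f ;; g) z z'" "cd f = dm g"
  obtains u v where "tri u v (y' ;; sh x)" "dm u = cd x" "cd u = cd z" "cd v = cd y"
proof -
  have "\<exists>u v. Tri C (cd x) (cd z) (cd y) u v (mp y' \<cdot>\<^bsub>C\<^esub> shift_mor C (mp x))"
    using TR4[of "dm f" "cd f" "cd x" "mp f" "mp x" "mp x'" "cd g" "cd y" "mp g" "mp y" "mp y'" "cd z" "mp z" "mp z'"]
      assms by (auto simp: tri_def comp_def)
  then obtain u v where uv: "Tri C (cd x) (cd z) (cd y) u v (mp y' \<cdot>\<^bsub>C\<^esub> shift_mor C (mp x))" by blast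
  show thesis
    by (rule that[of "Arrow (cd x) u (cd z)" "Arrow (cd z) v (cd y)"])
      (use assms uv tri_closed[OF uv] in \<open>simp_all add: arr_Arrow tri_def, simp add: comp_def sh_def\<close>)
qed

section \<open>Zero objects and exactness along a triangle\<close>

lemma zero_obj_obj: "is_zero_obj C Z \<Longrightarrow> Z \<in> Obj C"
  by (simp add: is_zero_obj_def)

lemma zero_obj_arrow:
  assumes "is_zero_obj C Z" "arr a"
  shows "dm a = Z \<Longrightarrow> a = zr Z (cd a)" "cd a = Z \<Longrightarrow> a = zr (dm a) Z"
proof -
  assume [simp]: "dm a = Z"
  have "zr Z (cd a) = a"
    using assms(1,2) zero_obj_obj[OF assms(1)] arrow_cases(4)[of "zr Z (cd a)" Z "cd a"] arrow_cases(4)[of a Z "cd a"]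
    by (intro arrow_eqI) (simp_all, metis is_zero_obj_def arr_obj(2))
  then show "a = zr Z (cd a)" ..
next
  assume [simp]: "cd a = Z"
  have "zr (dm a) Z = a"
    using assms(1,2) zero_obj_obj[OF assms(1)] arrow_cases(4)[of "zr (dm a) Z" "dm a" Z] arrow_cases(4)[of a "dm a" Z]
    by (intro arrow_eqI) (simp_all, metis is_zero_obj_def arr_obj(1))
  then show "a = zr (dm a) Z" ..
qed

lemma zero_objI:
  assumes "Z \<in> Obj C" "ident Z = zr Z Z"
  shows "is_zero_obj C Z"
proof -
  have *: "a = zr Z (cd a)" if "arr a" "dm a = Z" for a
  proof -
    have "a = ident Z ;; a" using that by simp
    then show ?thesis unfolding assms(2) using that assms(1) by simp
  qed
  have **: "a = zr (dm a) Z" if "arr a" "cd a = Z" for a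
  proof -
    have "a = a ;; ident Z" using that by simp
    then show ?thesis unfolding assms(2) using that assms(1) by simp
  qed
  have "f = mp (zr Z X)" if "X \<in> Obj C" "f \<in> mor C Z X" for f X
    using *[of "Arrow Z f X"] that assms by (simp add: arr_Arrow zr_def)
  moreover have "f = mp (zr X Z)" if "X \<in> Obj C" "f \<in> mor C X Z" for f X
    using **[of "Arrow X f Z"] that assms by (simp add: arr_Arrow zr_def)
  moreover have "mp (zr Z X) \<in> mor C Z X" "mp (zr X Z) \<in> mor C X Z" if "X \<in> Obj C" for X
    using arrow_cases(4)[of "zr Z X" Z X] arrow_cases(4)[of "zr X Z" X Z] that assms by auto
  ultimately show ?thesis
    using assms(1) unfolding is_zero_obj_def by blast
qed

lemma zero_obj_iff: "is_zero_obj C Z \<longleftrightarrow> Z \<in> Obj C \<and> ident Z = zr Z Z"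
  using zero_objI zero_obj_arrow(1)[of Z "ident Z"] zero_obj_obj by auto

lemma zero_obj_shift: "is_zero_obj C Z \<Longrightarrow> is_zero_obj C (shift C Z)"
  unfolding zero_obj_iff by (metis sh_ident sh_zr shift_obj)

text \<open>The triangle \<open>X \<rightarrow> X \<rightarrow> 0\<close> maps to the given one by
  the identity and \<open>f\<close>; the map between the third terms factors \<open>f ;; g\<close>
  through a zero object.\<close>

lemma tri_zero:
  assumes "tri f g h"
  shows "f ;; g = zr (dm f) (cd g)"
proof -
  note T = tri_typed[OF assms]
  note [simp] = T
  obtain Z where Z: "is_zero_obj C Z" using zero_obj_ex by blast
  note [simp] = zero_obj_obj[OF Z]
  obtain w where w: "w : Z \<rightharpoonup> cd g" "zr (dm f) Z ;; w = f ;; g"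
    using tri_morphism[OF tri_ident[OF _ Z, of "dm f"] assms, of "ident (dm f)" f] by auto
  then show ?thesis using comp_zr(2)[of w Z "dm f"] by simp
qed

text \<open>Exactness of Hom(T, -) at the middle term. \<open>b\<close> and a zero map go from the
  rotated trivial triangle \<open>T \<rightarrow> 0 \<rightarrow> T[1]\<close> to the rotated given
  triangle; the third component, brought back along the full functor \<open>shift\<close>, is the
  lift.\<close>

lemma tri_lift:
  assumes "tri f g h" "arr b" "cd b = cd f" "b ;; g = zr (dm b) (cd g)"
  obtains a where "a : dm b \<rightharpoonup> dm f" "a ;; f = b"
proof -
  note T = tri_typed[OF assms(1)]
  note [simp] = T assms(2,3,4)
  obtain Z where Z: "is_zero_obj C Z" using zero_obj_ex by blast
  note [simp] = zero_obj_obj[OF Z]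
  have 1: "tri (zr (dm b) Z) (zr Z (shift C (dm b))) (neg (sh (ident (dm b))))"
    using tri_rotate[OF tri_ident[OF _ Z, of "dm b"]] by simp
  obtain w where w: "w : shift C (dm b) \<rightharpoonup> shift C (dm f)"
      "neg (sh (ident (dm b))) ;; sh b = w ;; neg (sh f)"
    using tri_morphism[OF 1 tri_rotate[OF assms(1)], of b "zr Z (cd g)"] by auto
  obtain a where a: "a : dm b \<rightharpoonup> dm f" "sh a = w"
    using sh_full[of "dm b" "dm f" w] w by auto
  have "sh b = w ;; sh f" using w by (simp add: neg_inj)
  then have "sh b = sh (a ;; f)" using a by simp
  then show thesis using a by (intro that[of a]) (simp_all add: sh_inj del: sh_comp)
qed

text \<open>The contravariant counterpart, tested against the triangle
  \<open>0 \<rightarrow> T \<rightarrow> T \<rightarrow> 0[1]\<close>, whose third component is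
  itself the extension.\<close>

lemma tri_colift:
  assumes "tri f g h" "arr b" "dm b = cd f" "f ;; b = zr (dm f) (cd b)"
  obtains c where "c : cd g \<rightharpoonup> cd b" "g ;; c = b"
proof -
  note T = tri_typed[OF assms(1)]
  note [simp] = T assms(2,3,4)
  obtain Z where Z: "is_zero_obj C Z" using zero_obj_ex by blast
  note [simp] = zero_obj_obj[OF Z]
  \<comment> \<open>The last term must be literally \<open>shift C Z\<close>, so the identity
    triangle is taken with the zero object \<open>shift C Z\<close> before it is rotated
    back.\<close>
  have 1: "tri (zr Z (cd b)) (ident (cd b)) (zr (cd b) (shift C Z))"
    by (rule tri_unrotate) (use tri_ident[OF _ zero_obj_shift[OF Z], of "cd b"] in simp_all)
  obtain w where w: "w : cd g \<rightharpoonup> cd b" "g ;; w = b ;; ident (cd b)"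
    by (rule tri_morphism[OF assms(1) 1, of "zr (dm f) Z" b]) simp_all
  then have "g ;; w = b" by simp
  with w(1) show thesis by (rule that)
qed

section \<open>Uniqueness of cones and cocones\<close>

lemma square_zero_iso:
  assumes "d : X \<rightharpoonup> X" "d ;; d = zr X X"
  shows "iso (ident X \<boxplus> d)"
proof -
  have [simp]: "X \<in> Obj C" using assms by auto
  show ?thesis
    using assms plus_left_commute[of "neg d" "d" "zr X X"]
    by (intro isoI[of _ X X "ident X \<boxplus> neg d"]) (simp_all add: comp_plus_left comp_plus_right plus_assoc)
qed

text \<open>The difference \<open>d\<close> between \<open>e\<close> and the identity is killed by
  \<open>g\<close> and by \<open>h\<close>, so it factors both as \<open>h ;; s\<close> and as
  \<open>t ;; g\<close>; hence \<open>d ;; d = t ;; g ;; h ;; s = 0\<close>. This takes the place of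
  the five lemma.\<close>

lemma tri_endo_iso:
  assumes "tri f g h" "e : cd g \<rightharpoonup> cd g" "g ;; e = g" "e ;; h = h"
  shows "iso e"
proof -
  note T = tri_typed[OF assms(1)]
  note [simp] = T
  define d where "d = neg (ident (cd g)) \<boxplus> e"
  have d: "d : cd g \<rightharpoonup> cd g" "ident (cd g) \<boxplus> d = e"
    using assms(2) by (simp_all add: d_def)
  have "g ;; d = zr (cd f) (cd g)" "d ;; h = zr (cd g) (cd h)"
    using assms(2-4) by (simp_all add: d_def distribs)
  then have gd: "g ;; d = zr (dm g) (cd d)" and dh: "d ;; h = zr (dm d) (cd h)" using d by simp_all
  obtain s where s: "s : cd h \<rightharpoonup> cd g" "h ;; s = d"
    using tri_colift[OF tri_rotate[OF assms(1)] _ _ gd] d(1) by (metis T(4))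
  obtain t where t: "t : cd g \<rightharpoonup> cd f" "t ;; g = d"
    using tri_lift[OF tri_rotate[OF assms(1)] _ _ dh] d(1) by (metis T(4))
  have "d ;; d = (t ;; g) ;; h ;; s" using s(2) t(2) by simp
  also have "\<dots> = t ;; (g ;; h) ;; s" using s(1) t(1) by simp
  also have "\<dots> = zr (cd g) (cd g)"
    unfolding tri_zero[OF tri_rotate[OF assms(1)]] using s(1) t(1) by simp
  finally show ?thesis using square_zero_iso[OF d(1)] d(2) by simp
qed

text \<open>TR3 over identities gives comparison maps in both directions. They need not be mutually
  inverse, but both composites are invertible by \<open>tri_endo_iso\<close>.\<close>

lemma cone_unique:
  assumes "tri f g h" "tri f g' h'"
  obtains c where "iso c" "dm c = cd g" "cd c = cd g'" "g ;; c = g'" "c ;; h' = h"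
proof -
  note T = tri_typed[OF assms(1)] tri_typed[OF assms(2)]
  note [simp] = T
  obtain w where w: "w : cd g \<rightharpoonup> cd g'" "g ;; w = g'" "h = w ;; h'"
    using tri_morphism[OF assms, of "ident (dm f)" "ident (cd f)"] by auto
  obtain w' where w': "w' : cd g' \<rightharpoonup> cd g" "g' ;; w' = g" "h' = w' ;; h"
    using tri_morphism[OF assms(2,1), of "ident (dm f)" "ident (cd f)"] by auto
  have "iso (w ;; w')"
  proof (rule tri_endo_iso[OF assms(1)])
    show "g ;; w ;; w' = g" using w w' comp_assoc[of g w w'] by (simp del: comp_assoc)
    have "(w ;; w') ;; h = w ;; w' ;; h" using w(1) w'(1) by simp
    then show "(w ;; w') ;; h = h" using w(3) w'(3) by metis
  qed (use w w' in simp)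
  moreover have "iso (w' ;; w)"
  proof (rule tri_endo_iso[OF assms(2)])
    show "g' ;; w' ;; w = g'" using w w' comp_assoc[of g' w' w] by (simp del: comp_assoc)
    have "(w' ;; w) ;; h' = w' ;; w ;; h'" using w(1) w'(1) by simp
    then show "(w' ;; w) ;; h' = h'" using w(3) w'(3) by metis
  qed (use w w' in simp)
  ultimately have "iso w" using w w' by (intro iso_from_both[of w w']) simp_all
  then show thesis using w that[of w] by simp
qed

lemma tri_replace_cone:
  assumes "tri f g h" "iso c" "dm c = cd g"
  shows "tri f (g ;; c) (inverse c ;; h)"
proof -
  note [simp] = tri_typed[OF assms(1)] assms(2,3)
  show ?thesis
    by (rule tri_iso[OF assms(1), of _ "dm f" "cd f" _ "cd c" _ "ident (dm f)" "ident (cd f)" c])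
      simp_all
qed

lemma tri_replace_cocone:
  assumes "tri f g h" "iso a" "cd a = dm f"
  shows "tri (a ;; f) g (h ;; inverse (sh a))"
proof -
  note [simp] = tri_typed[OF assms(1)] assms(2,3)
  have [simp]: "inverse (sh a) = sh (inverse a)" by (simp add: inverse_sh)
  show ?thesis
    by (rule tri_iso[OF assms(1), of _ "dm a" "cd f" _ "cd g" _ "inverse a" "ident (cd f)" "ident (cd g)"])
      simp_all
qed

lemma tri_replace_middle:
  assumes "tri f g h" "iso b" "dm b = cd f"
  shows "tri (f ;; b) (inverse b ;; g) h"
proof -
  note [simp] = tri_typed[OF assms(1)] assms(2,3)
  show ?thesis
    by (rule tri_iso[OF assms(1), of _ "dm f" "cd b" _ "cd g" _ "ident (dm f)" b "ident (cd g)"])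
      simp_all
qed

text \<open>Since the last two maps of a triangle determine the first up to an automorphism, this is
  the uniqueness of cones applied to the rotated triangles.\<close>

lemma cocone_unique:
  assumes "tri f g h" "tri f' g h'" 
  obtains a where "iso a" "dm a = dm f'" "cd a = dm f" "f' = a ;; f" 
proof -
  note [simp] = tri_typed[OF assms(1)] tri_typed[OF assms(2)]
  have 1: "cd f' = cd f" using tri_typed(4)[OF assms(1)] tri_typed(4)[OF assms(2)] by simp
  obtain c where c: "iso c" "dm c = cd h'" "cd c = cd h" "h' ;; c = h" "c ;; neg (sh f) = neg (sh f')"
    using cone_unique[OF tri_rotate[OF assms(2)] tri_rotate[OF assms(1)]] by blast
  obtain a where a: "a : dm f' \<rightharpoonup> dm f" "sh a = c"
    using sh_full[of "dm f'" "dm f" c] c by auto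
  have "iso a" using a c iso_sh[of a] by simp
  moreover have "c ;; sh f = sh f'" using c 1 by (simp add: neg_inj)
  then have "sh (a ;; f) = sh f'" using a by simp
  then have "f' = a ;; f" using a 1 by (simp add: sh_inj del: sh_comp)
  ultimately show thesis using a that[of a] by simp
qed

section \<open>Biproducts, split triangles and homotopy cartesian squares\<close>

definition biprod :: "'o \<Rightarrow> 'o \<Rightarrow> 'o \<Rightarrow> ('o, 'm) arrow \<Rightarrow> ('o, 'm) arrow \<Rightarrow> ('o, 'm) arrow \<Rightarrow> ('o, 'm) arrow \<Rightarrow> bool" where
  "biprod X A B i1 i2 p1 p2 \<longleftrightarrow>
     i1 : A \<rightharpoonup> X \<and> i2 : B \<rightharpoonup> X \<and> p1 : X \<rightharpoonup> A \<and> p2 : X \<rightharpoonup> B \<and>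
     i1 ;; p1 = ident A \<and> i2 ;; p2 = ident B \<and> i1 ;; p2 = zr A B \<and> i2 ;; p1 = zr B A \<and>
     p1 ;; i1 \<boxplus> p2 ;; i2 = ident X"

lemma is_biprod_iff:
  "is_biprod C X A B i1 i2 p1 p2 \<longleftrightarrow> biprod X A B (Arrow A i1 X) (Arrow B i2 X) (Arrow X p1 A) (Arrow X p2 B)"
  unfolding is_biprod_def biprod_def
  by (auto simp: arr_Arrow comp_def ident_def zr_def plus_arr_def)

lemma biprodD:
  assumes "biprod X A B i1 i2 p1 p2"
  shows "i1 : A \<rightharpoonup> X" "i2 : B \<rightharpoonup> X" "p1 : X \<rightharpoonup> A" "p2 : X \<rightharpoonup> B"
    "i1 ;; p1 = ident A" "i2 ;; p2 = ident B" "i1 ;; p2 = zr A B" "i2 ;; p1 = zr B A"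
    "p1 ;; i1 \<boxplus> p2 ;; i2 = ident X" "X \<in> Obj C" "A \<in> Obj C" "B \<in> Obj C"
  using assms unfolding biprod_def by auto

lemma biprod_is_biprod:
  assumes "biprod X A B i1 i2 p1 p2"
  shows "is_biprod C X A B (mp i1) (mp i2) (mp p1) (mp p2)"
  unfolding is_biprod_iff
  using assms arrow_cases(1)[OF biprodD(1)[OF assms]] arrow_cases(1)[OF biprodD(2)[OF assms]]
    arrow_cases(1)[OF biprodD(3)[OF assms]] arrow_cases(1)[OF biprodD(4)[OF assms]] by simp

lemma biprod_exists:
  assumes "A \<in> Obj C" "B \<in> Obj C"
  obtains X i1 i2 p1 p2 where "biprod X A B i1 i2 p1 p2"
  using biprod_ex[OF assms] unfolding is_biprod_iff by blast

lemma biprod_swap: "biprod X A B i1 i2 p1 p2 \<Longrightarrow> biprod X B A i2 i1 p2 p1"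
  unfolding biprod_def using plus_commute[of "p1 ;; i1" "p2 ;; i2"] by auto

lemma biprod_comp [simp]:
  assumes "biprod X A B i1 i2 p1 p2" "arr a"
  shows "dm a = A \<Longrightarrow> i1 ;; p1 ;; a = a" "dm a = B \<Longrightarrow> i2 ;; p2 ;; a = a"
    "dm a = B \<Longrightarrow> i1 ;; p2 ;; a = zr A (cd a)" "dm a = A \<Longrightarrow> i2 ;; p1 ;; a = zr B (cd a)"
  using biprodD[OF assms(1)] assms(2) comp_assoc[of i1 p1 a] comp_assoc[of i2 p2 a]
    comp_assoc[of i1 p2 a] comp_assoc[of i2 p1 a] by simp_all

text \<open>The complement is the cone of \<open>i\<close>. Since \<open>i\<close> is split, the
  connecting map \<open>r\<close> vanishes, so the identity of the cone lifts along
  \<open>q\<close>.\<close>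

lemma split_mono_biprod:
  assumes "i : A \<rightharpoonup> X" "p : X \<rightharpoonup> A" "i ;; p = ident A"
  obtains B j q where "biprod X A B i j p q" "tri i q (zr B (shift C A))"
proof -
  obtain q r where T: "tri i q r" using tri_complete assms(1) by blast
  have [simp]: "X \<in> Obj C" "A \<in> Obj C" using assms by auto
  note [simp] = assms tri_typed[OF T]
  define B where "B = cd q"
  have [simp]: "cd q = B" "B \<in> Obj C" using tri_typed(2)[OF T] arr_obj(2) by (auto simp: B_def)
  have iq [simp]: "i ;; q = zr A B" using tri_zero[OF T] by simp
  have "neg (r ;; sh i) = zr B (shift C X)" using tri_zero[OF tri_rotate[OF tri_rotate[OF T]]] by simp
  then have ri: "r ;; sh i = zr B (shift C X)" by simp
  have ship: "sh i ;; sh p = ident (shift C A)" using sh_comp[of i p] by simp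
  have "r = r ;; sh i ;; sh p" unfolding ship by simp
  also have "\<dots> = (r ;; sh i) ;; sh p" by simp
  also have "\<dots> = zr B (shift C A)" unfolding ri by simp
  finally have r: "r = zr B (shift C A)" .
  obtain j0 where j0: "j0 : B \<rightharpoonup> X" "j0 ;; q = ident B"
    using tri_lift[OF tri_rotate[OF T], of "ident B"] by (simp add: r) blast
  \<comment> \<open>An arbitrary section \<open>j0\<close> of \<open>q\<close> is corrected by its
    component along \<open>i\<close>, so that \<open>p\<close> kills it.\<close>
  define j where "j = j0 \<boxplus> neg (j0 ;; p ;; i)"
  have j [simp]: "j : B \<rightharpoonup> X" "j ;; q = ident B" "j ;; p = zr B A"
    using j0 by (simp_all add: j_def comp_plus_left)
  \<comment> \<open>\<open>e\<close> measures the failure of the two idempotents to add up to the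
    identity. It is killed by \<open>q\<close>, so it factors through \<open>i\<close>; it is killed
    by \<open>p\<close>, so that factor vanishes.\<close>
  define e where "e = neg (p ;; i \<boxplus> q ;; j) \<boxplus> ident X"
  have e: "e : X \<rightharpoonup> X" by (simp add: e_def)
  have "e ;; q = zr X B" "e ;; p = zr X A" by (simp_all add: e_def comp_plus_left)
  then obtain s where s: "s : X \<rightharpoonup> A" "s ;; i = e"
    using tri_lift[OF T, of e] e by simp blast
  have "s = s ;; i ;; p" using s by simp
  also have "\<dots> = e ;; p" using s(1) by (simp flip: s(2))
  also have "\<dots> = zr X A" by fact
  finally have "e = zr X X" using s(1) by (simp flip: s(2))
  then have "p ;; i \<boxplus> q ;; j = ident X"
    using plus_neg_cancel(1)[of "p ;; i \<boxplus> q ;; j" "ident X"] by (simp add: e_def)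
  then have "biprod X A B i j p q" unfolding biprod_def by simp
  then show thesis using that[of B j q] T by (simp add: r)
qed

text \<open>The complement produced by \<open>split_mono_biprod\<close> need not be the given
  \<open>B\<close>. Both idempotents \<open>q ;; j\<close> and \<open>p2 ;; i2\<close> are the
  identity minus \<open>p1 ;; i1\<close>, so \<open>j ;; p2\<close> identifies the complements and
  carries the triangle over.\<close>

lemma biprod_tri:
  assumes "biprod X A B i1 i2 p1 p2"
  shows "tri i1 p2 (zr B (shift C A))"
proof -
  note [simp] = biprodD[OF assms] biprod_comp[OF assms]
  obtain B' j q where bp: "biprod X A B' i1 j p1 q" and T: "tri i1 q (zr B' (shift C A))"
    using split_mono_biprod[of i1 A X p1] by auto
  note [simp] = biprodD[OF bp] biprod_comp[OF bp]
  have "p1 ;; i1 \<boxplus> q ;; j = p1 ;; i1 \<boxplus> p2 ;; i2" by simp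
  then have 1: "q ;; j = p2 ;; i2" by (subst (asm) plus_cancel) simp_all
  have 2: "q ;; j ;; p2 = p2"
    using arg_cong[OF 1, of "\<lambda>x. x ;; p2"] by simp
  have "i2 ;; q ;; j ;; p2 = ident B" by (simp add: 2)
  moreover have "(j ;; p2) ;; i2 ;; q = ident B'"
  proof -
    have "(j ;; p2) ;; i2 ;; q = j ;; (p2 ;; i2) ;; q" by simp
    also have "\<dots> = ident B'" unfolding 1[symmetric] by simp
    finally show ?thesis .
  qed
  ultimately have "iso (j ;; p2)" by (intro isoI[of _ B' B "i2 ;; q"]) simp_all
  from tri_replace_cone[OF T this]
  have "tri i1 p2 (inverse (j ;; p2) ;; zr B' (shift C A))" using 2 by simp
  then show ?thesis using \<open>iso (j ;; p2)\<close> inverse_simps(1-3)[OF \<open>iso (j ;; p2)\<close>] by simp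
qed

lemma biprod_shift:
  assumes "biprod X A B i1 i2 p1 p2"
  shows "biprod (shift C X) (shift C A) (shift C B) (sh i1) (sh i2) (sh p1) (sh p2)"
proof -
  note [simp] = biprodD[OF assms]
  have "sh p1 ;; sh i1 \<boxplus> sh p2 ;; sh i2 = sh (p1 ;; i1 \<boxplus> p2 ;; i2)"
    by (subst sh_plus) (simp_all del: biprodD(9)[OF assms])
  then show ?thesis unfolding biprod_def by (simp flip: sh_comp)
qed

text \<open>The octahedron on \<open>a\<close> followed by the split epimorphism \<open>p1\<close>,
  whose cone is \<open>Y[1]\<close>, yields a triangle ending in the negative of the shift of
  \<open>i2 ;; b\<close>. Rotated back, it shows that the cone of \<open>a ;; p1\<close> is a cone
  of \<open>i2 ;; b\<close>. As \<open>a ;; b = 0\<close>, the square formed by the components only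
  anticommutes, but cones do not see signs.\<close>

lemma homotopy_cartesian_cone:
  assumes "biprod E M Y i1 i2 p1 p2" "tri a b c" "cd a = E"
  shows "(\<exists>g h. tri (a ;; p1) g h \<and> cd g = Z) \<longleftrightarrow> (\<exists>g h. tri (i2 ;; b) g h \<and> cd g = Z)"
proof -
  note [simp] = biprodD[OF assms(1)] biprod_comp[OF assms(1)] tri_typed[OF assms(2)] assms(3)
  have imp: "\<exists>g' h'. tri (i2 ;; b) g' h' \<and> cd g' = cd g" if T: "tri (a ;; p1) g h" for g h
  proof -
    have "tri p1 (zr M (shift C Y)) (neg (sh i2))"
      by (rule tri_rotate[OF biprod_tri[OF biprod_swap[OF assms(1)]]])
    from tri_octahedron[OF assms(2) this T] obtain u v where
      uv: "tri u v (neg (sh i2) ;; sh b)" "dm u = cd b" "cd u = cd g" "cd v = shift C Y" by auto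
    have "tri (i2 ;; b) u v" by (rule tri_unrotate) (use uv in simp_all)
    then show ?thesis using uv(3) by blast
  qed
  show ?thesis
  proof
    assume "\<exists>g h. tri (a ;; p1) g h \<and> cd g = Z"
    then show "\<exists>g h. tri (i2 ;; b) g h \<and> cd g = Z" using imp by blast
  next
    assume "\<exists>g h. tri (i2 ;; b) g h \<and> cd g = Z"
    then obtain g h where gh: "tri (i2 ;; b) g h" "cd g = Z" by blast
    \<comment> \<open>The converse reuses the first direction for an arbitrary cone of
      \<open>a ;; p1\<close>, which uniqueness of cones then identifies with
      \<open>Z\<close>.\<close>
    obtain g' h' where T: "tri (a ;; p1) g' h'" using tri_complete[of "a ;; p1"] by auto
    obtain g'' h'' where T2: "tri (i2 ;; b) g'' h''" "cd g'' = cd g'" using imp[OF T] by blast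
    obtain u where "iso u" "dm u = cd g'" "cd u = Z" using cone_unique[OF T2(1) gh(1)] gh(2) T2(2) by metis
    then show "\<exists>g h. tri (a ;; p1) g h \<and> cd g = Z"
      using tri_replace_cone[OF T, of u] by (intro exI[of _ "g' ;; u"] exI) auto
  qed
qed

text \<open>Rotation turns a cocone \<open>X\<close> into a cone \<open>X[1]\<close>, so statements
  on cones cover cocones as well. On the way back the sign in \<open>sh f = neg h\<close> cancels
  that of the rotation.\<close>

lemma cocone_iff_cone:
  assumes "arr u" "X \<in> Obj C"
  shows "(\<exists>f h. tri f u h \<and> dm f = X) \<longleftrightarrow> (\<exists>g h. tri u g h \<and> cd g = shift C X)"
proof
  assume "\<exists>f h. tri f u h \<and> dm f = X"
  then show "\<exists>g h. tri u g h \<and> cd g = shift C X" using tri_rotate tri_typed(6) by blast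
next
  assume "\<exists>g h. tri u g h \<and> cd g = shift C X"
  then obtain g h where T: "tri u g h" "cd g = shift C X" by blast
  note [simp] = tri_typed[OF T(1)] T(2)
  obtain f where f: "f : X \<rightharpoonup> dm u" "sh f = neg h"
    using sh_full[of X "dm u" "neg h"] assms by auto
  have "tri f u g"
  proof (rule tri_unrotate)
    have "neg (sh f) = h" unfolding f(2) by simp
    then show "tri u g (neg (sh f))" using T(1) by metis
  qed (use f(1) in simp_all)
  then show "\<exists>f h. tri f u h \<and> dm f = X" using f by blast
qed

lemma homotopy_cartesian_cocone:
  assumes "biprod E M Y i1 i2 p1 p2" "tri a b c" "cd a = E" "X \<in> Obj C"
  shows "(\<exists>f h. tri f (a ;; p2) h \<and> dm f = X) \<longleftrightarrow> (\<exists>f h. tri f (i1 ;; b) h \<and> dm f = X)"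
  using homotopy_cartesian_cone[OF biprod_swap[OF assms(1)] assms(2,3), of "shift C X"]
    cocone_iff_cone[of "a ;; p2" X] cocone_iff_cone[of "i1 ;; b" X] assms biprodD[OF assms(1)] tri_typed[OF assms(2)]
  by simp

end

subsection \<open>The radical\<close>

text \<open>The numerical form of the hypotheses: over a finite field, finite dimension makes
  hom-sets finite, and summability of the dimensions leaves exactly one map out of every high
  shift.\<close>

locale finitary_triangulated = triangulated_arrows k C
  for k :: "'k ring" and C :: "('o, 'm, 'k) tri_data" +
  assumes finite_mor: "X \<in> Obj C \<Longrightarrow> Y \<in> Obj C \<Longrightarrow> finite (mor C X Y)"
    and local_End: "indecomposable C X \<Longrightarrow> local_ring (End_ring C X)"
    and vanishing: "X \<in> Obj C \<Longrightarrow> Y \<in> Obj C \<Longrightarrow> \<exists>N. \<forall>n\<ge>N. card (mor C ((shift C ^^ n) X) Y) = 1"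
begin

lemma in_Mor [simp]: "a \<in> Mor X Y \<longleftrightarrow> a : X \<rightharpoonup> Y"
  by (simp add: Mor_def)

lemma mor_Mor_bij:
  assumes "X \<in> Obj C" "Y \<in> Obj C"
  shows "bij_betw (\<lambda>f. Arrow X f Y) (mor C X Y) (Mor X Y)"
  by (rule bij_betw_byWitness[where f' = mp]) (use assms in \<open>auto simp: arr_def simp del: arr_obj\<close>)

lemma card_Mor: "X \<in> Obj C \<Longrightarrow> Y \<in> Obj C \<Longrightarrow> card (mor C X Y) = card (Mor X Y)"
  using bij_betw_same_card[OF mor_Mor_bij] .

lemma finite_Mor [simp]: "finite (Mor X Y)"
proof (cases "X \<in> Obj C \<and> Y \<in> Obj C")
  case True
  then show ?thesis using bij_betw_finite[OF mor_Mor_bij] finite_mor by blast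
next
  case False
  then have "Mor X Y = {}" by auto
  then show ?thesis by simp
qed

lemma card_Mor_pos: "X \<in> Obj C \<Longrightarrow> Y \<in> Obj C \<Longrightarrow> 0 < card (Mor X Y)"
  using in_Mor[of "zr X Y" X Y] by (auto simp: card_gt_0_iff simp del: in_Mor)

lemma End_ring_simps [simp]:
  "carrier (End_ring C X) = mor C X X" "x \<otimes>\<^bsub>End_ring C X\<^esub> y = x \<cdot>\<^bsub>C\<^esub> y" "\<one>\<^bsub>End_ring C X\<^esub> = idt C X"
  "x \<oplus>\<^bsub>End_ring C X\<^esub> y = x \<oplus>\<^bsub>Hom C X X\<^esub> y"
  by (simp_all add: End_ring_def)

lemma Units_End_ring: "X \<in> Obj C \<Longrightarrow> f \<in> Units (End_ring C X) \<longleftrightarrow> iso (Arrow X f X)"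
  unfolding is_iso_iff[symmetric] Units_def is_iso_def by auto

text \<open>If \<open>r\<close> and \<open>1 + r\<close> were both non-units, their difference
  \<open>1\<close> would lie in the ideal of non-units.\<close>

lemma local_one_plus:
  assumes "indecomposable C X" "r : X \<rightharpoonup> X" "\<not> iso r"
  shows "iso (ident X \<boxplus> r)"
proof (rule ccontr)
  assume n: "\<not> iso (ident X \<boxplus> r)"
  let ?R = "End_ring C X" and ?I = "carrier (End_ring C X) - Units (End_ring C X)"
  have [simp]: "X \<in> Obj C" using assms(1) by (simp add: indecomposable_def)
  interpret additive_subgroup ?I ?R
    using local_End[OF assms(1)] ideal.axioms(1) unfolding local_ring_def by blast
  have nonunit: "mp a \<in> ?I \<longleftrightarrow> \<not> iso a" if a: "a : X \<rightharpoonup> X" for a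
    using arrow_cases[OF a] Units_End_ring[of X "mp a"] by simp
  have r: "ident X \<boxplus> r : X \<rightharpoonup> X" "neg r : X \<rightharpoonup> X" using assms(2) by simp_all
  have "\<not> iso (neg r)" using iso_neg[of "neg r"] assms(2,3) by auto
  with n have "mp (ident X \<boxplus> r) \<oplus>\<^bsub>?R\<^esub> mp (neg r) \<in> ?I"
    using nonunit[OF r(1)] nonunit[OF r(2)] by (intro a_closed) simp_all
  then have "mp ((ident X \<boxplus> r) \<boxplus> neg r) \<in> ?I" using assms(2) by (simp add: plus_arr_def)
  moreover have "(ident X \<boxplus> r) \<boxplus> neg r = ident X" using assms(2) by (simp add: plus_assoc)
  ultimately show False using nonunit[of "ident X"] by simp
qed

definition rad :: "('o, 'm) arrow \<Rightarrow> bool" where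
  "rad r \<longleftrightarrow> arr r \<and> (\<forall>A g h. indecomposable C A \<longrightarrow> g : A \<rightharpoonup> dm r \<longrightarrow> h : cd r \<rightharpoonup> A \<longrightarrow>
     \<not> iso (g ;; r ;; h))"

lemma radHom_iff:
  assumes "X \<in> Obj C" "Y \<in> Obj C"
  shows "f \<in> radHom C X Y \<longleftrightarrow> rad (Arrow X f Y)"
proof
  assume f: "f \<in> radHom C X Y"
  then have a: "arr (Arrow X f Y)" using assms by (simp add: radHom_def arr_Arrow)
  have "\<not> iso (g ;; Arrow X f Y ;; h)" if A: "indecomposable C A" and g: "g : A \<rightharpoonup> X" and h: "h : Y \<rightharpoonup> A" for A g h
  proof
    assume "iso (g ;; Arrow X f Y ;; h)"
    then have "iso ((g ;; Arrow X f Y) ;; h)" using a g h by simp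
    then have "is_iso C A A (mp g \<cdot>\<^bsub>C\<^esub> f \<cdot>\<^bsub>C\<^esub> mp h)"
      using iso_is_iso[of "(g ;; Arrow X f Y) ;; h"] g h by (simp add: comp_def)
    then show False using f A arrow_cases(4)[OF g] arrow_cases(4)[OF h] unfolding radHom_def by blast
  qed
  then show "rad (Arrow X f Y)" using a by (simp add: rad_def)
next
  assume r: "rad (Arrow X f Y)"
  then have a: "arr (Arrow X f Y)" by (simp add: rad_def)
  have "\<not> is_iso C A A (g \<cdot>\<^bsub>C\<^esub> f \<cdot>\<^bsub>C\<^esub> h)" if A: "indecomposable C A" and g: "g \<in> mor C A X" and h: "h \<in> mor C Y A" for A g h
  proof
    assume i: "is_iso C A A (g \<cdot>\<^bsub>C\<^esub> f \<cdot>\<^bsub>C\<^esub> h)"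
    have o: "A \<in> Obj C" using A by (simp add: indecomposable_def)
    have t: "Arrow A g X : A \<rightharpoonup> X" "Arrow Y h A : Y \<rightharpoonup> A" using g h o assms by (simp_all add: arr_Arrow)
    have "iso ((Arrow A g X ;; Arrow X f Y) ;; Arrow Y h A)"
      using i unfolding is_iso_iff[OF o o] by (simp add: comp_def)
    then show False using r A t a by (simp add: rad_def)
  qed
  then show "f \<in> radHom C X Y" using a by (auto simp: radHom_def arr_Arrow)
qed

lemma rad_comp_left:
  assumes "rad r" "arr a" "cd a = dm r"
  shows "rad (a ;; r)"
proof -
  have [simp]: "arr r" using assms(1) by (simp add: rad_def)
  have "\<not> iso (g ;; (a ;; r) ;; h)" if "indecomposable C A" "g : A \<rightharpoonup> dm a" "h : cd r \<rightharpoonup> A" for A g h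
  proof -
    have "\<not> iso ((g ;; a) ;; r ;; h)"
      using assms that unfolding rad_def by (metis arr_comp dm_cd_simps(1,2))
    then show ?thesis using assms that by simp
  qed
  then show ?thesis using assms by (simp add: rad_def)
qed

lemma rad_comp_right:
  assumes "rad r" "arr b" "cd r = dm b"
  shows "rad (r ;; b)"
proof -
  have [simp]: "arr r" using assms(1) by (simp add: rad_def)
  have "\<not> iso (g ;; (r ;; b) ;; h)" if "indecomposable C A" "g : A \<rightharpoonup> dm r" "h : cd b \<rightharpoonup> A" for A g h
  proof -
    have "\<not> iso (g ;; r ;; (b ;; h))"
      using assms that unfolding rad_def by (metis arr_comp dm_cd_simps(1,2))
    then show ?thesis using assms that by simp
  qed
  then show ?thesis using assms by (simp add: rad_def)
qed

lemma rad_arr [simp]: "rad r \<Longrightarrow> arr r"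
  by (simp add: rad_def)

section \<open>Endomorphism sets as a measure of size\<close>

lemma retract_inj:
  assumes "i : A \<rightharpoonup> X" "p : X \<rightharpoonup> A" "i ;; p = ident A"
  shows "inj_on (\<lambda>a. p ;; a ;; i) (Mor A A)"
proof (rule inj_on_inverseI[where g = "\<lambda>b. i ;; b ;; p"])
  fix a assume "a \<in> Mor A A"
  moreover have "i ;; p ;; a = a" if "a : A \<rightharpoonup> A" for a
    using comp_assoc[of i p a] assms that by simp
  ultimately show "i ;; (p ;; a ;; i) ;; p = a" using assms by simp
qed

lemma retract_card_le:
  assumes "i : A \<rightharpoonup> X" "p : X \<rightharpoonup> A" "i ;; p = ident A"
  shows "card (Mor A A) \<le> card (Mor X X)"
  by (rule card_inj_on_le[OF retract_inj[OF assms]]) (use assms in auto)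

text \<open>Extension by zero embeds the endomorphisms of a summand and never reaches the identity
  when the complement is non-zero. This strict drop makes |End X| usable for induction.\<close>

lemma summand_card_less:
  assumes "biprod X A B i1 i2 p1 p2" "\<not> is_zero_obj C B"
  shows "card (Mor A A) < card (Mor X X)"
proof -
  note [simp] = biprodD[OF assms(1)] biprod_comp[OF assms(1)]
  have "p1 ;; a ;; i1 \<noteq> ident X" if "a : A \<rightharpoonup> A" for a
  proof
    assume eq: "p1 ;; a ;; i1 = ident X"
    have "ident B = i2 ;; (p1 ;; a ;; i1) ;; p2" unfolding eq by simp
    also have "\<dots> = zr B B" using that by simp
    finally show False using assms(2) by (simp add: zero_obj_iff)
  qed
  then have "(\<lambda>a. p1 ;; a ;; i1) ` Mor A A \<subseteq> Mor X X - {ident X}" by auto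
  moreover have "card ((\<lambda>a. p1 ;; a ;; i1) ` Mor A A) = card (Mor A A)"
    by (rule card_image[OF retract_inj]) simp_all
  ultimately have "card (Mor A A) \<le> card (Mor X X - {ident X})"
    by (metis card_mono finite_Diff finite_Mor)
  also have "\<dots> < card (Mor X X)" by (rule card_Diff1_less) simp_all
  finally show ?thesis .
qed

text \<open>Radical endomorphisms are quasi-regular. For \<open>X = A \<oplus> B\<close> the sum
  \<open>1 + r\<close> equals \<open>u (1 + inverse u r p2 i2)\<close> with
  \<open>u = 1 + r p1 i1\<close>. Exchanging the order of composition turns each of the two into the
  identity plus a radical endomorphism of the smaller \<open>A\<close> or \<open>B\<close>.\<close>

lemma rad_one_plus:
  assumes "rad r" "dm r = X" "cd r = X"
  shows "iso (ident X \<boxplus> r)"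
  using assms
proof (induction "card (Mor X X)" arbitrary: X r rule: less_induct)
  case less
  note [simp] = less.prems(2,3) rad_arr[OF less.prems(1)]
  have [simp]: "X \<in> Obj C" using arr_obj(1)[OF rad_arr[OF less.prems(1)]] by simp
  consider "is_zero_obj C X" | "indecomposable C X" | "\<not> is_zero_obj C X" "\<not> indecomposable C X" by blast
  then show ?case
  proof cases
    case 1
    then have "ident X \<boxplus> r = ident X"
      using zero_obj_arrow(1)[of X "ident X \<boxplus> r"] zero_obj_arrow(1)[of X "ident X"] by simp
    then show ?thesis by simp
  next
    case 2
    have "\<not> iso (ident X ;; r ;; ident X)"
      using less.prems(1) 2 unfolding rad_def by (metis \<open>X \<in> Obj C\<close> arr_ident dm_cd_simps(9,10) less.prems(2,3))
    then show ?thesis using 2 by (intro local_one_plus) simp_all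
  next
    case 3
    then obtain A B i1 i2 p1 p2 where bp: "biprod X A B i1 i2 p1 p2" and nz: "\<not> is_zero_obj C A" "\<not> is_zero_obj C B"
      unfolding indecomposable_def is_biprod_iff using \<open>X \<in> Obj C\<close> by metis
    note [simp] = biprodD[OF bp] biprod_comp[OF bp]
    have less_A: "card (Mor A A) < card (Mor X X)" by (rule summand_card_less[OF bp nz(2)])
    have less_B: "card (Mor B B) < card (Mor X X)" by (rule summand_card_less[OF biprod_swap[OF bp] nz(1)])
    have rA: "rad (i1 ;; r ;; p1)"
      using less.prems(1) by (intro rad_comp_left rad_comp_right) simp_all
    have "iso (ident A \<boxplus> i1 ;; (r ;; p1))"
      using less.hyps[OF less_A rA] by simp
    then have u: "iso (ident X \<boxplus> (r ;; p1) ;; i1)"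
      by (intro iso_one_plus_swap[of i1 A X "r ;; p1"]) simp_all
    define u where "u = ident X \<boxplus> (r ;; p1) ;; i1"
    have [simp]: "u : X \<rightharpoonup> X" "iso u" using u by (simp_all add: u_def)
    have rB: "rad (i2 ;; inverse u ;; r ;; p2)"
      using less.prems(1) by (intro rad_comp_left rad_comp_right) simp_all
    have "iso (ident B \<boxplus> i2 ;; (inverse u ;; r ;; p2))"
      using less.hyps[OF less_B rB] by simp
    then have v: "iso (ident X \<boxplus> (inverse u ;; r ;; p2) ;; i2)"
      by (intro iso_one_plus_swap[of i2 B X "inverse u ;; r ;; p2"]) simp_all
    have "r = r ;; (p1 ;; i1 \<boxplus> p2 ;; i2)" by simp
    also have "\<dots> = r ;; p1 ;; i1 \<boxplus> r ;; p2 ;; i2" by (rule comp_plus_right) simp_all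
    finally have "ident X \<boxplus> r = ident X \<boxplus> (r ;; p1 ;; i1 \<boxplus> r ;; p2 ;; i2)" by simp
    also have "\<dots> = u \<boxplus> r ;; p2 ;; i2" by (simp add: u_def plus_assoc)
    also have "\<dots> = u ;; (ident X \<boxplus> (inverse u ;; r ;; p2) ;; i2)" by (simp add: comp_plus_right)
    finally show ?thesis using v by simp
  qed
qed

lemma iso_plus_rad:
  assumes "iso u" "rad r" "dm u = X" "cd u = X" "dm r = X" "cd r = X"
  shows "iso (u \<boxplus> r)"
proof -
  note [simp] = assms
  have "X \<in> Obj C" using arr_obj(1)[OF iso_arr[OF assms(1)]] by simp
  have "iso (ident X \<boxplus> inverse u ;; r)" by (intro rad_one_plus rad_comp_left) simp_all
  then have "iso (u ;; (ident X \<boxplus> inverse u ;; r))" using \<open>X \<in> Obj C\<close> by simp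
  also have "u ;; (ident X \<boxplus> inverse u ;; r) = u \<boxplus> r" using \<open>X \<in> Obj C\<close> by (simp add: comp_plus_right)
  finally show ?thesis .
qed

lemma rad_neg: "rad r \<Longrightarrow> rad (neg r)"
  using rad_comp_right[of r "neg (ident (cd r))"] by simp

lemma iso_plus_rad_iff:
  assumes "u : X \<rightharpoonup> X" "rad r" "dm r = X" "cd r = X"
  shows "iso (u \<boxplus> r) \<longleftrightarrow> iso u"
proof
  assume "iso (u \<boxplus> r)"
  then have "iso ((u \<boxplus> r) \<boxplus> neg r)" using assms rad_neg[OF assms(2)]
    by (intro iso_plus_rad[of "u \<boxplus> r" "neg r" X]) simp_all
  also have "(u \<boxplus> r) \<boxplus> neg r = u" using assms by (simp add: plus_assoc)
  finally show "iso u" .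
qed (use assms iso_plus_rad in auto)

text \<open>A remaining block that is not radical lets an indecomposable \<open>A\<close> split off.
  As \<open>A\<close> is isomorphic to some \<open>B[1]\<close>, the object \<open>B\<close> can be
  adjoined to \<open>X1\<close>, which enlarges the isomorphism part.\<close>

lemma larger_iso_part:
  assumes h: "h : Y \<rightharpoonup> shift C X"
    and bX: "biprod X X1 X2 i1 i2 p1 p2" and bY: "biprod Y (shift C X1) Y2 j1 j2 q1 q2"
    and i1: "sh i1 = j1 ;; h" and q1: "q1 = h ;; sh p1"
    and nr: "\<not> rad (j2 ;; h ;; sh p2)"
  shows "\<exists>X' j' p'. p' : X \<rightharpoonup> X' \<and> j' : shift C X' \<rightharpoonup> Y \<and> j' ;; h ;; sh p' = ident (shift C X') \<and>
     card (Mor X1 X1) < card (Mor X' X')"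
proof -
  note [simp] = h biprodD[OF bX] biprodD[OF bY] biprod_comp[OF bX] biprod_comp[OF bY]
  note [simp] = biprodD[OF biprod_shift[OF bX]] biprod_comp[OF biprod_shift[OF bX]]
  obtain A g t where A: "indecomposable C A" and g: "g : A \<rightharpoonup> Y2" and t: "t : shift C X2 \<rightharpoonup> A"
      and \<theta>: "iso (g ;; (j2 ;; h ;; sh p2) ;; t)"
    using nr unfolding rad_def by auto
  have AO: "A \<in> Obj C" "\<not> is_zero_obj C A" using A by (simp_all add: indecomposable_def)
  obtain B \<sigma> where B [simp]: "B \<in> Obj C" and \<sigma>: "iso \<sigma>" "dm \<sigma> = shift C B" "cd \<sigma> = A"
    using shift_ess_surj[OF AO(1)] AO isomorphic_iff by (metis shift_obj)
  note [simp] = g t \<sigma> AO(1)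
  define \<theta> where "\<theta> = g ;; (j2 ;; h ;; sh p2) ;; t"
  have [simp]: "iso \<theta>" "\<theta> : A \<rightharpoonup> A" using \<theta> by (simp_all add: \<theta>_def)
  have nzB: "\<not> is_zero_obj C B"
  proof
    assume "is_zero_obj C B"
    then have z: "ident (shift C B) = zr (shift C B) (shift C B)" using zero_obj_shift zero_obj_iff by blast
    have "ident A = inverse \<sigma> ;; ident (shift C B) ;; \<sigma>" by simp
    also have "\<dots> = zr A A" unfolding z by simp
    finally show False using AO by (simp add: zero_obj_iff)
  qed
  \<comment> \<open>\<open>t\<close> is normalised by \<open>\<theta>\<close> and
    \<open>\<sigma>\<close>, so that the composite through \<open>h\<close> becomes the identity of
    \<open>B[1]\<close>.\<close>
  obtain t' where t': "t' : X2 \<rightharpoonup> B" "sh t' = t ;; inverse \<theta> ;; inverse \<sigma>"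
    using sh_full[of X2 B "t ;; inverse \<theta> ;; inverse \<sigma>"] by auto
  note [simp] = t'(1)
  define g' where "g' = \<sigma> ;; g"
  have g' [simp]: "g' : shift C B \<rightharpoonup> Y2" by (simp add: g'_def)
  have \<theta>_comp: "g ;; j2 ;; h ;; sh p2 ;; t ;; a = \<theta> ;; a" if "arr a" "dm a = A" for a
    using that by (simp add: \<theta>_def)
  have gt: "g' ;; j2 ;; h ;; sh p2 ;; sh t' = ident (shift C B)"
    unfolding t'(2) by (simp add: g'_def \<theta>_comp)
  obtain X' e1 e2 d1 d2 where b': "biprod X' X1 B e1 e2 d1 d2" using biprod_exists[OF biprodD(11)[OF bX] B] by blast
  note [simp] = biprodD[OF b'] biprod_comp[OF b']
  note bs = biprodD[OF biprod_shift[OF b']]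
  note [simp] = bs biprod_comp[OF biprod_shift[OF b']]
  \<comment> \<open>Block maps for \<open>X' = X1 \<oplus> B\<close>. Their mixed terms vanish
    because \<open>j1 ;; h = sh i1\<close> and
    \<open>j2 ;; h ;; sh p1 = j2 ;; q1 = 0\<close>.\<close>
  define j' where "j' = sh d1 ;; j1 \<boxplus> sh d2 ;; g' ;; j2"
  define p' where "p' = p1 ;; e1 \<boxplus> p2 ;; t' ;; e2"
  have j': "j' : shift C X' \<rightharpoonup> Y" and p': "p' : X \<rightharpoonup> X'" by (simp_all add: j'_def p'_def)
  have j1h: "j1 ;; h ;; a = sh i1 ;; a" if "arr a" "dm a = shift C X" for a
    using that comp_assoc[of j1 h a] unfolding i1 by simp
  have j2h: "j2 ;; h ;; sh p1 ;; a = zr Y2 (cd a)" if "arr a" "dm a = shift C X1" for a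
  proof -
    have "j2 ;; h ;; sh p1 ;; a = (j2 ;; q1) ;; a" using that unfolding q1 by simp
    also have "\<dots> = zr Y2 (cd a)" using that by simp
    finally show ?thesis .
  qed
  have gt': "g' ;; j2 ;; h ;; sh p2 ;; sh t' ;; sh e2 = sh e2"
    using arg_cong[OF gt, of "\<lambda>x. x ;; sh e2"] by simp
  have hp: "sh p' = sh p1 ;; sh e1 \<boxplus> sh p2 ;; sh t' ;; sh e2"
    by (simp add: p'_def sh_plus)
  have "j' ;; h ;; sh p' = sh d1 ;; j1 ;; h ;; sh p' \<boxplus> sh d2 ;; g' ;; j2 ;; h ;; sh p'"
    using p' by (simp add: j'_def comp_plus_left)
  also have "sh d1 ;; j1 ;; h ;; sh p' = sh d1 ;; sh e1"
    using p' by (subst j1h) (simp_all add: hp comp_plus_right)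
  also have "sh d2 ;; g' ;; j2 ;; h ;; sh p' = sh d2 ;; sh e2"
    by (simp add: hp comp_plus_right j2h gt')
  also have "sh d1 ;; sh e1 \<boxplus> sh d2 ;; sh e2 = ident (shift C X')" by (rule bs(9))
  finally show ?thesis using summand_card_less[OF b' nzB] j' p' by blast
qed

text \<open>Among all \<open>X1\<close> through which \<open>h\<close> carries an identity
  \<open>X1[1] \<rightarrow> Y \<rightarrow> X[1] \<rightarrow> X1[1]\<close>, one with the largest
  |End X1| is taken; by maximality the remaining block is radical. Choosing \<open>i\<close> with
  \<open>sh i = j ;; h\<close> and putting \<open>q1 = h ;; sh p\<close> makes the matrix diagonal,
  with \<open>h11\<close> the identity of \<open>X1[1]\<close>.\<close>

lemma iso_rad_decomposition:
  assumes h: "h : Y \<rightharpoonup> shift C X" and X [simp]: "X \<in> Obj C"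
  obtains X1 X2 Y1 Y2 i1 i2 p1 p2 j1 j2 q1 q2 h11 h22 where
    "biprod X X1 X2 i1 i2 p1 p2" "biprod Y Y1 Y2 j1 j2 q1 q2"
    "iso h11" "dm h11 = Y1" "cd h11 = shift C X1" "rad h22" "dm h22 = Y2" "cd h22 = shift C X2"
    "h = q1 ;; h11 ;; sh i1 \<boxplus> q2 ;; h22 ;; sh i2"
proof -
  note [simp] = h
  have [simp]: "Y \<in> Obj C" using arr_obj(1)[of h] h by simp
  define Q where "Q X1 j p \<longleftrightarrow> p : X \<rightharpoonup> X1 \<and> j : shift C X1 \<rightharpoonup> Y \<and> j ;; h ;; sh p = ident (shift C X1)" for X1 j p
  have section_ex: "\<exists>i. i : X1 \<rightharpoonup> X \<and> sh i = j ;; h \<and> i ;; p = ident X1" if "Q X1 j p" for X1 j p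
  proof -
    have [simp]: "p : X \<rightharpoonup> X1" "j : shift C X1 \<rightharpoonup> Y" and e: "j ;; h ;; sh p = ident (shift C X1)"
      using that by (auto simp: Q_def)
    have [simp]: "X1 \<in> Obj C" using arr_obj(2)[of p] by simp
    obtain i where i: "i : X1 \<rightharpoonup> X" "sh i = j ;; h" using sh_full[of X1 X "j ;; h"] by auto
    have "sh (i ;; p) = sh (ident X1)" using i(1) e by (simp add: i(2))
    then have "i ;; p = ident X1" using i(1) by (simp add: sh_inj del: sh_comp sh_ident)
    with i show ?thesis by blast
  qed
  obtain Z where Z: "is_zero_obj C Z" using zero_obj_ex by blast
  have [simp]: "Z \<in> Obj C" using zero_obj_obj[OF Z] .
  have "Q Z (zr (shift C Z) Y) (zr X Z)"
    unfolding Q_def using zero_obj_shift[OF Z] zero_obj_iff by simp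
  then have ex: "\<exists>j p. Q Z j p" by blast
  \<comment> \<open>The section makes \<open>X1\<close> a retract of \<open>X\<close>, so the
    maximum exists.\<close>
  have bound: "card (Mor X1 X1) \<le> card (Mor X X)" if "Q X1 j p" for X1 j p
    using section_ex[OF that] that retract_card_le unfolding Q_def by blast
  have "\<exists>X1. (\<exists>j p. Q X1 j p) \<and> (\<forall>X'. (\<exists>j p. Q X' j p) \<longrightarrow> card (Mor X' X') \<le> card (Mor X1 X1))"
    by (rule ex_has_greatest_nat[of "\<lambda>X1. \<exists>j p. Q X1 j p" Z _ "Suc (card (Mor X X))"])
      (use bound ex in \<open>auto simp: less_Suc_eq_le\<close>)
  then obtain X1 j p where Q: "Q X1 j p"
      and max: "\<And>X' j' p'. Q X' j' p' \<Longrightarrow> card (Mor X' X') \<le> card (Mor X1 X1)" by blast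
  have [simp]: "p : X \<rightharpoonup> X1" "j : shift C X1 \<rightharpoonup> Y" and e: "j ;; h ;; sh p = ident (shift C X1)"
    using Q by (auto simp: Q_def)
  have [simp]: "X1 \<in> Obj C" using arr_obj(2)[of p] by simp
  obtain i where i: "i : X1 \<rightharpoonup> X" "sh i = j ;; h" "i ;; p = ident X1" using section_ex[OF Q] by blast
  obtain X2 i2 p2 q where bX: "biprod X X1 X2 i i2 p p2"
    using split_mono_biprod[OF i(1) _ i(3)] \<open>p : X \<rightharpoonup> X1\<close> by blast
  define q1 where "q1 = h ;; sh p"
  have q1 [simp]: "q1 : Y \<rightharpoonup> shift C X1" and jq: "j ;; q1 = ident (shift C X1)" using e by (simp_all add: q1_def)
  obtain Y2 j2 q2 where bY: "biprod Y (shift C X1) Y2 j j2 q1 q2"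
    using split_mono_biprod[OF _ q1 jq] \<open>j : shift C X1 \<rightharpoonup> Y\<close> by blast
  define h22 where "h22 = j2 ;; h ;; sh p2"
  note [simp] = i(1) biprodD[OF bX] biprodD[OF bY] biprod_comp[OF bX] biprod_comp[OF bY]
  note [simp] = biprodD[OF biprod_shift[OF bX]] biprod_comp[OF biprod_shift[OF bX]]
  have rad: "rad h22"
  proof (rule ccontr)
    assume "\<not> rad h22"
    from larger_iso_part[OF h bX bY i(2) q1_def this[unfolded h22_def]]
    obtain X' j' p' where "Q X' j' p'" "card (Mor X1 X1) < card (Mor X' X')" unfolding Q_def by blast
    then show False using max[of X' j' p'] by simp
  qed
  have z: "q2 ;; j2 ;; h ;; sh p ;; sh i = zr Y (shift C X)"
  proof -
    have "q2 ;; j2 ;; h ;; sh p ;; sh i = q2 ;; (j2 ;; q1) ;; sh i"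
      unfolding q1_def by (simp del: biprodD(8)[OF bY])
    then show ?thesis by simp
  qed
  have "h = (q1 ;; j \<boxplus> q2 ;; j2) ;; h" by simp
  also have "\<dots> = q1 ;; sh i \<boxplus> q2 ;; j2 ;; h"
    unfolding i(2) by (subst comp_plus_left) simp_all
  also have "q2 ;; j2 ;; h = q2 ;; j2 ;; h ;; (sh p ;; sh i \<boxplus> sh p2 ;; sh i2)" by simp
  also have "\<dots> = q2 ;; h22 ;; sh i2"
    by (simp add: comp_plus_right z h22_def del: biprodD(9)[OF biprod_shift[OF bX]])
  finally have "h = q1 ;; ident (shift C X1) ;; sh i \<boxplus> q2 ;; h22 ;; sh i2" by simp
  from that[OF bX bY iso_ident _ _ rad _ _ this]
  show thesis by (simp add: h22_def)
qed

subsection \<open>Counting along triangles\<close>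

lemma finite_typed [simp]: "finite {a. arr a \<and> dm a = X \<and> cd a = Y \<and> P a}"
  by (rule finite_subset[OF _ finite_Mor[of X Y]]) auto

text \<open>The fibres of an additive map over its image are translates of the kernel, so
  proportions in the image pull back.\<close>

lemma card_fibres:
  assumes X: "X \<in> Obj C" "Y \<in> Obj C"
    and ty: "\<And>a. a : X \<rightharpoonup> Y \<Longrightarrow> \<phi> a : X' \<rightharpoonup> Y'"
    and add: "\<And>a b. a : X \<rightharpoonup> Y \<Longrightarrow> b : X \<rightharpoonup> Y \<Longrightarrow> \<phi> (a \<boxplus> b) = \<phi> a \<boxplus> \<phi> b"
  shows "card {a \<in> Mor X Y. P (\<phi> a)}
    = card {a \<in> Mor X Y. \<phi> a = zr X' Y'} * card {b \<in> \<phi> ` Mor X Y. P b}"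
proof -
  let ?K = "{a \<in> Mor X Y. \<phi> a = zr X' Y'}" and ?B = "{b \<in> \<phi> ` Mor X Y. P b}"
  have neg: "\<phi> (neg a) = neg (\<phi> a)" if a: "a : X \<rightharpoonup> Y" for a
  proof -
    have z: "\<phi> (zr X Y) = zr X' Y'"
      using add[of "zr X Y" "zr X Y"] ty[of "zr X Y"] zr_unique[of "\<phi> (zr X Y)"] X by simp
    show ?thesis
      using add[of a "neg a"] ty[OF a] ty[of "neg a"] a z neg_unique[of "\<phi> a" "\<phi> (neg a)"] by simp
  qed
  have fib: "card {a \<in> Mor X Y. \<phi> a = b} = card ?K" if "b \<in> ?B" for b
  proof -
    obtain a0 where a0: "a0 : X \<rightharpoonup> Y" "b = \<phi> a0" using \<open>b \<in> ?B\<close> by auto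
    have "bij_betw (\<lambda>a. a \<boxplus> a0) ?K {a \<in> Mor X Y. \<phi> a = b}"
    proof (rule bij_betw_byWitness[where f' = "\<lambda>a. a \<boxplus> neg a0"])
      show "\<forall>a\<in>?K. (a \<boxplus> a0) \<boxplus> neg a0 = a" using a0(1) by (simp add: plus_assoc)
      show "\<forall>a\<in>{a \<in> Mor X Y. \<phi> a = b}. (a \<boxplus> neg a0) \<boxplus> a0 = a" using a0(1) by (simp add: plus_assoc)
      show "(\<lambda>a. a \<boxplus> a0) ` ?K \<subseteq> {a \<in> Mor X Y. \<phi> a = b}"
        using a0 ty[OF a0(1)] add[OF _ a0(1)] by auto
      show "(\<lambda>a. a \<boxplus> neg a0) ` {a \<in> Mor X Y. \<phi> a = b} \<subseteq> ?K"
        using a0 ty[OF a0(1)] add[of _ "neg a0"] neg[OF a0(1)] by auto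
    qed
    then show ?thesis by (simp add: bij_betw_same_card)
  qed
  have "{a \<in> Mor X Y. P (\<phi> a)} = (\<Union>b\<in>?B. {a \<in> Mor X Y. \<phi> a = b})" by auto
  then have "card {a \<in> Mor X Y. P (\<phi> a)} = (\<Sum>b\<in>?B. card {a \<in> Mor X Y. \<phi> a = b})"
    by (simp only:) (rule card_UN_disjoint, auto)
  also have "\<dots> = card ?K * card ?B" using fib by simp
  finally show ?thesis .
qed

lemma card_kernel_image:
  assumes "X \<in> Obj C" "Y \<in> Obj C"
    and "\<And>a. a : X \<rightharpoonup> Y \<Longrightarrow> \<phi> a : X' \<rightharpoonup> Y'"
    and "\<And>a b. a : X \<rightharpoonup> Y \<Longrightarrow> b : X \<rightharpoonup> Y \<Longrightarrow> \<phi> (a \<boxplus> b) = \<phi> a \<boxplus> \<phi> b"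
  shows "card (Mor X Y) = card {a \<in> Mor X Y. \<phi> a = zr X' Y'} * card (\<phi> ` Mor X Y)"
proof -
  have "card {a \<in> Mor X Y. True} = card {a \<in> Mor X Y. \<phi> a = zr X' Y'} * card {b \<in> \<phi> ` Mor X Y. True}"
    by (rule card_fibres[where \<phi> = \<phi> and P = "\<lambda>_. True"]) (fact assms)+
  then show ?thesis by (simp only: simp_thms Collect_mem_eq)
qed

section \<open>Kernels in the long exact sequences\<close>

definition lker :: "'o \<Rightarrow> ('o, 'm) arrow \<Rightarrow> ('o, 'm) arrow set" where
  "lker T f = {a \<in> Mor T (dm f). a ;; f = zr T (cd f)}"

definition rker :: "('o, 'm) arrow \<Rightarrow> 'o \<Rightarrow> ('o, 'm) arrow set" where
  "rker f T = {b \<in> Mor (cd f) T. f ;; b = zr (dm f) T}"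

lemma finite_lker [simp]: "finite (lker T f)" and finite_rker [simp]: "finite (rker f T)"
  by (simp_all add: lker_def rker_def)

text \<open>\<open>lker T f\<close> is the kernel of Hom(T, f) and \<open>rker f T\<close> that of
  Hom(f, T); this is exactness of Hom(T, -) in a form that allows counting.\<close>

lemma lker_image:
  assumes "tri f g h" "T \<in> Obj C"
  shows "(\<lambda>a. a ;; f) ` Mor T (dm f) = lker T g"
proof
  note [simp] = tri_typed[OF assms(1)] assms(2)
  have "(a ;; f) ;; g = zr T (cd g)" if "a : T \<rightharpoonup> dm f" for a
    using that tri_zero[OF assms(1)] by simp
  then show "(\<lambda>a. a ;; f) ` Mor T (dm f) \<subseteq> lker T g" by (auto simp: lker_def simp del: comp_assoc)
  show "lker T g \<subseteq> (\<lambda>a. a ;; f) ` Mor T (dm f)"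
  proof
    fix b assume "b \<in> lker T g"
    then have b: "arr b" "cd b = cd f" "b ;; g = zr (dm b) (cd g)" "dm b = T" by (auto simp: lker_def)
    obtain a where "a : dm b \<rightharpoonup> dm f" "a ;; f = b" using tri_lift[OF assms(1) b(1-3)] by blast
    then show "b \<in> (\<lambda>a. a ;; f) ` Mor T (dm f)" using b(4) by (intro image_eqI[of _ _ a]) simp_all
  qed
qed

lemma rker_image:
  assumes "tri f g h" "T \<in> Obj C"
  shows "(\<lambda>c. g ;; c) ` Mor (cd g) T = rker f T"
proof
  note [simp] = tri_typed[OF assms(1)] assms(2)
  have "f ;; g ;; c = zr (dm f) T" if "c : cd g \<rightharpoonup> T" for c
    using that arg_cong[OF tri_zero[OF assms(1)], of "\<lambda>x. x ;; c"] by simp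
  then show "(\<lambda>c. g ;; c) ` Mor (cd g) T \<subseteq> rker f T" by (auto simp: rker_def)
  show "rker f T \<subseteq> (\<lambda>c. g ;; c) ` Mor (cd g) T"
  proof
    fix b assume "b \<in> rker f T"
    then have b: "arr b" "dm b = cd f" "f ;; b = zr (dm f) (cd b)" "cd b = T" by (auto simp: rker_def)
    obtain c where "c : cd g \<rightharpoonup> cd b" "g ;; c = b" using tri_colift[OF assms(1) b(1-3)] by blast
    then show "b \<in> (\<lambda>c. g ;; c) ` Mor (cd g) T" using b(4) by (intro image_eqI[of _ _ c]) simp_all
  qed
qed

lemma card_Mor_lker:
  assumes "tri f g h" "T \<in> Obj C"
  shows "card (Mor T (dm f)) = card (lker T f) * card (lker T g)"
  using card_kernel_image[of T "dm f" "\<lambda>a. a ;; f" T "cd f"] assms tri_typed[OF assms(1)]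
  unfolding lker_image[OF assms, symmetric] by (simp add: lker_def comp_plus_left)

lemma card_Mor_rker:
  assumes "tri f g h" "T \<in> Obj C"
  shows "card (Mor (cd g) T) = card (rker g T) * card (rker f T)"
  using card_kernel_image[of "cd g" T "\<lambda>c. g ;; c" "dm g" T] assms tri_typed[OF assms(1)]
  unfolding rker_image[OF assms, symmetric] by (simp add: rker_def comp_plus_right)

lemma lker_neg: "arr f \<Longrightarrow> lker T (neg f) = lker T f"
  unfolding lker_def by (rule Collect_cong) auto

lemma lker_shift:
  assumes "arr f" "T \<in> Obj C"
  shows "lker (shift C T) (sh f) = sh ` lker T f"
proof
  note [simp] = assms
  show "sh ` lker T f \<subseteq> lker (shift C T) (sh f)" by (auto simp: lker_def simp flip: sh_comp)
  show "lker (shift C T) (sh f) \<subseteq> sh ` lker T f"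
  proof
    fix b assume b: "b \<in> lker (shift C T) (sh f)"
    then obtain a where a: "a : T \<rightharpoonup> dm f" "sh a = b"
      using sh_full[of T "dm f" b] by (auto simp: lker_def)
    have "sh (a ;; f) = sh (zr T (cd f))" using a(1) b by (simp add: lker_def flip: a(2))
    then have "a ;; f = zr T (cd f)" using a(1) by (simp add: sh_inj del: sh_comp sh_zr)
    then show "b \<in> sh ` lker T f" using a by (auto simp: lker_def)
  qed
qed

lemma sh_inj_on: "inj_on sh (Mor X Y)"
  by (auto simp: inj_on_def sh_inj)

lemma card_lker_shift: "arr f \<Longrightarrow> T \<in> Obj C \<Longrightarrow> card (lker (shift C T) (sh f)) = card (lker T f)"
  unfolding lker_shift by (rule card_image, rule inj_on_subset[OF sh_inj_on[of T "dm f"]]) (auto simp: lker_def)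

text \<open>At \<open>T[1]\<close>, three consecutive Hom sets of the exact sequence each factor as
  a kernel times the next kernel. Those of \<open>g\<close> and \<open>h\<close> cancel, and that of
  the shifted \<open>f\<close> at \<open>T[1]\<close> is the kernel of \<open>f\<close> at
  \<open>T\<close>, so the kernels of \<open>f\<close> at two consecutive shifts remain.\<close>

lemma lker_step:
  assumes "tri f g h" "T \<in> Obj C"
  shows "card (lker T f) * card (lker (shift C T) f) * card (Mor (shift C T) (cd f))
    = card (Mor (shift C T) (dm f)) * card (Mor (shift C T) (cd g))"
proof -
  note T = tri_typed[OF assms(1)]
  have 1: "card (lker (shift C T) (neg (sh f))) = card (lker T f)"
    using T assms by (simp add: lker_neg card_lker_shift)
  show ?thesis
    using card_Mor_lker[OF assms(1), of "shift C T"] card_Mor_lker[OF tri_rotate[OF assms(1)], of "shift C T"]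
      card_Mor_lker[OF tri_rotate[OF tri_rotate[OF assms(1)]], of "shift C T"] assms(2) T(4,5) 1 by simp
qed

lemma tri_rotate3: "tri f g h \<Longrightarrow> tri (neg (sh f)) (neg (sh g)) (neg (sh h))"
  by (intro tri_rotate)

text \<open>Here \<open>T\<close> stays fixed and the triangle is shifted, so the next kernel
  belongs to \<open>neg (sh g)\<close>; those of \<open>h\<close> and \<open>neg (sh f)\<close>
  cancel.\<close>

lemma rker_step:
  assumes "tri f g h" "T \<in> Obj C"
  shows "card (rker g T) * card (rker (neg (sh g)) T) * card (Mor (shift C (cd f)) T)
    = card (Mor (shift C (dm f)) T) * card (Mor (shift C (cd g)) T)"
  using card_Mor_rker[OF tri_rotate[OF assms(1)] assms(2)]
    card_Mor_rker[OF tri_rotate[OF tri_rotate[OF assms(1)]] assms(2)]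
    card_Mor_rker[OF tri_rotate3[OF assms(1)] assms(2)] tri_typed[OF assms(1)] by simp

section \<open>The alternating product of Hom orders\<close>

lemma funpow_shift_obj [simp]: "X \<in> Obj C \<Longrightarrow> (shift C ^^ n) X \<in> Obj C"
  by (induction n) simp_all

lemma hom_bracket_eq_prod:
  assumes "X \<in> Obj C" "Y \<in> Obj C" "\<forall>n>N. card (Mor ((shift C ^^ n) X) Y) = 1"
  shows "hom_bracket C X Y = (\<Prod>i = 1..N. of_nat (card (Mor ((shift C ^^ i) X) Y)) powi ((- 1) ^ i))"
proof -
  let ?c = "\<lambda>i. card (Mor ((shift C ^^ i) X) Y)"
  have "hom_bracket C X Y = (\<Prod>i | 0 < i \<and> ?c i \<noteq> 1. of_nat (?c i) powi ((- 1) ^ i))"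
    using assms(1,2) by (simp add: hom_bracket_def card_Mor)
  also have "\<dots> = (\<Prod>i = 1..N. of_nat (?c i) powi ((- 1) ^ i))"
    by (rule prod.mono_neutral_left) (use assms(3) in \<open>auto simp: not_less[symmetric]\<close>)
  finally show ?thesis .
qed

lemma Mor_vanishing:
  assumes "X \<in> Obj C" "Y \<in> Obj C"
  obtains N where "\<And>n. n \<ge> N \<Longrightarrow> card (Mor ((shift C ^^ n) X) Y) = 1"
  using vanishing[OF assms] card_Mor[OF funpow_shift_obj[OF assms(1)] assms(2)] by metis

text \<open>Shifting \<open>X\<close> moves every index by one and inverts every exponent; the
  factor at index 1, with exponent -1, is left over.\<close>

lemma hom_bracket_rec:
  assumes "X \<in> Obj C" "Y \<in> Obj C"
  shows "hom_bracket C X Y = 1 / (of_nat (card (Mor (shift C X) Y)) * hom_bracket C (shift C X) Y)"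
proof -
  obtain N where N: "\<And>n. n \<ge> N \<Longrightarrow> card (Mor ((shift C ^^ n) X) Y) = 1"
    using Mor_vanishing[OF assms] by blast
  have sw: "(shift C ^^ n) (shift C X) = (shift C ^^ Suc n) X" for n by (simp add: funpow_swap1)
  let ?c = "\<lambda>i. of_nat (card (Mor ((shift C ^^ i) X) Y)) :: rat"
  have "hom_bracket C X Y = (\<Prod>i = 1..Suc N. ?c i powi ((- 1) ^ i))"
    by (rule hom_bracket_eq_prod) (use assms N in auto)
  also have "\<dots> = ?c 1 powi (- 1) * (\<Prod>i = 1..N. ?c (Suc i) powi ((- 1) ^ Suc i))"
    by (subst prod.atLeast_Suc_atMost) (simp_all add: prod.shift_bounds_cl_Suc_ivl del: prod.cl_ivl_Suc)
  also have "(\<Prod>i = 1..N. ?c (Suc i) powi ((- 1) ^ Suc i)) = 1 / (\<Prod>i = 1..N. ?c (Suc i) powi ((- 1) ^ i))"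
    by (simp add: power_int_minus prod_inversef[symmetric] o_def divide_inverse)
  also have "(\<Prod>i = 1..N. ?c (Suc i) powi ((- 1) ^ i)) = hom_bracket C (shift C X) Y"
  proof -
    have "\<forall>n>N. card (Mor ((shift C ^^ n) (shift C X)) Y) = 1" unfolding sw using N[of "Suc _"] by (intro allI impI) (simp del: funpow.simps)
    from hom_bracket_eq_prod[OF _ _ this] show ?thesis using assms by (simp add: sw)
  qed
  finally show ?thesis by (simp add: power_int_minus field_simps)
qed

lemma hom_bracket_vanishing:
  assumes "X \<in> Obj C" "Y \<in> Obj C"
  shows "\<exists>N. \<forall>n\<ge>N. hom_bracket C ((shift C ^^ n) X) Y = 1 \<and> card (Mor ((shift C ^^ n) X) Y) = 1"
proof -
  obtain N where N: "\<And>n. n \<ge> N \<Longrightarrow> card (Mor ((shift C ^^ n) X) Y) = 1"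
    using Mor_vanishing[OF assms] by blast
  have "hom_bracket C ((shift C ^^ n) X) Y = 1" if "n \<ge> N" for n
  proof -
    have "card (Mor ((shift C ^^ m) ((shift C ^^ n) X)) Y) = 1" for m
      using N[of "m + n"] that by (simp add: funpow_add)
    then show ?thesis by (subst hom_bracket_eq_prod[of _ _ 0]) (use assms in simp_all)
  qed
  with N show ?thesis by blast
qed

lemma hom_bracket_nonzero: "X \<in> Obj C \<Longrightarrow> Y \<in> Obj C \<Longrightarrow> hom_bracket C X Y \<noteq> 0"
proof -
  assume *: "X \<in> Obj C" "Y \<in> Obj C"
  obtain N where "\<And>n. n \<ge> N \<Longrightarrow> card (Mor ((shift C ^^ n) X) Y) = 1"
    using Mor_vanishing[OF *] by blast
  then have "hom_bracket C X Y = (\<Prod>i = 1..N. of_nat (card (Mor ((shift C ^^ i) X) Y)) powi ((- 1) ^ i))"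
    by (intro hom_bracket_eq_prod) (use * in auto)
  also have "\<dots> \<noteq> 0"
  proof -
    have "card (Mor ((shift C ^^ i) X) Y) \<noteq> 0" for i
      using card_Mor_pos[OF funpow_shift_obj[OF *(1)] *(2)] by (metis less_irrefl)
    then show ?thesis by (simp add: power_int_not_zero prod_zero_iff del: card_0_eq)
  qed
  finally show ?thesis .
qed

text \<open>The recursions for brackets and kernels point to higher shifts, so the induction starts
  where all Hom sets involved are trivial and descends.\<close>

lemma downward_shift_induct:
  assumes "\<And>n. n \<ge> N \<Longrightarrow> P n" "\<And>n. P (Suc n) \<Longrightarrow> P n"
  shows "P (0::nat)"
proof -
  have "P (N - m)" for m
  proof (induction m)
    case 0
    show ?case using assms(1)[of N] by simp
  next
    case (Suc m)
    show ?case
    proof (cases "m < N")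
      case True
      then show ?thesis using Suc assms(2)[of "N - Suc m"] by (simp add: Suc_diff_Suc)
    next
      case False
      then show ?thesis using Suc by simp
    qed
  qed
  from this[of N] show ?thesis by simp
qed

text \<open>Arithmetic of one descent: \<open>\<kappa>\<close> and \<open>\<kappa>'\<close> are
  consecutive kernels, \<open>x\<close>, \<open>y\<close>, \<open>l\<close> are orders of Hom sets,
  and the remaining variables are brackets at the higher shift.\<close>

lemma kernel_recursion:
  fixes \<kappa> \<kappa>' x y l b\<^sub>x b\<^sub>y b\<^sub>l :: rat
  assumes "\<kappa> * \<kappa>' * l = x * y" "\<kappa>' = b\<^sub>l / (b\<^sub>x * b\<^sub>y)"
    and "x \<noteq> 0" "y \<noteq> 0" "l \<noteq> 0" "b\<^sub>x \<noteq> 0" "b\<^sub>y \<noteq> 0" "b\<^sub>l \<noteq> 0"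
  shows "\<kappa> = (1 / (l * b\<^sub>l)) / ((1 / (x * b\<^sub>x)) * (1 / (y * b\<^sub>y)))"
proof -
  have "\<kappa> * (b\<^sub>l * l) = x * y * (b\<^sub>x * b\<^sub>y)"
    using assms(1,6,7) unfolding assms(2) by (simp add: divide_simps mult_ac)
  then show ?thesis using assms(3-8) by (simp add: field_simps)
qed

text \<open>\<open>\<kappa> n\<close> is the order of the kernel at the end of the exact sequence truncated at the shift
  by \<open>n\<close>.\<close>

lemma exact_sequence_card:
  fixes \<kappa> :: "nat \<Rightarrow> nat"
  assumes obj: "X \<in> Obj C" "X' \<in> Obj C" "L \<in> Obj C" "L' \<in> Obj C" "Y \<in> Obj C" "Y' \<in> Obj C"
    and step: "\<And>n. \<kappa> n * \<kappa> (Suc n) * card (Mor ((shift C ^^ Suc n) L) L')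
      = card (Mor ((shift C ^^ Suc n) X) X') * card (Mor ((shift C ^^ Suc n) Y) Y')"
    and van: "\<And>n. card (Mor ((shift C ^^ n) X) X') = 1 \<Longrightarrow> \<kappa> n = 1"
  shows "of_nat (\<kappa> 0) = hom_bracket C L L' / (hom_bracket C X X' * hom_bracket C Y Y')"
proof -
  let ?s = "\<lambda>n A. (shift C ^^ n) A"
  define P where "P n \<longleftrightarrow> of_nat (\<kappa> n) = hom_bracket C (?s n L) L' / (hom_bracket C (?s n X) X' * hom_bracket C (?s n Y) Y')" for n
  obtain N1 where N1: "\<forall>n\<ge>N1. hom_bracket C (?s n X) X' = 1 \<and> card (Mor (?s n X) X') = 1"
    using hom_bracket_vanishing[OF obj(1,2)] by blast
  obtain N2 where N2: "\<forall>n\<ge>N2. hom_bracket C (?s n L) L' = 1 \<and> card (Mor (?s n L) L') = 1"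
    using hom_bracket_vanishing[OF obj(3,4)] by blast
  obtain N3 where N3: "\<forall>n\<ge>N3. hom_bracket C (?s n Y) Y' = 1 \<and> card (Mor (?s n Y) Y') = 1"
    using hom_bracket_vanishing[OF obj(5,6)] by blast
  have "P 0"
  proof (rule downward_shift_induct)
    show "P n" if "n \<ge> N1 + N2 + N3" for n
      using that N1 N2 N3 van[of n] by (simp add: P_def)
  next
    fix n assume IH: "P (Suc n)"
    have nz: "of_nat (card (Mor (shift C (?s n A)) B)) \<noteq> (0::rat)" "hom_bracket C (shift C (?s n A)) B \<noteq> 0"
      if "A \<in> Obj C" "B \<in> Obj C" for A B
      using card_Mor_pos[of "shift C (?s n A)" B] hom_bracket_nonzero[of "shift C (?s n A)" B] that
      by (auto simp del: card_0_eq)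
    have "of_nat (\<kappa> n) * of_nat (\<kappa> (Suc n)) * of_nat (card (Mor (shift C (?s n L)) L'))
        = (of_nat (card (Mor (shift C (?s n X)) X')) * of_nat (card (Mor (shift C (?s n Y)) Y')) :: rat)"
      using step[of n] by (simp flip: of_nat_mult)
    then show "P n"
      using IH unfolding P_def funpow.simps o_apply hom_bracket_rec[OF funpow_shift_obj[OF obj(1)] obj(2)]
        hom_bracket_rec[OF funpow_shift_obj[OF obj(3)] obj(4)] hom_bracket_rec[OF funpow_shift_obj[OF obj(5)] obj(6)]
      by (intro kernel_recursion nz obj)
  qed
  then show ?thesis by (simp add: P_def)
qed

lemma card_lker:
  assumes "tri f g h" "T \<in> Obj C"
  shows "of_nat (card (lker T f)) = hom_bracket C T (cd f) / (hom_bracket C T (dm f) * hom_bracket C T (cd g))"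
proof -
  note [simp] = tri_typed[OF assms(1)] assms(2)
  have "card (lker ((shift C ^^ n) T) f) = 1" if "card (Mor ((shift C ^^ n) T) (dm f)) = 1" for n
    using card_Mor_lker[OF assms(1), of "(shift C ^^ n) T"] that by simp
  then show ?thesis
    using exact_sequence_card[of T "dm f" T "cd f" T "cd g" "\<lambda>n. card (lker ((shift C ^^ n) T) f)"]
      lker_step[OF assms(1)] by simp
qed

text \<open>Three rotations shift a triangle and negate all three maps; the signs are kept in the
  iteration so that the sequences stay triangles.\<close>

lemma tri_iterate:
  assumes "tri f g h"
  defines "\<sigma> \<equiv> \<lambda>n. (\<lambda>a. neg (sh a)) ^^ n"
  shows "tri (\<sigma> n f) (\<sigma> n g) (\<sigma> n h) \<and> dm (\<sigma> n f) = (shift C ^^ n) (dm f) \<and>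
    cd (\<sigma> n f) = (shift C ^^ n) (cd f) \<and> cd (\<sigma> n g) = (shift C ^^ n) (cd g)"
  unfolding \<sigma>_def using assms(1) by (induction n) (simp_all add: tri_rotate3)

lemma card_rker:
  assumes "tri f g h" "T \<in> Obj C"
  shows "of_nat (card (rker g T)) = hom_bracket C (cd f) T / (hom_bracket C (dm f) T * hom_bracket C (cd g) T)"
proof -
  note [simp] = tri_typed[OF assms(1)] assms(2)
  let ?\<sigma> = "\<lambda>n. (\<lambda>a. neg (sh a)) ^^ n"
  note it = tri_iterate[OF assms(1)]
  have "card (rker (?\<sigma> n g) T) = 1" if "card (Mor ((shift C ^^ n) (cd g)) T) = 1" for n
    using card_Mor_rker[OF conjunct1[OF it[of n]] assms(2)] it[of n] that by simp
  moreover have "card (rker (?\<sigma> n g) T) * card (rker (?\<sigma> (Suc n) g) T) * card (Mor ((shift C ^^ Suc n) (cd f)) T)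
      = card (Mor ((shift C ^^ Suc n) (cd g)) T) * card (Mor ((shift C ^^ Suc n) (dm f)) T)" for n
    using rker_step[OF conjunct1[OF it[of n]] assms(2)] it[of n] by (simp add: mult.commute)
  ultimately show ?thesis
    using exact_sequence_card[of "cd g" T "cd f" T "dm f" T "\<lambda>n. card (rker (?\<sigma> n g) T)"]
    by (simp add: mult.commute)
qed

section \<open>Automorphisms, stabilisers and the proportion of units\<close>

definition aut :: "'o \<Rightarrow> ('o, 'm) arrow set" where
  "aut X = {a \<in> Mor X X. iso a}"

lemma in_aut [simp]: "a \<in> aut X \<longleftrightarrow> iso a \<and> dm a = X \<and> cd a = X"
  by (auto simp: aut_def)

lemma finite_aut [simp]: "finite (aut X)"
  by (simp add: aut_def)

lemma card_aut_pos: "X \<in> Obj C \<Longrightarrow> 0 < card (aut X)"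
  using in_aut[of "ident X" X] by (auto simp: card_gt_0_iff simp del: in_aut)

lemma card_shifted_aut:
  assumes X: "X \<in> Obj C"
  shows "card (aut (shift C X)) = card (aut X)"
proof -
  have "aut (shift C X) = sh ` aut X"
  proof
    show "aut (shift C X) \<subseteq> sh ` aut X"
    proof
      fix b assume b: "b \<in> aut (shift C X)"
      then obtain a where a: "a : X \<rightharpoonup> X" "sh a = b" using sh_full[OF X X, of b] X by auto
      then have "iso a" using b iso_sh[of a] by simp
      then show "b \<in> sh ` aut X" using a by (intro image_eqI[of _ _ a]) simp_all
    qed
  qed auto
  moreover have "inj_on sh (aut X)" by (rule inj_on_subset[OF sh_inj_on[of X X]]) auto
  ultimately show ?thesis by (simp add: card_image)
qed

lemma card_shifted_End: "card (Mor (shift C X) (shift C Y)) = card (Mor X Y)" if "X \<in> Obj C" "Y \<in> Obj C"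
  using bij_betw_same_card[OF sh_bij[OF that]] by simp

lemma card_one_plus_iso:
  assumes "X \<in> Obj C"
  shows "card {b \<in> Mor X X. iso (ident X \<boxplus> b)} = card (aut X)"
proof -
  note [simp] = assms
  have "bij_betw (\<lambda>b. ident X \<boxplus> b) {b \<in> Mor X X. iso (ident X \<boxplus> b)} (aut X)"
    by (rule bij_betw_byWitness[where f' = "\<lambda>a. neg (ident X) \<boxplus> a"]) auto
  then show ?thesis by (rule bij_betw_same_card)
qed

text \<open>Modulo the radical, \<open>1 + s h\<close> only sees the component of \<open>s\<close> that is paired with the
  isomorphism \<open>\<theta>\<close>, and this component is an arbitrary endomorphism of \<open>X1\<close>.\<close>

lemma unit_proportion:
  assumes i: "i : X1 \<rightharpoonup> X" "p : X \<rightharpoonup> X1" "i ;; p = ident X1"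
    and j: "j : Y1 \<rightharpoonup> Y" "q : Y \<rightharpoonup> Y1" "j ;; q = ident Y1"
    and \<theta>: "iso \<theta>" "dm \<theta> = Y1" "cd \<theta> = shift C X1"
    and \<rho>: "rad \<rho>" "dm \<rho> = Y" "cd \<rho> = shift C X"
    and h: "h = q ;; \<theta> ;; sh i \<boxplus> \<rho>"
  shows "card (Mor (shift C X) Y) * card (aut X1)
    = card (Mor X1 X1) * card {s \<in> Mor (shift C X) Y. iso (ident (shift C X) \<boxplus> s ;; h)}"
proof -
  have [simp]: "X \<in> Obj C" "X1 \<in> Obj C" "Y \<in> Obj C" "Y1 \<in> Obj C"
    using i(1) j(1) arr_obj[of i] arr_obj[of j] by auto
  note [simp] = i j \<theta> \<rho>
  let ?S = "Mor (shift C X) Y"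
  define \<phi> where "\<phi> s = sh i ;; s ;; q ;; \<theta>" for s
  have ty: "\<phi> s : shift C X1 \<rightharpoonup> shift C X1" if "s : shift C X \<rightharpoonup> Y" for s
    using that by (simp add: \<phi>_def)
  have add: "\<phi> (s \<boxplus> t) = \<phi> s \<boxplus> \<phi> t" if "s : shift C X \<rightharpoonup> Y" "t : shift C X \<rightharpoonup> Y" for s t
    using that by (simp add: \<phi>_def comp_plus_left comp_plus_right)
  have iff: "iso (ident (shift C X) \<boxplus> s ;; h) \<longleftrightarrow> iso (ident (shift C X1) \<boxplus> \<phi> s)"
    if [simp]: "s : shift C X \<rightharpoonup> Y" for s
  proof -
    have "ident (shift C X) \<boxplus> s ;; h = (ident (shift C X) \<boxplus> (s ;; q ;; \<theta>) ;; sh i) \<boxplus> s ;; \<rho>"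
      by (simp add: h comp_plus_right plus_assoc)
    moreover have "rad (s ;; \<rho>)" by (intro rad_comp_left) simp_all
    ultimately have "iso (ident (shift C X) \<boxplus> s ;; h) \<longleftrightarrow> iso (ident (shift C X) \<boxplus> (s ;; q ;; \<theta>) ;; sh i)"
      by (simp add: iso_plus_rad_iff[of _ "shift C X"])
    \<comment> \<open>Modulo the radical the perturbation factors through \<open>X1[1]\<close>;
      exchanging the two factors turns it into an endomorphism of \<open>X1[1]\<close>.\<close>
    also have "\<dots> \<longleftrightarrow> iso (ident (shift C X1) \<boxplus> sh i ;; (s ;; q ;; \<theta>))"
      using iso_one_plus_swap[of "s ;; q ;; \<theta>" "shift C X" "shift C X1" "sh i"]
        iso_one_plus_swap[of "sh i" "shift C X1" "shift C X" "s ;; q ;; \<theta>"] by auto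
    finally show ?thesis by (simp add: \<phi>_def)
  qed
  have surj: "\<phi> ` ?S = Mor (shift C X1) (shift C X1)"
  proof
    show "\<phi> ` ?S \<subseteq> Mor (shift C X1) (shift C X1)" using ty by auto
    show "Mor (shift C X1) (shift C X1) \<subseteq> \<phi> ` ?S"
    proof
      fix b assume b: "b \<in> Mor (shift C X1) (shift C X1)"
      \<comment> \<open>A preimage of \<open>b\<close>: \<open>sh p\<close> and \<open>j\<close>
        undo \<open>sh i\<close> and \<open>q\<close> on the appropriate sides.\<close>
      define s where "s = sh p ;; b ;; inverse \<theta> ;; j"
      have [simp]: "b : shift C X1 \<rightharpoonup> shift C X1" using b by simp
      have ip: "sh i ;; sh p ;; c = c" if "arr c" "dm c = shift C X1" for c
        using that arg_cong[OF sh_comp[of i p], of "\<lambda>x. x ;; c"] by simp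
      have jq: "j ;; q ;; c = c" if "arr c" "dm c = Y1" for c
        using that comp_assoc[of j q c] by simp
      have "\<phi> s = b" by (simp add: \<phi>_def s_def ip jq)
      moreover have "s \<in> ?S" by (simp add: s_def)
      ultimately show "b \<in> \<phi> ` ?S" by blast
    qed
  qed
  let ?k = "card {s \<in> ?S. \<phi> s = zr (shift C X1) (shift C X1)}"
  have 1: "card ?S = ?k * card (Mor X1 X1)"
    using card_kernel_image[of "shift C X" Y \<phi> "shift C X1" "shift C X1"] ty add surj card_shifted_End[of X1 X1] by simp
  have "card {s \<in> ?S. iso (ident (shift C X) \<boxplus> s ;; h)} = card {s \<in> ?S. iso (ident (shift C X1) \<boxplus> \<phi> s)}"
    by (rule arg_cong[of _ _ card]) (use iff in auto)
  also have "\<dots> = ?k * card {b \<in> \<phi> ` ?S. iso (ident (shift C X1) \<boxplus> b)}"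
    using card_fibres[of "shift C X" Y \<phi> "shift C X1" "shift C X1" "\<lambda>b. iso (ident (shift C X1) \<boxplus> b)"] ty add by simp
  also have "\<dots> = ?k * card (aut X1)"
    unfolding surj using card_one_plus_iso[of "shift C X1"] card_shifted_aut[of X1] by simp
  finally show ?thesis unfolding 1 by simp
qed

text \<open>Composition with \<open>h\<close> maps Hom(X[1], Y) onto the shifted kernel of
  \<open>f\<close> with fibres of constant size, so the proportion of units may be computed among
  the \<open>s\<close>.\<close>

lemma lker_unit_proportion:
  assumes t: "tri f g h" and X: "dm f = X" "cd g = Y"
  shows "card {a \<in> lker X f. iso (ident X \<boxplus> a)} * card (Mor (shift C X) Y)
    = card (lker X f) * card {s \<in> Mor (shift C X) Y. iso (ident (shift C X) \<boxplus> s ;; h)}"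
proof -
  have [simp]: "X \<in> Obj C" "Y \<in> Obj C" using tri_typed(1,2)[OF t] X by auto
  note [simp] = tri_typed[OF t] X
  let ?S = "Mor (shift C X) Y" and ?\<phi> = "\<lambda>s. s ;; h"
  have im: "?\<phi> ` ?S = sh ` lker X f"
    using lker_image[OF tri_rotate[OF tri_rotate[OF t]], of "shift C X"] lker_shift[of f X]
    by (simp add: lker_neg)
  have inj: "inj_on sh (lker X f)" by (rule inj_on_subset[OF sh_inj_on[of X X]]) (auto simp: lker_def)
  let ?k = "card {s \<in> ?S. s ;; h = zr (shift C X) (shift C X)}"
  have 1: "card ?S = ?k * card (lker X f)"
    using card_kernel_image[of "shift C X" Y ?\<phi> "shift C X" "shift C X"] im
    by (simp add: comp_plus_left card_image[OF inj])
  have "{b \<in> ?\<phi> ` ?S. iso (ident (shift C X) \<boxplus> b)} = sh ` {a \<in> lker X f. iso (ident X \<boxplus> a)}"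
  proof -
    have "iso (ident (shift C X) \<boxplus> sh a) \<longleftrightarrow> iso (ident X \<boxplus> a)" if "a \<in> lker X f" for a
      using that iso_sh[of "ident X \<boxplus> a"] by (auto simp: lker_def sh_plus)
    then show ?thesis unfolding im by auto
  qed
  moreover have "inj_on sh {a \<in> lker X f. iso (ident X \<boxplus> a)}" by (rule inj_on_subset[OF inj]) auto
  ultimately have "card {b \<in> ?\<phi> ` ?S. iso (ident (shift C X) \<boxplus> b)} = card {a \<in> lker X f. iso (ident X \<boxplus> a)}"
    by (simp add: card_image)
  then have "card {s \<in> ?S. iso (ident (shift C X) \<boxplus> s ;; h)} = ?k * card {a \<in> lker X f. iso (ident X \<boxplus> a)}"
    using card_fibres[of "shift C X" Y ?\<phi> "shift C X" "shift C X" "\<lambda>b. iso (ident (shift C X) \<boxplus> b)"]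
    by (simp add: comp_plus_left)
  then show ?thesis unfolding 1 by simp
qed

text \<open>Now \<open>s\<close> is composed with \<open>h\<close> on the other side, which maps
  onto the kernel of Hom(g, Y). Since \<open>1 + h s\<close> and \<open>1 + s h\<close> are
  invertible together, the same set of \<open>s\<close> is counted as for \<open>f\<close>.\<close>

lemma rker_unit_proportion:
  assumes t: "tri f g h" and X: "dm f = X" "cd g = Y"
  shows "card {c \<in> rker g Y. iso (ident Y \<boxplus> c)} * card (Mor (shift C X) Y)
    = card (rker g Y) * card {s \<in> Mor (shift C X) Y. iso (ident (shift C X) \<boxplus> s ;; h)}"
proof -
  have [simp]: "X \<in> Obj C" "Y \<in> Obj C" using tri_typed(1,2)[OF t] X by auto
  note [simp] = tri_typed[OF t] X
  let ?S = "Mor (shift C X) Y" and ?\<psi> = "\<lambda>s. h ;; s"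
  have im: "?\<psi> ` ?S = rker g Y" using rker_image[OF tri_rotate[OF t], of Y] by simp
  let ?k = "card {s \<in> ?S. h ;; s = zr Y Y}"
  have 1: "card ?S = ?k * card (rker g Y)"
    using card_kernel_image[of "shift C X" Y ?\<psi> Y Y] im by (simp add: comp_plus_right)
  have "card {s \<in> ?S. iso (ident (shift C X) \<boxplus> s ;; h)} = card {s \<in> ?S. iso (ident Y \<boxplus> h ;; s)}"
    by (rule arg_cong[of _ _ card])
      (use iso_one_plus_swap[of h Y "shift C X"] iso_one_plus_swap[of _ "shift C X" Y h] in auto)
  also have "\<dots> = ?k * card {c \<in> rker g Y. iso (ident Y \<boxplus> c)}"
    using card_fibres[of "shift C X" Y ?\<psi> Y Y "\<lambda>b. iso (ident Y \<boxplus> b)"] im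
    by (simp add: comp_plus_right)
  finally show ?thesis unfolding 1 by simp
qed

text \<open>Orbit and stabiliser: the automorphisms carrying \<open>f\<close> to
  \<open>a0 ;; f\<close> are the invertible \<open>a0 (1 + a)\<close> with
  \<open>a ;; f = 0\<close>, so the stabiliser is the invertible part of a translate of the
  kernel.\<close>

lemma left_orbit_card:
  assumes "arr f" "dm f = X"
  shows "card ((\<lambda>a. a ;; f) ` aut X) * card {a \<in> lker X f. iso (ident X \<boxplus> a)} = card (aut X)"
proof -
  note [simp] = assms
  have [simp]: "X \<in> Obj C" using arr_obj(1)[OF assms(1)] by simp
  let ?O = "(\<lambda>a. a ;; f) ` aut X"
  have fib: "card {a \<in> aut X. a ;; f = b} = card {a \<in> lker X f. iso (ident X \<boxplus> a)}" if "b \<in> ?O" for b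
  proof -
    obtain a0 where a0: "iso a0" "dm a0 = X" "cd a0 = X" "b = a0 ;; f" using \<open>b \<in> ?O\<close> by auto
    note [simp] = a0(1-3)
    have "bij_betw (\<lambda>a. a0 ;; (ident X \<boxplus> a)) {a \<in> lker X f. iso (ident X \<boxplus> a)} {a \<in> aut X. a ;; f = b}"
    proof (rule bij_betw_byWitness[where f' = "\<lambda>a. neg (ident X) \<boxplus> inverse a0 ;; a"])
      show "(\<lambda>a. neg (ident X) \<boxplus> inverse a0 ;; a) ` {a \<in> aut X. a ;; f = b} \<subseteq> {a \<in> lker X f. iso (ident X \<boxplus> a)}"
        by (auto simp: lker_def comp_plus_left a0(4))
      show "(\<lambda>a. a0 ;; (ident X \<boxplus> a)) ` {a \<in> lker X f. iso (ident X \<boxplus> a)} \<subseteq> {a \<in> aut X. a ;; f = b}"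
        by (auto simp: lker_def comp_plus_left a0(4))
    qed (auto simp: lker_def)
    then show ?thesis by (simp add: bij_betw_same_card)
  qed
  have "card (aut X) = (\<Sum>b\<in>?O. card {a \<in> aut X. a ;; f = b})"
    by (rule card_by_class) (auto simp del: in_aut)
  also have "\<dots> = card ?O * card {a \<in> lker X f. iso (ident X \<boxplus> a)}" using fib by simp
  finally show ?thesis by simp
qed

lemma right_orbit_card:
  assumes "arr g" "cd g = Y"
  shows "card ((\<lambda>c. g ;; c) ` aut Y) * card {c \<in> rker g Y. iso (ident Y \<boxplus> c)} = card (aut Y)"
proof -
  note [simp] = assms
  have [simp]: "Y \<in> Obj C" using arr_obj(2)[OF assms(1)] by simp
  let ?O = "(\<lambda>c. g ;; c) ` aut Y"
  have fib: "card {a \<in> aut Y. g ;; a = b} = card {a \<in> rker g Y. iso (ident Y \<boxplus> a)}" if "b \<in> ?O" for b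
  proof -
    obtain a0 where a0: "iso a0" "dm a0 = Y" "cd a0 = Y" "b = g ;; a0" using \<open>b \<in> ?O\<close> by auto
    note [simp] = a0(1-3)
    have ga: "g ;; a ;; inverse a0 = g" if "iso a" "dm a = Y" "cd a = Y" "g ;; a = g ;; a0" for a
      using that comp_assoc[of g a "inverse a0"] comp_assoc[of g a0 "inverse a0"] by (simp del: comp_assoc)
    have "bij_betw (\<lambda>a. (ident Y \<boxplus> a) ;; a0) {a \<in> rker g Y. iso (ident Y \<boxplus> a)} {a \<in> aut Y. g ;; a = b}"
    proof (rule bij_betw_byWitness[where f' = "\<lambda>a. neg (ident Y) \<boxplus> a ;; inverse a0"])
      show "(\<lambda>a. neg (ident Y) \<boxplus> a ;; inverse a0) ` {a \<in> aut Y. g ;; a = b} \<subseteq> {a \<in> rker g Y. iso (ident Y \<boxplus> a)}"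
        using ga by (auto simp: rker_def comp_plus_right a0(4))
      have "g ;; (ident Y \<boxplus> a) ;; a0 = g ;; a0" if "a \<in> rker g Y" for a
        using that comp_assoc[of g "ident Y \<boxplus> a" a0] by (auto simp: rker_def comp_plus_right simp del: comp_assoc)
      then show "(\<lambda>a. (ident Y \<boxplus> a) ;; a0) ` {a \<in> rker g Y. iso (ident Y \<boxplus> a)} \<subseteq> {a \<in> aut Y. g ;; a = b}"
        by (auto simp: rker_def a0(4))
    qed (auto simp: rker_def)
    then show ?thesis by (simp add: bij_betw_same_card)
  qed
  have "card (aut Y) = (\<Sum>b\<in>?O. card {a \<in> aut Y. g ;; a = b})"
    by (rule card_by_class) (auto simp del: in_aut)
  also have "\<dots> = card ?O * card {a \<in> rker g Y. iso (ident Y \<boxplus> a)}" using fib by simp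
  finally show ?thesis by simp
qed

subsection \<open>Orbits of triangles\<close>

text \<open>By uniqueness of cones the condition concerns \<open>f\<close> and the isomorphism class
  of \<open>Y\<close> only, which lets a single map stand for a triangle.\<close>

definition cone_maps :: "'o \<Rightarrow> 'o \<Rightarrow> 'o \<Rightarrow> ('o, 'm) arrow set" where
  "cone_maps X L Y = {f \<in> Mor X L. \<exists>g h. tri f g h \<and> cd g = Y}"

definition cocone_maps :: "'o \<Rightarrow> 'o \<Rightarrow> 'o \<Rightarrow> ('o, 'm) arrow set" where
  "cocone_maps X L Y = {g \<in> Mor L Y. \<exists>f h. tri f g h \<and> dm f = X}"

lemma cone_maps_subset: "cone_maps X L Y \<subseteq> Mor X L" and cocone_maps_subset: "cocone_maps X L Y \<subseteq> Mor L Y"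
  by (auto simp: cone_maps_def cocone_maps_def)

lemma finite_cone_maps [simp]: "finite (cone_maps X L Y)" and finite_cocone_maps [simp]: "finite (cocone_maps X L Y)"
  by (simp_all add: cone_maps_def cocone_maps_def)

text \<open>An orbit of triples described through its first maps; the other two components range
  over all completions with cone \<open>Y\<close>. That this is a full orbit is
  \<open>orbit_eq\<close>.\<close>

definition orbit_of :: "'o \<Rightarrow> 'o \<Rightarrow> 'o \<Rightarrow> ('o, 'm) arrow \<Rightarrow> ('m \<times> 'm \<times> 'm) set" where
  "orbit_of X L Y f = {(mp f', mp g', mp h') | f' g' h'.
     tri f' g' h' \<and> cd f' = L \<and> cd g' = Y \<and> f' \<in> (\<lambda>a. a ;; f) ` aut X}"

lemma mp_comp: "mp (a ;; b) = mp a \<cdot>\<^bsub>C\<^esub> mp b"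
  by (simp add: comp_def)

lemma mp_plus: "mp (a \<boxplus> b) = mp a \<oplus>\<^bsub>Hom C (dm a) (cd a)\<^esub> mp b"
  by (simp add: plus_arr_def)

lemma tri_W_iff:
  assumes "X \<in> Obj C" "L \<in> Obj C" "Y \<in> Obj C"
  shows "(f, g, h) \<in> tri_W C X Y L \<longleftrightarrow> tri (Arrow X f L) (Arrow L g Y) (Arrow Y h (shift C X))"
  using assms by (auto simp: tri_W_def tri_def arr_Arrow)

lemma inv_End_ring:
  assumes "iso a" "dm a = X" "cd a = X"
  shows "inv\<^bsub>End_ring C X\<^esub> (mp a) = mp (inverse a)"
proof -
  have [simp]: "X \<in> Obj C" using arr_obj(1)[OF iso_arr[OF assms(1)]] assms by simp
  note [simp] = assms
  have a: "a = Arrow X (mp a) X" using arrow_cases(1)[of a X X] by simp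
  have i: "mp (inverse a) \<in> mor C X X" using arrow_cases(4)[of "inverse a" X X] by simp
  show ?thesis
    unfolding m_inv_def
  proof (rule the_equality)
    show "mp (inverse a) \<in> carrier (End_ring C X) \<and> mp a \<otimes>\<^bsub>End_ring C X\<^esub> mp (inverse a) = \<one>\<^bsub>End_ring C X\<^esub> \<and>
        mp (inverse a) \<otimes>\<^bsub>End_ring C X\<^esub> mp a = \<one>\<^bsub>End_ring C X\<^esub>"
      using i inverse_simps(4,5)[OF assms(1)] by (simp add: comp_def ident_def)
  next
    fix y assume y: "y \<in> carrier (End_ring C X) \<and> mp a \<otimes>\<^bsub>End_ring C X\<^esub> y = \<one>\<^bsub>End_ring C X\<^esub> \<and>
        y \<otimes>\<^bsub>End_ring C X\<^esub> mp a = \<one>\<^bsub>End_ring C X\<^esub>"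
    then have "inverse a = Arrow X y X"
      by (intro inverse_unique) (simp_all add: arr_Arrow comp_def ident_def)
    then show "y = mp (inverse a)" by simp
  qed
qed

lemma carrier_Aut: "X \<in> Obj C \<Longrightarrow> carrier (Aut C X) = mp ` aut X"
proof -
  assume X: "X \<in> Obj C"
  show ?thesis
  proof
    show "carrier (Aut C X) \<subseteq> mp ` aut X"
      using Units_End_ring[OF X] by (auto simp: units_of_def intro!: image_eqI[of _ mp "Arrow X x X" for x])
    show "mp ` aut X \<subseteq> carrier (Aut C X)"
    proof
      fix x assume "x \<in> mp ` aut X"
      then obtain a where a: "iso a" "dm a = X" "cd a = X" "x = mp a" by auto
      then have "Arrow X x X = a" using arrow_cases(1)[of a X X] by simp
      then show "x \<in> carrier (Aut C X)" using a(1) Units_End_ring[OF X, of x] by (simp add: units_of_def)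
    qed
  qed
qed

lemma card_carrier_Aut: "X \<in> Obj C \<Longrightarrow> card (carrier (Aut C X)) = card (aut X)"
  unfolding carrier_Aut by (rule card_image) (auto simp: inj_on_def intro: arrow_eqI)

text \<open>From \<open>f' = a ;; f\<close>, uniqueness of cones supplies the automorphism of
  \<open>Y\<close>, inverted to match the action; from \<open>g' = g ;; c\<close>, uniqueness of
  cocones supplies that of \<open>X\<close>. An orbit is therefore recognised at either end.\<close>

lemma left_orbit_iff:
  assumes "tri f g h" "tri f' g' h'" "dm f = X" "dm f' = X" "cd g = Y" "cd g' = Y"
  shows "f' \<in> (\<lambda>a. a ;; f) ` aut X \<longleftrightarrow>
    (\<exists>a\<in>aut X. \<exists>c\<in>aut Y. f' = a ;; f \<and> g' = g ;; inverse c \<and> h' = (c ;; h) ;; inverse (sh a))" (is "?A \<longleftrightarrow> ?B")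
    and "g' \<in> (\<lambda>c. g ;; c) ` aut Y \<longleftrightarrow>
    (\<exists>a\<in>aut X. \<exists>c\<in>aut Y. f' = a ;; f \<and> g' = g ;; inverse c \<and> h' = (c ;; h) ;; inverse (sh a))" (is "?A' \<longleftrightarrow> ?B")
proof -
  have AB: "?B" if "?A"
  proof -
    obtain a where a: "iso a" "dm a = X" "cd a = X" "f' = a ;; f" using \<open>?A\<close> by auto
    have t: "tri f' g (h ;; inverse (sh a))" using tri_replace_cocone[OF assms(1) a(1)] a assms(3) by simp
    obtain c where c: "iso c" "dm c = cd g" "cd c = cd g'" "g ;; c = g'" "c ;; h' = h ;; inverse (sh a)"
      using cone_unique[OF t assms(2)] by blast
    have "h' = inverse c ;; (c ;; h')" using c(1-3) tri_typed[OF assms(2)] by simp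
    also have "\<dots> = (inverse c ;; h) ;; inverse (sh a)"
      unfolding c(5) using c(1-3) a(1-3) assms(3) tri_typed[OF assms(1)] by (simp add: inverse_sh)
    finally have h': "h' = (inverse c ;; h) ;; inverse (sh a)" .
    have "inverse (inverse c) = c" by (rule inverse_unique) (use c(1) in simp_all)
    then show ?B using a c assms(5,6) h' by (intro bexI[of _ a] bexI[of _ "inverse c"]) simp_all
  qed
  have BA: "?A" if "?B" using that by auto
  show "?A \<longleftrightarrow> ?B" using AB BA by blast
  have BA': "?A'" if "?B" 
  proof -
    obtain c where "iso c" "dm c = Y" "cd c = Y" "g' = g ;; inverse c" using \<open>?B\<close> by auto
    then show ?A' by (intro image_eqI[of _ _ "inverse c"]) simp_all
  qed
  have "?A" if "?A'"
  proof -
    obtain c where c: "iso c" "dm c = Y" "cd c = Y" "g' = g ;; c" using \<open>?A'\<close> by auto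
    have t: "tri f g' (inverse c ;; h)" using tri_replace_cone[OF assms(1) c(1)] c assms(5) by simp
    obtain a where "iso a" "dm a = dm f'" "cd a = dm f" "f' = a ;; f"
      using cocone_unique[OF t assms(2)] by blast
    then show ?A using assms(3,4) by auto
  qed
  then show "?A' \<longleftrightarrow> ?B" using AB BA' by blast
qed

lemma orbit_eq:
  assumes t: "tri f g h" and X: "dm f = X" "cd f = L" "cd g = Y"
  shows "orbit (Aut C X \<times>\<times> Aut C Y) (tri_action C X Y) (mp f, mp g, mp h) = orbit_of X L Y f"
proof -
  note [simp] = tri_typed[OF t] X
  have [simp]: "X \<in> Obj C" "Y \<in> Obj C" "L \<in> Obj C" using tri_typed[OF t] X arr_obj by metis+
  have act: "tri_action C X Y (mp a, mp c) (mp f, mp g, mp h) =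
      (mp (a ;; f), mp (g ;; inverse c), mp ((c ;; h) ;; inverse (sh a)))" if "a \<in> aut X" "c \<in> aut Y" for a c
  proof -
    have "inv\<^bsub>End_ring C (shift C X)\<^esub> (mp (sh a)) = mp (inverse (sh a))" "inv\<^bsub>End_ring C Y\<^esub> (mp c) = mp (inverse c)"
      using that by (auto intro: inv_End_ring)
    then show ?thesis by (simp add: tri_action_def comp_def sh_def)
  qed
  have 1: "orbit (Aut C X \<times>\<times> Aut C Y) (tri_action C X Y) (mp f, mp g, mp h)
      = {tri_action C X Y (mp a, mp c) (mp f, mp g, mp h) | a c. a \<in> aut X \<and> c \<in> aut Y}"
    by (auto simp: orbit_def DirProd_def carrier_Aut simp del: in_aut)
  show ?thesis
  proof
    show "orbit (Aut C X \<times>\<times> Aut C Y) (tri_action C X Y) (mp f, mp g, mp h) \<subseteq> orbit_of X L Y f"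
    proof
      fix x assume "x \<in> orbit (Aut C X \<times>\<times> Aut C Y) (tri_action C X Y) (mp f, mp g, mp h)"
      then obtain a c where ac: "a \<in> aut X" "c \<in> aut Y"
        and x: "x = (mp (a ;; f), mp (g ;; inverse c), mp ((c ;; h) ;; inverse (sh a)))"
        unfolding 1 using act by auto
      have [simp]: "iso a" "dm a = X" "cd a = X" "iso c" "dm c = Y" "cd c = Y" using ac by auto
      have "tri f (g ;; inverse c) (c ;; h)"
        using tri_replace_cone[OF t, of "inverse c"] inverse_unique[of "inverse c" c] by simp
      from tri_replace_cocone[OF this, of a]
      have "tri (a ;; f) (g ;; inverse c) ((c ;; h) ;; inverse (sh a))" by simp
      then show "x \<in> orbit_of X L Y f" unfolding x orbit_of_def using ac(1) by force
    qed
    show "orbit_of X L Y f \<subseteq> orbit (Aut C X \<times>\<times> Aut C Y) (tri_action C X Y) (mp f, mp g, mp h)"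
    proof
      fix x assume "x \<in> orbit_of X L Y f"
      then obtain f' g' h' where x: "x = (mp f', mp g', mp h')" and t': "tri f' g' h'" "cd f' = L" "cd g' = Y"
        and f': "f' \<in> (\<lambda>a. a ;; f) ` aut X" unfolding orbit_of_def by blast
      have "dm f' = X" using f' by auto
      then obtain a c where ac: "a \<in> aut X" "c \<in> aut Y"
        and e: "f' = a ;; f" "g' = g ;; inverse c" "h' = (c ;; h) ;; inverse (sh a)"
        using left_orbit_iff(1)[OF t t'(1)] f' t'(3) X by blast
      then show "x \<in> orbit (Aut C X \<times>\<times> Aut C Y) (tri_action C X Y) (mp f, mp g, mp h)"
        unfolding 1 x e act[OF ac, symmetric] using ac by blast
    qed
  qed
qed

lemma cone_mapsD:
  assumes "f \<in> cone_maps X L Y"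
  obtains g h where "tri f g h" "dm f = X" "cd f = L" "cd g = Y" "dm g = L"
  using assms tri_typed(4) unfolding cone_maps_def by fastforce

lemma cone_mapsI: "tri f g h \<Longrightarrow> f \<in> cone_maps (dm f) (cd f) (cd g)"
  using tri_typed(1)[of f g h] by (auto simp: cone_maps_def)

lemma cocone_mapsI: "tri f g h \<Longrightarrow> g \<in> cocone_maps (dm f) (cd f) (cd g)"
  using tri_typed(2,4)[of f g h] by (auto simp: cocone_maps_def)

lemma tri_V_eq:
  assumes "X \<in> Obj C" "L \<in> Obj C" "Y \<in> Obj C"
  shows "tri_V C X Y L = orbit_of X L Y ` cone_maps X L Y"
proof
  show "tri_V C X Y L \<subseteq> orbit_of X L Y ` cone_maps X L Y"
  proof
    fix \<alpha> assume "\<alpha> \<in> tri_V C X Y L"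
    then obtain f g h where w: "(f, g, h) \<in> tri_W C X Y L"
      and \<alpha>: "\<alpha> = orbit (Aut C X \<times>\<times> Aut C Y) (tri_action C X Y) (f, g, h)"
      unfolding tri_V_def orbits_def by auto
    have t: "tri (Arrow X f L) (Arrow L g Y) (Arrow Y h (shift C X))" using w tri_W_iff[OF assms] by simp
    then have "\<alpha> = orbit_of X L Y (Arrow X f L)" unfolding \<alpha> using orbit_eq[OF t, of X L Y] by simp
    moreover have "Arrow X f L \<in> cone_maps X L Y" using cone_mapsI[OF t] by simp
    ultimately show "\<alpha> \<in> orbit_of X L Y ` cone_maps X L Y" by blast
  qed
  show "orbit_of X L Y ` cone_maps X L Y \<subseteq> tri_V C X Y L"
  proof
    fix \<alpha> assume "\<alpha> \<in> orbit_of X L Y ` cone_maps X L Y"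
    then obtain f where f: "f \<in> cone_maps X L Y" "\<alpha> = orbit_of X L Y f" by blast
    obtain g h where t: "tri f g h" and X: "dm f = X" "cd f = L" "cd g = Y" "dm g = L" using cone_mapsD[OF f(1)] .
    have \<alpha>: "\<alpha> = orbit (Aut C X \<times>\<times> Aut C Y) (tri_action C X Y) (mp f, mp g, mp h)"
      using orbit_eq[OF t X(1-3)] f(2) by simp
    have "f = Arrow X (mp f) L" "g = Arrow L (mp g) Y" "h = Arrow Y (mp h) (shift C X)"
      using tri_typed[OF t] X arrow_cases(1) by blast+
    then have "(mp f, mp g, mp h) \<in> tri_W C X Y L" using t tri_W_iff[OF assms] by metis
    then show "\<alpha> \<in> tri_V C X Y L" unfolding \<alpha> tri_V_def orbits_def by blast
  qed
qed

lemma orbit_ofD: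
  assumes "(f, g, h) \<in> orbit_of X L Y f0" "f0 \<in> cone_maps X L Y"
  obtains "tri (Arrow X f L) (Arrow L g Y) (Arrow Y h (shift C X))" "Arrow X f L \<in> (\<lambda>a. a ;; f0) ` aut X"
proof -
  obtain f' g' h' where e: "f = mp f'" "g = mp g'" "h = mp h'" and t': "tri f' g' h'" "cd f' = L" "cd g' = Y"
    and f': "f' \<in> (\<lambda>a. a ;; f0) ` aut X" using assms(1) unfolding orbit_of_def by blast
  have "dm f' = X" using f' by auto
  then have "f' = Arrow X f L" "g' = Arrow L g Y" "h' = Arrow Y h (shift C X)"
    using tri_typed[OF t'(1)] t' arrow_cases(1) e by metis+
  then show thesis using that t' f' by simp
qed

lemma aut_orbit_eq:
  assumes "f \<in> (\<lambda>a. a ;; f0) ` aut X" "arr f0" "dm f0 = X"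
  shows "(\<lambda>a. a ;; f) ` aut X = (\<lambda>a. a ;; f0) ` aut X"
proof -
  obtain a0 where a0: "iso a0" "dm a0 = X" "cd a0 = X" "f = a0 ;; f0" using assms by auto
  note [simp] = a0(1-3) assms(2,3)
  have "X \<in> Obj C" using arr_obj(1)[OF assms(2)] by simp
  show ?thesis
  proof
    show "(\<lambda>a. a ;; f) ` aut X \<subseteq> (\<lambda>a. a ;; f0) ` aut X"
    proof
      fix x assume "x \<in> (\<lambda>a. a ;; f) ` aut X"
      then obtain a where "iso a" "dm a = X" "cd a = X" "x = a ;; f" by auto
      then show "x \<in> (\<lambda>a. a ;; f0) ` aut X"
        by (intro image_eqI[of _ _ "a ;; a0"]) (simp_all add: a0(4))
    qed
    show "(\<lambda>a. a ;; f0) ` aut X \<subseteq> (\<lambda>a. a ;; f) ` aut X"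
    proof
      fix x assume "x \<in> (\<lambda>a. a ;; f0) ` aut X"
      then obtain a where "iso a" "dm a = X" "cd a = X" "x = a ;; f0" by auto
      then show "x \<in> (\<lambda>a. a ;; f) ` aut X"
        by (intro image_eqI[of _ _ "a ;; inverse a0"]) (simp_all add: a0(4))
    qed
  qed
qed

text \<open>Gives the choice in \<open>X1_of\<close> a witness. The decomposition applies to
  \<open>h\<close> itself, so \<open>a\<close> and \<open>c\<close> can be identities.\<close>

lemma is_X1_exists:
  assumes "f0 \<in> cone_maps X L Y"
  shows "\<exists>X1. is_X1 C X Y (orbit_of X L Y f0) X1"
proof -
  obtain g h where t: "tri f0 g h" and X: "dm f0 = X" "cd f0 = L" "cd g = Y" "dm g = L" using cone_mapsD[OF assms] .
  note [simp] = tri_typed[OF t] X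
  have [simp]: "X \<in> Obj C" "Y \<in> Obj C" using tri_typed[OF t] X arr_obj by metis+
  have "h : Y \<rightharpoonup> shift C X" by simp
  then obtain X1 X2 Y1 Y2 i1 i2 p1 p2 j1 j2 q1 q2 h11 h22 where
    bX: "biprod X X1 X2 i1 i2 p1 p2" and bY: "biprod Y Y1 Y2 j1 j2 q1 q2"
    and h11: "iso h11" "dm h11 = Y1" "cd h11 = shift C X1"
    and h22: "rad h22" "dm h22 = Y2" "cd h22 = shift C X2"
    and h: "h = q1 ;; h11 ;; sh i1 \<boxplus> q2 ;; h22 ;; sh i2"
    by (rule iso_rad_decomposition) simp
  note [simp] = biprodD[OF bX] biprodD[OF bY] h11 h22
  have i: "mp (ident X) \<in> carrier (Aut C X)" "mp (ident Y) \<in> carrier (Aut C Y)"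
    by (auto simp: carrier_Aut)
  have orb: "(mp f0, mp g, mp h) \<in> orbit_of X L Y f0"
    unfolding orbit_of_def using t by (force intro: image_eqI[of _ _ "ident X"])
  have "inv\<^bsub>End_ring C (shift C X)\<^esub> (shift_mor C (mp (ident X))) = mp (inverse (ident (shift C X)))"
  proof -
    have "shift_mor C (mp (ident X)) = mp (ident (shift C X))" using shift_idt[of X] by (simp add: ident_def)
    then show ?thesis using inv_End_ring[of "ident (shift C X)" "shift C X"] by simp
  qed
  also have "inverse (ident (shift C X)) = ident (shift C X)" by (rule inverse_unique) simp_all
  finally have inv: "inv\<^bsub>End_ring C (shift C X)\<^esub> (shift_mor C (mp (ident X))) = mp (ident (shift C X))" .
  have "(ident Y ;; h) ;; ident (shift C X) = (q1 ;; h11) ;; sh i1 \<boxplus> (q2 ;; h22) ;; sh i2"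
    using h by simp
  then have eq: "mp (ident Y) \<cdot>\<^bsub>C\<^esub> mp h \<cdot>\<^bsub>C\<^esub> inv\<^bsub>End_ring C (shift C X)\<^esub> (shift_mor C (mp (ident X))) =
      (mp q1 \<cdot>\<^bsub>C\<^esub> mp h11 \<cdot>\<^bsub>C\<^esub> shift_mor C (mp i1)) \<oplus>\<^bsub>Hom C Y (shift C X)\<^esub> (mp q2 \<cdot>\<^bsub>C\<^esub> mp h22 \<cdot>\<^bsub>C\<^esub> shift_mor C (mp i2))"
    unfolding inv by (simp add: comp_def plus_arr_def sh_def)
  have iso11: "is_iso C Y1 (shift C X1) (mp h11)" using iso_is_iso[OF h11(1)] by simp
  have "h22 = Arrow Y2 (mp h22) (shift C X2)" using arrow_cases(1)[of h22 Y2 "shift C X2"] h22 by simp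
  then have rad22: "mp h22 \<in> radHom C Y2 (shift C X2)" using h22(1) radHom_iff[of Y2 "shift C X2" "mp h22"] by simp
  show ?thesis
    unfolding is_X1_def
    using orb biprod_is_biprod[OF bX] biprod_is_biprod[OF bY] i iso11 rad22 eq by blast
qed

text \<open>Formulated for every witness of \<open>is_X1\<close>, since \<open>X1_of\<close> is an
  unspecified choice and its representative may differ from \<open>f0\<close>. The automorphisms
  \<open>a\<close> and \<open>c\<close> are absorbed into the inclusions and projections before
  \<open>unit_proportion\<close> is applied.\<close>

lemma is_X1_proportion:
  assumes "f0 \<in> cone_maps X L Y" "is_X1 C X Y (orbit_of X L Y f0) X1"
  shows "X1 \<in> Obj C"
    and "\<exists>f g h. tri f g h \<and> dm f = X \<and> cd f = L \<and> cd g = Y \<and> f \<in> (\<lambda>a. a ;; f0) ` aut X \<and>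
      card (Mor (shift C X) Y) * card (aut X1)
      = card (Mor X1 X1) * card {s \<in> Mor (shift C X) Y. iso (ident (shift C X) \<boxplus> s ;; h)}"
proof -
  obtain rf rg rh X2 Y1 Y2 ri1 ri2 rp1 rp2 rj1 rj2 rq1 rq2 ra rc rh11 rh22 where
    orb: "(rf, rg, rh) \<in> orbit_of X L Y f0" and
    bX: "is_biprod C X X1 X2 ri1 ri2 rp1 rp2" and bY: "is_biprod C Y Y1 Y2 rj1 rj2 rq1 rq2" and
    ac: "ra \<in> carrier (Aut C X)" "rc \<in> carrier (Aut C Y)" and
    h11: "is_iso C Y1 (shift C X1) rh11" and h22: "rh22 \<in> radHom C Y2 (shift C X2)" and
    eq: "rc \<cdot>\<^bsub>C\<^esub> rh \<cdot>\<^bsub>C\<^esub> inv\<^bsub>End_ring C (shift C X)\<^esub> (shift_mor C ra) =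
          (rq1 \<cdot>\<^bsub>C\<^esub> rh11 \<cdot>\<^bsub>C\<^esub> shift_mor C ri1) \<oplus>\<^bsub>Hom C Y (shift C X)\<^esub> (rq2 \<cdot>\<^bsub>C\<^esub> rh22 \<cdot>\<^bsub>C\<^esub> shift_mor C ri2)"
    using assms(2) unfolding is_X1_def by blast
  obtain i1 i2 p1 p2 where BX: "biprod X X1 X2 i1 i2 p1 p2" and mi: "mp i1 = ri1" "mp i2 = ri2"
    using bX unfolding is_biprod_iff by (metis arrow.sel(2))
  obtain j1 j2 q1 q2 where BY: "biprod Y Y1 Y2 j1 j2 q1 q2" and mq: "mp q1 = rq1" "mp q2 = rq2"
    using bY unfolding is_biprod_iff by (metis arrow.sel(2))
  note [simp] = biprodD[OF BX] biprodD[OF BY] biprod_comp[OF BX] biprod_comp[OF BY]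
  show "X1 \<in> Obj C" by simp
  obtain a where a: "iso a" "dm a = X" "cd a = X" "mp a = ra" using ac(1) by (auto simp: carrier_Aut)
  obtain c where c: "iso c" "dm c = Y" "cd c = Y" "mp c = rc" using ac(2) by (auto simp: carrier_Aut)
  define f g h where "f = Arrow X rf L" and "g = Arrow L rg Y" and "h = Arrow Y rh (shift C X)"
  have t: "tri f g h" and orb': "f \<in> (\<lambda>a. a ;; f0) ` aut X"
    using orbit_ofD[OF orb assms(1)] unfolding f_def g_def h_def by blast+
  have [simp]: "dm f = X" "cd f = L" "dm g = L" "cd g = Y" "dm h = Y" "cd h = shift C X" "arr f" "arr g" "arr h"
    using tri_typed[OF t] by (simp_all add: f_def g_def h_def)
  define \<theta> \<rho> where "\<theta> = Arrow Y1 rh11 (shift C X1)" and "\<rho> = Arrow Y2 rh22 (shift C X2)"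
  have \<theta>: "iso \<theta>" "dm \<theta> = Y1" "cd \<theta> = shift C X1" using h11 by (simp_all add: \<theta>_def is_iso_iff)
  have \<rho>: "rad \<rho>" "dm \<rho> = Y2" "cd \<rho> = shift C X2" using h22 by (simp_all add: \<rho>_def radHom_iff)
  note [simp] = a(1-3) c(1-3) \<theta> \<rho>
  have inv: "inv\<^bsub>End_ring C (shift C X)\<^esub> (shift_mor C ra) = mp (inverse (sh a))"
  proof -
    have "shift_mor C ra = mp (sh a)" using a(4) by (simp add: sh_def)
    then show ?thesis using inv_End_ring[of "sh a" "shift C X"] by simp
  qed
  have "(c ;; h) ;; inverse (sh a) = (q1 ;; \<theta>) ;; sh i1 \<boxplus> (q2 ;; \<rho>) ;; sh i2"
  proof (rule arrow_eqI)
    have "mp h = rh" "mp \<theta> = rh11" "mp \<rho> = rh22" by (simp_all add: h_def \<theta>_def \<rho>_def)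
    then have "mp c \<cdot>\<^bsub>C\<^esub> mp h \<cdot>\<^bsub>C\<^esub> mp (inverse (sh a)) = (mp q1 \<cdot>\<^bsub>C\<^esub> mp \<theta> \<cdot>\<^bsub>C\<^esub> mp (sh i1))
        \<oplus>\<^bsub>Hom C Y (shift C X)\<^esub> (mp q2 \<cdot>\<^bsub>C\<^esub> mp \<rho> \<cdot>\<^bsub>C\<^esub> mp (sh i2))"
      using eq unfolding inv using mi mq c(4) by (simp add: sh_def)
    then show "mp ((c ;; h) ;; inverse (sh a)) = mp ((q1 ;; \<theta>) ;; sh i1 \<boxplus> (q2 ;; \<rho>) ;; sh i2)"
      by (simp add: mp_comp mp_plus del: comp_assoc)
  qed simp_all
  then have e: "c ;; h ;; sh (inverse a) = q1 ;; \<theta> ;; sh i1 \<boxplus> q2 ;; \<rho> ;; sh i2"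
    by (simp add: inverse_sh)
  have aa: "sh (inverse a) ;; sh a = ident (shift C X)" using sh_comp[of "inverse a" a] by simp
  \<comment> \<open>After solving for \<open>h\<close>, the first summand still passes through an
    isomorphism of direct summands, and the second is still radical because the radical is an
    ideal.\<close>
  have "h = inverse c ;; (c ;; h ;; sh (inverse a)) ;; sh a" by (simp add: aa)
  also have "\<dots> = (inverse c ;; q1) ;; \<theta> ;; sh (i1 ;; a) \<boxplus> inverse c ;; q2 ;; \<rho> ;; sh i2 ;; sh a"
    unfolding e by (simp add: comp_plus_left comp_plus_right)
  finally have h: "h = (inverse c ;; q1) ;; \<theta> ;; sh (i1 ;; a) \<boxplus> inverse c ;; q2 ;; \<rho> ;; sh i2 ;; sh a" .
  have "rad (inverse c ;; q2 ;; \<rho> ;; sh i2 ;; sh a)"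
    by (intro rad_comp_left rad_comp_right) simp_all
  then have "card (Mor (shift C X) Y) * card (aut X1)
      = card (Mor X1 X1) * card {s \<in> Mor (shift C X) Y. iso (ident (shift C X) \<boxplus> s ;; h)}"
    by (intro unit_proportion[where i = "i1 ;; a" and p = "inverse a ;; p1" and j = "j1 ;; c" and q = "inverse c ;; q1"
        and \<theta> = \<theta> and \<rho> = "inverse c ;; q2 ;; \<rho> ;; sh i2 ;; sh a" and ?Y1.0 = Y1]) (simp_all add: h)
  then show "\<exists>f g h. tri f g h \<and> dm f = X \<and> cd f = L \<and> cd g = Y \<and> f \<in> (\<lambda>a. a ;; f0) ` aut X \<and>
      card (Mor (shift C X) Y) * card (aut X1)
      = card (Mor X1 X1) * card {s \<in> Mor (shift C X) Y. iso (ident (shift C X) \<boxplus> s ;; h)}"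
    using t orb' by (intro exI[of _ f] exI[of _ g] exI[of _ h]) simp
qed

text \<open>The part of the first formula for F(X, Y; L) that does not involve \<open>Y\<close>, as
  \<open>in_factor\<close> is the part of the second that does not involve \<open>X\<close>.
  Associativity relies on this separation.\<close>

definition out_factor :: "'o \<Rightarrow> 'o \<Rightarrow> rat" where
  "out_factor X L = hom_bracket C X L / (hom_bracket C X X * of_nat (card (aut X)))"

definition in_factor :: "'o \<Rightarrow> 'o \<Rightarrow> rat" where
  "in_factor L Y = hom_bracket C L Y / (hom_bracket C Y Y * of_nat (card (aut Y)))"

definition weight :: "'o \<Rightarrow> 'o \<Rightarrow> ('m \<times> 'm \<times> 'm) set \<Rightarrow> rat" where
  "weight X Y \<alpha> = of_nat (card (carrier (End_ring C (X1_of C X Y \<alpha>)))) / of_nat (card (carrier (Aut C (X1_of C X Y \<alpha>))))"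

text \<open>Let \<open>N\<close> be the orbit length, \<open>K\<close> the order of the kernel and
  \<open>U\<close> the number of invertible \<open>1 + a\<close> with \<open>a\<close> in the
  kernel. At the \<open>X\<close> end \<open>N U = |Aut X|\<close> and
  \<open>U / K = |Aut X1| / |End X1|\<close>, and the long exact sequence gives \<open>K\<close>.
  The \<open>Y\<close> end has the same shape, which is why the calculation \<open>calc\<close> is
  shared.\<close>

lemma weight_orbit:
  assumes t: "tri f g h" and X: "dm f = X" "cd f = L" "cd g = Y"
  shows "hom_bracket C X Y * weight X Y (orbit_of X L Y f)
      = of_nat (card ((\<lambda>a. a ;; f) ` aut X)) * out_factor X L"
    and "hom_bracket C X Y * weight X Y (orbit_of X L Y f)
      = of_nat (card ((\<lambda>c. g ;; c) ` aut Y)) * in_factor L Y"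
proof -
  have f: "f \<in> cone_maps X L Y" using cone_mapsI[OF t] X by simp
  note [simp] = tri_typed[OF t] X
  have [simp]: "X \<in> Obj C" "Y \<in> Obj C" "L \<in> Obj C" using tri_typed[OF t] X arr_obj by metis+
  define X1 where "X1 = X1_of C X Y (orbit_of X L Y f)"
  have "is_X1 C X Y (orbit_of X L Y f) X1"
    unfolding X1_def X1_of_def using someI_ex[OF is_X1_exists[OF f]] .
  from is_X1_proportion[OF f this] obtain f' g' h' where [simp]: "X1 \<in> Obj C" and
    t': "tri f' g' h'" and X': "dm f' = X" "cd f' = L" "cd g' = Y" and
    orb: "f' \<in> (\<lambda>a. a ;; f) ` aut X" and
    ratio: "card (Mor (shift C X) Y) * card (aut X1)
      = card (Mor X1 X1) * card {s \<in> Mor (shift C X) Y. iso (ident (shift C X) \<boxplus> s ;; h')}" by blast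
  note [simp] = tri_typed[OF t'] X'
  have w: "weight X Y (orbit_of X L Y f) = of_nat (card (Mor X1 X1)) / of_nat (card (aut X1))"
    unfolding weight_def X1_def[symmetric] by (simp add: card_carrier_Aut card_Mor)
  define S I E A where "S = (of_nat (card (Mor (shift C X) Y)) :: rat)"
    and "I = (of_nat (card {s \<in> Mor (shift C X) Y. iso (ident (shift C X) \<boxplus> s ;; h')}) :: rat)"
    and "E = (of_nat (card (Mor X1 X1)) :: rat)" and "A = (of_nat (card (aut X1)) :: rat)"
  have nz: "S \<noteq> 0" "A \<noteq> 0" "E \<noteq> 0"
    using card_Mor_pos[of "shift C X" Y] card_Mor_pos[of X1 X1] card_aut_pos[of X1]
    by (auto simp: S_def A_def E_def simp del: card_0_eq)
  have ratio': "S * A = E * I" unfolding S_def A_def E_def I_def using ratio by (simp flip: of_nat_mult)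
  have "I \<noteq> 0" using ratio' nz by auto
  have bnz [simp]: "hom_bracket C X' Y' \<noteq> 0" if "X' \<in> Obj C" "Y' \<in> Obj C" for X' Y'
    using hom_bracket_nonzero that by blast
  have calc: "bXY * (E / A) = N * bb / (cc * AA)"
    if "U * S = K * I" "N * U = AA" "AA \<noteq> 0" "K = bb / (cc * bXY)" "bXY \<noteq> 0" "cc \<noteq> 0" "bb \<noteq> 0" for bXY N bb cc AA U K :: rat
  proof -
    have "U \<noteq> 0" "N \<noteq> 0" using that by auto
    have "E / A = S / I" using ratio' nz \<open>I \<noteq> 0\<close> by (simp add: field_simps)
    also have "\<dots> = K / U" using that(1) nz \<open>I \<noteq> 0\<close> \<open>U \<noteq> 0\<close> by (simp add: field_simps)
    finally show ?thesis using that(5-7) \<open>N \<noteq> 0\<close> \<open>U \<noteq> 0\<close> unfolding that(2)[symmetric] that(4) by (simp add: field_simps)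
  qed
  have autX: "(of_nat (card (aut X)) :: rat) \<noteq> 0" and autY: "(of_nat (card (aut Y)) :: rat) \<noteq> 0"
    using card_aut_pos[of X] card_aut_pos[of Y] by (auto simp del: card_0_eq)
  have "(\<lambda>a. a ;; f') ` aut X = (\<lambda>a. a ;; f) ` aut X" using aut_orbit_eq[OF orb] by simp
  then have 1: "card ((\<lambda>a. a ;; f) ` aut X) * card {a \<in> lker X f'. iso (ident X \<boxplus> a)} = card (aut X)"
    using left_orbit_card[of f' X] by simp
  have 2: "card {a \<in> lker X f'. iso (ident X \<boxplus> a)} * card (Mor (shift C X) Y)
      = card (lker X f') * card {s \<in> Mor (shift C X) Y. iso (ident (shift C X) \<boxplus> s ;; h')}"
    by (rule lker_unit_proportion[OF t']) simp_all
  show "hom_bracket C X Y * weight X Y (orbit_of X L Y f)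
      = of_nat (card ((\<lambda>a. a ;; f) ` aut X)) * out_factor X L"
    unfolding w E_def[symmetric] A_def[symmetric] out_factor_def times_divide_eq_right
  proof (rule calc[unfolded times_divide_eq_right])
    show "of_nat (card {a \<in> lker X f'. iso (ident X \<boxplus> a)}) * S = of_nat (card (lker X f')) * I"
      unfolding S_def I_def of_nat_mult[symmetric] 2 ..
    show "of_nat (card ((\<lambda>a. a ;; f) ` aut X)) * of_nat (card {a \<in> lker X f'. iso (ident X \<boxplus> a)}) = (of_nat (card (aut X)) :: rat)"
      unfolding of_nat_mult[symmetric] 1 ..
    show "of_nat (card (lker X f')) = hom_bracket C X L / (hom_bracket C X X * hom_bracket C X Y)"
      using card_lker[OF t', of X] by simp
  qed (use autX bnz in auto)
  \<comment> \<open>The representative used for the proportion need not be the given triangle; its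
    map \<open>g'\<close> still lies in the \<open>Aut Y\<close>-orbit of \<open>g\<close>.\<close>
  have "\<exists>c\<in>aut Y. g' = g ;; c"
    using left_orbit_iff(1)[OF t t', of X Y] left_orbit_iff(2)[OF t t', of X Y] orb by auto
  then obtain c0 where c0: "iso c0" "dm c0 = Y" "cd c0 = Y" "g' = g ;; c0" by auto
  note [simp] = c0(1-3)
  have "(\<lambda>c. g' ;; c) ` aut Y = (\<lambda>c. g ;; c) ` aut Y"
  proof
    show "(\<lambda>c. g' ;; c) ` aut Y \<subseteq> (\<lambda>c. g ;; c) ` aut Y"
    proof
      fix x assume "x \<in> (\<lambda>c. g' ;; c) ` aut Y"
      then obtain c where "iso c" "dm c = Y" "cd c = Y" "x = g' ;; c" by auto
      then show "x \<in> (\<lambda>c. g ;; c) ` aut Y" by (intro image_eqI[of _ _ "c0 ;; c"]) (simp_all add: c0(4))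
    qed
    show "(\<lambda>c. g ;; c) ` aut Y \<subseteq> (\<lambda>c. g' ;; c) ` aut Y"
    proof
      fix x assume "x \<in> (\<lambda>c. g ;; c) ` aut Y"
      then obtain c where "iso c" "dm c = Y" "cd c = Y" "x = g ;; c" by auto
      then show "x \<in> (\<lambda>c. g' ;; c) ` aut Y" by (intro image_eqI[of _ _ "inverse c0 ;; c"]) (simp_all add: c0(4))
    qed
  qed
  then have 3: "card ((\<lambda>c. g ;; c) ` aut Y) * card {c \<in> rker g' Y. iso (ident Y \<boxplus> c)} = card (aut Y)"
    using right_orbit_card[of g' Y] by simp
  have 4: "card {c \<in> rker g' Y. iso (ident Y \<boxplus> c)} * card (Mor (shift C X) Y)
      = card (rker g' Y) * card {s \<in> Mor (shift C X) Y. iso (ident (shift C X) \<boxplus> s ;; h')}"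
    by (rule rker_unit_proportion[OF t']) simp_all
  show "hom_bracket C X Y * weight X Y (orbit_of X L Y f)
      = of_nat (card ((\<lambda>c. g ;; c) ` aut Y)) * in_factor L Y"
    unfolding w E_def[symmetric] A_def[symmetric] in_factor_def times_divide_eq_right
  proof (rule calc[unfolded times_divide_eq_right])
    show "of_nat (card {c \<in> rker g' Y. iso (ident Y \<boxplus> c)}) * S = of_nat (card (rker g' Y)) * I"
      unfolding S_def I_def of_nat_mult[symmetric] 4 ..
    show "of_nat (card ((\<lambda>c. g ;; c) ` aut Y)) * of_nat (card {c \<in> rker g' Y. iso (ident Y \<boxplus> c)}) = (of_nat (card (aut Y)) :: rat)"
      unfolding of_nat_mult[symmetric] 3 ..
    show "of_nat (card (rker g' Y)) = hom_bracket C L Y / (hom_bracket C Y Y * hom_bracket C X Y)"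
      using card_rker[OF t', of Y] by (simp add: mult.commute)
  qed (use autY bnz in auto)
qed

subsection \<open>Structure constants\<close>

lemma orbit_of_cong:
  assumes "f' \<in> (\<lambda>a. a ;; f) ` aut X" "arr f" "dm f = X"
  shows "orbit_of X L Y f' = orbit_of X L Y f"
  unfolding orbit_of_def aut_orbit_eq[OF assms] ..

lemma orbit_of_eq_iff:
  assumes "tri f g h" "tri f' g' h'" "dm f = X" "dm f' = X" "cd f = L" "cd f' = L" "cd g = Y" "cd g' = Y"
  shows "orbit_of X L Y f' = orbit_of X L Y f \<longleftrightarrow> f' \<in> (\<lambda>a. a ;; f) ` aut X"
    and "orbit_of X L Y f' = orbit_of X L Y f \<longleftrightarrow> g' \<in> (\<lambda>c. g ;; c) ` aut Y"
proof -
  have f: "f \<in> cone_maps X L Y" using cone_mapsI[OF assms(1)] assms by simp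
  have X: "X \<in> Obj C" using arr_obj(1)[OF tri_typed(1)[OF assms(1)]] assms by simp
  show *: "orbit_of X L Y f' = orbit_of X L Y f \<longleftrightarrow> f' \<in> (\<lambda>a. a ;; f) ` aut X"
  proof
    assume e: "orbit_of X L Y f' = orbit_of X L Y f"
    have "f' \<in> (\<lambda>a. a ;; f') ` aut X"
      using X assms tri_typed[OF assms(2)] by (intro image_eqI[of _ _ "ident X"]) simp_all
    then have "(mp f', mp g', mp h') \<in> orbit_of X L Y f'"
      unfolding orbit_of_def using assms by blast
    then have "Arrow X (mp f') L \<in> (\<lambda>a. a ;; f) ` aut X"
      unfolding e using orbit_ofD[OF _ f] by metis
    moreover have "f' = Arrow X (mp f') L" using arrow_cases(1)[of f' X L] assms tri_typed[OF assms(2)] by simp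
    ultimately show "f' \<in> (\<lambda>a. a ;; f) ` aut X" by simp
  next
    assume "f' \<in> (\<lambda>a. a ;; f) ` aut X"
    then show "orbit_of X L Y f' = orbit_of X L Y f"
      using orbit_of_cong assms tri_typed(1)[OF assms(1)] by blast
  qed
  show "orbit_of X L Y f' = orbit_of X L Y f \<longleftrightarrow> g' \<in> (\<lambda>c. g ;; c) ` aut Y"
    unfolding * using left_orbit_iff[OF assms(1,2), of X Y] assms by simp
qed

text \<open>The contributions of single orbits are added over a set of orbits. The link between
  \<open>P\<close> and \<open>Q\<close> makes \<open>P\<close> constant on each orbit, and lets the
  same orbits be counted by their first or by their second maps.\<close>

lemma sum_orbit_weights:
  assumes "X \<in> Obj C" "L \<in> Obj C" "Y \<in> Obj C"
    and PQ: "\<And>f g h. tri f g h \<Longrightarrow> dm f = X \<Longrightarrow> cd f = L \<Longrightarrow> cd g = Y \<Longrightarrow> P f \<longleftrightarrow> Q g"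
  shows "hom_bracket C X Y * (\<Sum>\<alpha>\<in>orbit_of X L Y ` {f \<in> cone_maps X L Y. P f}. weight X Y \<alpha>)
      = of_nat (card {f \<in> cone_maps X L Y. P f}) * out_factor X L"
    and "hom_bracket C X Y * (\<Sum>\<alpha>\<in>orbit_of X L Y ` {f \<in> cone_maps X L Y. P f}. weight X Y \<alpha>)
      = of_nat (card {g \<in> cocone_maps X L Y. Q g}) * in_factor L Y"
proof -
  let ?P = "{f \<in> cone_maps X L Y. P f}" and ?Q = "{g \<in> cocone_maps X L Y. Q g}"
  let ?V = "orbit_of X L Y ` ?P"
  let ?F = "\<lambda>\<alpha>. {f \<in> ?P. orbit_of X L Y f = \<alpha>}"
  let ?G = "\<lambda>\<alpha>. {g \<in> ?Q. \<exists>f h. tri f g h \<and> dm f = X \<and> orbit_of X L Y f = \<alpha>}"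
  have fin: "finite ?P" "finite ?Q" by (rule finite_subset[OF _ finite_cone_maps], blast) (rule finite_subset[OF _ finite_cocone_maps], blast)
  \<comment> \<open>Along an \<open>Aut X\<close>-orbit the map \<open>g\<close> can be kept, so
    \<open>Q g\<close> decides \<open>P\<close> for all its members.\<close>
  have inv: "P f'" if f: "f \<in> ?P" and f': "f' \<in> cone_maps X L Y" "orbit_of X L Y f' = orbit_of X L Y f" for f f'
  proof -
    obtain g h where t: "tri f g h" "dm f = X" "cd f = L" "cd g = Y" "dm g = L" using f cone_mapsD by blast
    obtain g' h' where t': "tri f' g' h'" "dm f' = X" "cd f' = L" "cd g' = Y" "dm g' = L" using f' cone_mapsD by blast
    have "f' \<in> (\<lambda>a. a ;; f) ` aut X" using orbit_of_eq_iff(1)[OF t(1) t'(1)] t t' f' by simp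
    then obtain a where a: "iso a" "dm a = X" "cd a = X" "f' = a ;; f" by auto
    have "tri f' g (h ;; inverse (sh a))" using tri_replace_cocone[OF t(1) a(1)] a t by simp
    then show "P f'" using PQ[OF t(1)] PQ[of f' g] t t' f by blast
  qed
  \<comment> \<open>The maps belonging to one triangle orbit form a single
    \<open>Aut X\<close>-orbit at the first place and a single \<open>Aut Y\<close>-orbit at the
    second.\<close>
  have F: "?F \<alpha> = (\<lambda>a. a ;; f) ` aut X" and G: "?G \<alpha> = (\<lambda>c. g ;; c) ` aut Y"
    if f: "f \<in> ?P" and t: "tri f g h" "dm f = X" "cd f = L" "cd g = Y" and \<alpha>: "\<alpha> = orbit_of X L Y f" for \<alpha> f g h
  proof -
    note [simp] = tri_typed[OF t(1)] t(2-4)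
    show "?F \<alpha> = (\<lambda>a. a ;; f) ` aut X"
    proof
      show "?F \<alpha> \<subseteq> (\<lambda>a. a ;; f) ` aut X"
      proof
        fix f' assume "f' \<in> ?F \<alpha>"
        then have f': "f' \<in> cone_maps X L Y" "orbit_of X L Y f' = orbit_of X L Y f" using \<alpha> by auto
        obtain g' h' where t': "tri f' g' h'" "dm f' = X" "cd f' = L" "cd g' = Y" "dm g' = L" using f'(1) cone_mapsD by blast
        show "f' \<in> (\<lambda>a. a ;; f) ` aut X" using orbit_of_eq_iff(1)[OF t(1) t'(1)] t' f'(2) by simp
      qed
      show "(\<lambda>a. a ;; f) ` aut X \<subseteq> ?F \<alpha>"
      proof
        fix f' assume f': "f' \<in> (\<lambda>a. a ;; f) ` aut X"
        then obtain a where a: "iso a" "dm a = X" "cd a = X" "f' = a ;; f" by auto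
        have "tri f' g (h ;; inverse (sh a))" using tri_replace_cocone[OF t(1) a(1)] a by simp
        from cone_mapsI[OF this] have "f' \<in> cone_maps X L Y" using a by simp
        moreover have e: "orbit_of X L Y f' = orbit_of X L Y f" using orbit_of_cong[OF f'] by simp
        ultimately show "f' \<in> ?F \<alpha>" using inv[OF f] \<alpha> by simp
      qed
    qed
    show "?G \<alpha> = (\<lambda>c. g ;; c) ` aut Y"
    proof
      show "?G \<alpha> \<subseteq> (\<lambda>c. g ;; c) ` aut Y"
      proof
        fix g' assume "g' \<in> ?G \<alpha>"
        then obtain f' h' where g': "g' \<in> cocone_maps X L Y" and t': "tri f' g' h'" "dm f' = X" "orbit_of X L Y f' = orbit_of X L Y f"
          using \<alpha> by blast
        have "cd g' = Y" "cd f' = L" using g' tri_typed(4)[OF t'(1)] by (auto simp: cocone_maps_def)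
        then show "g' \<in> (\<lambda>c. g ;; c) ` aut Y" using orbit_of_eq_iff(2)[OF t(1) t'(1)] t' by simp
      qed
      show "(\<lambda>c. g ;; c) ` aut Y \<subseteq> ?G \<alpha>"
      proof
        fix g' assume "g' \<in> (\<lambda>c. g ;; c) ` aut Y"
        then obtain c where c: "iso c" "dm c = Y" "cd c = Y" "g' = g ;; c" by auto
        have t': "tri f g' (inverse c ;; h)" using tri_replace_cone[OF t(1) c(1)] c by simp
        then have "g' \<in> cocone_maps X L Y" using cocone_mapsI[OF t'] c by simp
        moreover have "Q g'" using PQ[OF t'] c f by simp
        ultimately show "g' \<in> ?G \<alpha>" using t' \<alpha> t(2) by blast
      qed
    qed
  qed
  have ob: "\<exists>f g h. f \<in> ?P \<and> tri f g h \<and> dm f = X \<and> cd f = L \<and> cd g = Y \<and> \<alpha> = orbit_of X L Y f" if "\<alpha> \<in> ?V" for \<alpha>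
    using that cone_mapsD by (smt (verit) imageE mem_Collect_eq)
  have "hom_bracket C X Y * weight X Y \<alpha>
      = of_nat (card (?F \<alpha>)) * out_factor X L"
    and "hom_bracket C X Y * weight X Y \<alpha>
      = of_nat (card (?G \<alpha>)) * in_factor L Y" if "\<alpha> \<in> ?V" for \<alpha>
  proof -
    obtain f g h where f: "f \<in> ?P" and t: "tri f g h" "dm f = X" "cd f = L" "cd g = Y" and \<alpha>: "\<alpha> = orbit_of X L Y f"
      using ob[OF \<open>\<alpha> \<in> ?V\<close>] by blast
    show "hom_bracket C X Y * weight X Y \<alpha>
        = of_nat (card (?F \<alpha>)) * out_factor X L"
      unfolding F[OF f t \<alpha>] unfolding \<alpha> weight_orbit(1)[OF t] by simp
    show "hom_bracket C X Y * weight X Y \<alpha>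
        = of_nat (card (?G \<alpha>)) * in_factor L Y"
      unfolding G[OF f t \<alpha>] unfolding \<alpha> weight_orbit(2)[OF t] by simp
  qed
  then have s1: "hom_bracket C X Y * (\<Sum>\<alpha>\<in>?V. weight X Y \<alpha>)
      = of_nat (\<Sum>\<alpha>\<in>?V. card (?F \<alpha>)) * out_factor X L"
    and s2: "hom_bracket C X Y * (\<Sum>\<alpha>\<in>?V. weight X Y \<alpha>)
      = of_nat (\<Sum>\<alpha>\<in>?V. card (?G \<alpha>)) * in_factor L Y"
    unfolding sum_distrib_left of_nat_sum sum_distrib_right by (auto intro!: sum.cong simp del: of_nat_sum)
  have "card ?P = (\<Sum>\<alpha>\<in>?V. card (?F \<alpha>))" by (rule card_by_class) (use fin in auto)
  then show "hom_bracket C X Y * (\<Sum>\<alpha>\<in>?V. weight X Y \<alpha>)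
      = of_nat (card ?P) * out_factor X L"
    using s1 by simp
  have "card ?Q = (\<Sum>\<alpha>\<in>?V. card (?G \<alpha>))"
  proof (rule card_by_class)
    fix g assume g: "g \<in> ?Q"
    then obtain f h where t: "tri f g h" "dm f = X" and Y: "cd g = Y" "dm g = L" by (auto simp: cocone_maps_def)
    have L: "cd f = L" using tri_typed(4)[OF t(1)] Y by simp
    \<comment> \<open>A map \<open>g\<close> determines its completions up to an automorphism of
      \<open>X\<close>, hence one orbit.\<close>
    show "\<exists>!\<alpha>. \<alpha> \<in> ?V \<and> (\<exists>f h. tri f g h \<and> dm f = X \<and> orbit_of X L Y f = \<alpha>)"
    proof (rule ex1I)
      have "f \<in> ?P" using cone_mapsI[OF t(1)] PQ[OF t L Y(1)] g t L Y by simp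
      then show "orbit_of X L Y f \<in> ?V \<and> (\<exists>f' h. tri f' g h \<and> dm f' = X \<and> orbit_of X L Y f' = orbit_of X L Y f)"
        using t by blast
    next
      fix \<beta> assume "\<beta> \<in> ?V \<and> (\<exists>f h. tri f g h \<and> dm f = X \<and> orbit_of X L Y f = \<beta>)"
      then obtain f' h' where t': "tri f' g h'" "dm f' = X" "orbit_of X L Y f' = \<beta>" by blast
      have L': "cd f' = L" using tri_typed(4)[OF t'(1)] Y by simp
      obtain a where "iso a" "dm a = dm f'" "cd a = dm f" "f' = a ;; f" using cocone_unique[OF t(1) t'(1)] by blast
      then have "f' \<in> (\<lambda>a. a ;; f) ` aut X" using t t' by simp
      then show "\<beta> = orbit_of X L Y f"
        using orbit_of_eq_iff(1)[OF t(1) t'(1) t(2) t'(2) L L' Y(1,1)] t'(3) by blast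
    qed
  qed (use fin in simp_all)
  then show "hom_bracket C X Y * (\<Sum>\<alpha>\<in>?V. weight X Y \<alpha>) = of_nat (card ?Q) * in_factor L Y"
    using s2 by simp
qed

lemma hall_number_eq:
  assumes "X \<in> Obj C" "Y \<in> Obj C" "L \<in> Obj C"
  shows "hall_number C X Y L = of_nat (card (cone_maps X L Y)) * out_factor X L"
    and "hall_number C X Y L = of_nat (card (cocone_maps X L Y)) * in_factor L Y"
proof -
  have "hall_number C X Y L = hom_bracket C X Y * (\<Sum>\<alpha>\<in>orbit_of X L Y ` cone_maps X L Y. weight X Y \<alpha>)"
    unfolding hall_number_def tri_V_eq[OF assms(1,3,2)] weight_def ..
  then show "hall_number C X Y L = of_nat (card (cone_maps X L Y)) * out_factor X L"
    and "hall_number C X Y L = of_nat (card (cocone_maps X L Y)) * in_factor L Y"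
    using sum_orbit_weights[OF assms(1,3,2), of "\<lambda>_. True" "\<lambda>_. True"] by simp_all
qed

lemma card_cone_maps_cocone:
  assumes "X \<in> Obj C" "Y \<in> Obj C" "L \<in> Obj C"
    and "\<And>f g h. tri f g h \<Longrightarrow> dm f = X \<Longrightarrow> cd f = L \<Longrightarrow> cd g = Y \<Longrightarrow> P f \<longleftrightarrow> Q g"
  shows "of_nat (card {f \<in> cone_maps X L Y. P f}) * out_factor X L
      = of_nat (card {g \<in> cocone_maps X L Y. Q g}) * in_factor L Y"
  using sum_orbit_weights[OF assms(1,3,2), of P Q] assms(4) by simp

section \<open>Invariance under isomorphism\<close>

lemma isomorphicE:
  assumes "isomorphic C X Y" "X \<in> Obj C" "Y \<in> Obj C"
  obtains a where "iso a" "dm a = X" "cd a = Y"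
  using assms isomorphic_iff by blast

lemma cone_maps_cong:
  assumes "iso c" "dm c = Y" "cd c = Y'"
  shows "cone_maps X L Y = cone_maps X L Y'"
proof -
  have "cone_maps X L Y \<subseteq> cone_maps X L Y'" if c: "iso c" "dm c = Y" "cd c = Y'" for c Y Y'
  proof
    fix f assume "f \<in> cone_maps X L Y"
    then obtain g h where t: "tri f g h" "dm f = X" "cd f = L" "cd g = Y" "dm g = L" using cone_mapsD by blast
    have "tri f (g ;; c) (inverse c ;; h)" using tri_replace_cone[OF t(1) c(1)] c t by simp
    from cone_mapsI[OF this] show "f \<in> cone_maps X L Y'" using t c by simp
  qed
  from this[OF assms] this[of "inverse c" Y' Y] assms show ?thesis by auto
qed

lemma Mor_iso_bij:
  assumes "iso a" "dm a = X'" "cd a = X" "iso b" "dm b = Y" "cd b = Y'"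
  shows "bij_betw (\<lambda>f. a ;; f ;; b) (Mor X Y) (Mor X' Y')"
proof (rule bij_betw_byWitness[where f' = "\<lambda>f. inverse a ;; f ;; inverse b"])
  note [simp] = assms
  have X [simp]: "X \<in> Obj C" "X' \<in> Obj C" "Y \<in> Obj C" "Y' \<in> Obj C"
    using assms arr_obj iso_arr by metis+
  show "(\<lambda>f. a ;; f ;; b) ` Mor X Y \<subseteq> Mor X' Y'" "(\<lambda>f. inverse a ;; f ;; inverse b) ` Mor X' Y' \<subseteq> Mor X Y" by auto
qed (use assms in auto)

lemma card_cone_maps_iso:
  assumes "iso a" "dm a = X'" "cd a = X" "iso b" "dm b = L" "cd b = L'"
  shows "card (cone_maps X L Y) = card (cone_maps X' L' Y)"
proof -
  have le: "card (cone_maps X L Y) \<le> card (cone_maps X' L' Y)"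
    if ab: "iso a" "dm a = X'" "cd a = X" "iso b" "dm b = L" "cd b = L'" for a b X X' L L'
  proof (rule card_inj_on_le[of "\<lambda>f. a ;; f ;; b"])
    show "inj_on (\<lambda>f. a ;; f ;; b) (cone_maps X L Y)"
      by (rule inj_on_subset[OF bij_betw_imp_inj_on[OF Mor_iso_bij[OF ab]]]) (auto simp: cone_maps_def)
    show "(\<lambda>f. a ;; f ;; b) ` cone_maps X L Y \<subseteq> cone_maps X' L' Y"
    proof
      fix x assume "x \<in> (\<lambda>f. a ;; f ;; b) ` cone_maps X L Y"
      then obtain f where f: "f \<in> cone_maps X L Y" "x = a ;; f ;; b" by blast
      obtain g h where t: "tri f g h" "dm f = X" "cd f = L" "cd g = Y" "dm g = L" using cone_mapsD[OF f(1)] .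
      note [simp] = tri_typed[OF t(1)] t(2-5) ab
      have "tri (f ;; b) (inverse b ;; g) h" using tri_replace_middle[OF t(1) ab(4)] by simp
      from tri_replace_cocone[OF this ab(1)]
      have "tri (a ;; f ;; b) (inverse b ;; g) (h ;; inverse (sh a))" by simp
      from cone_mapsI[OF this] show "x \<in> cone_maps X' L' Y" unfolding f(2) by simp
    qed
  qed simp
  show ?thesis
    using le[OF assms] le[of "inverse a" X X' "inverse b" L' L] assms by simp
qed

lemma iso_funpow_sh:
  assumes "iso a" "dm a = X" "cd a = Y"
  shows "\<exists>b. iso b \<and> dm b = (shift C ^^ n) X \<and> cd b = (shift C ^^ n) Y"
proof (induction n)
  case 0
  then show ?case using assms by auto
next
  case (Suc n)
  then obtain b where "iso b" "dm b = (shift C ^^ n) X" "cd b = (shift C ^^ n) Y" by blast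
  then show ?case by (intro exI[of _ "sh b"]) simp
qed

lemma hom_bracket_iso:
  assumes "iso a" "dm a = X" "cd a = X'" "iso b" "dm b = Y" "cd b = Y'"
  shows "hom_bracket C X Y = hom_bracket C X' Y'"
proof -
  have X [simp]: "X \<in> Obj C" "X' \<in> Obj C" "Y \<in> Obj C" "Y' \<in> Obj C"
    using assms arr_obj iso_arr by metis+
  have "card (mor C ((shift C ^^ n) X) Y) = card (mor C ((shift C ^^ n) X') Y')" for n
  proof -
    obtain c where c: "iso c" "dm c = (shift C ^^ n) X" "cd c = (shift C ^^ n) X'" using iso_funpow_sh[OF assms(1-3)] by blast
    show ?thesis
      using bij_betw_same_card[OF Mor_iso_bij[of "inverse c" "(shift C ^^ n) X'" "(shift C ^^ n) X" b Y Y']] c assms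
      by (simp add: card_Mor)
  qed
  then show ?thesis by (simp add: hom_bracket_def)
qed

lemma card_aut_iso:
  assumes "iso a" "dm a = X" "cd a = X'"
  shows "card (aut X) = card (aut X')"
proof -
  have "bij_betw (\<lambda>u. inverse a ;; u ;; a) (aut X) (aut X')"
    by (rule bij_betw_byWitness[where f' = "\<lambda>u. a ;; u ;; inverse a"]) (use assms in auto)
  then show ?thesis by (rule bij_betw_same_card)
qed

lemma hall_number_iso:
  assumes "isomorphic C X X'" "isomorphic C Y Y'" "isomorphic C L L'"
    and [simp]: "X \<in> Obj C" "X' \<in> Obj C" "Y \<in> Obj C" "Y' \<in> Obj C" "L \<in> Obj C" "L' \<in> Obj C"
  shows "hall_number C X Y L = hall_number C X' Y' L'"
proof -
  obtain a where a: "iso a" "dm a = X" "cd a = X'" using isomorphicE[OF assms(1)] by auto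
  obtain b where b: "iso b" "dm b = L" "cd b = L'" using isomorphicE[OF assms(3)] by auto
  obtain c where c: "iso c" "dm c = Y" "cd c = Y'" using isomorphicE[OF assms(2)] by auto
  have "card (cone_maps X L Y) = card (cone_maps X' L' Y')"
    using card_cone_maps_iso[of "inverse a" X' X b L L' Y] cone_maps_cong[OF c, of X' L'] a b by simp
  then show ?thesis
    by (simp add: hall_number_eq(1) out_factor_def hom_bracket_iso[OF a b] hom_bracket_iso[OF a a] card_aut_iso[OF a])
qed

section \<open>Hom sets and brackets of direct sums\<close>

lemma iso_funpow_biprod:
  assumes "biprod X A B i1 i2 p1 p2"
  shows "\<exists>i1 i2 p1 p2. biprod ((shift C ^^ n) X) ((shift C ^^ n) A) ((shift C ^^ n) B) i1 i2 p1 p2"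
proof (induction n)
  case 0
  then show ?case using assms by auto
next
  case (Suc n)
  then show ?case using biprod_shift by simp blast
qed

lemma Mor_biprod_right:
  assumes "biprod E A B i1 i2 p1 p2"
  shows "bij_betw (\<lambda>a. (a ;; p1, a ;; p2)) (Mor X E) (Mor X A \<times> Mor X B)"
proof (cases "X \<in> Obj C")
  case True
  note [simp] = True biprodD[OF assms] biprod_comp[OF assms]
  have "a ;; p1 ;; i1 \<boxplus> a ;; p2 ;; i2 = a" if "a : X \<rightharpoonup> E" for a
    using that comp_plus_right[of a "p1 ;; i1" "p2 ;; i2"] by simp
  then show ?thesis
    by (intro bij_betw_byWitness[where f' = "\<lambda>(a, b). a ;; i1 \<boxplus> b ;; i2"])
      (auto simp: comp_plus_left)
next
  case False
  then have "Mor X Y = {}" for Y by auto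
  then show ?thesis by (simp add: bij_betw_def)
qed

lemma Mor_biprod_left:
  assumes "biprod E A B i1 i2 p1 p2"
  shows "bij_betw (\<lambda>a. (i1 ;; a, i2 ;; a)) (Mor E X) (Mor A X \<times> Mor B X)"
proof (cases "X \<in> Obj C")
  case True
  note [simp] = True biprodD[OF assms] biprod_comp[OF assms]
  have "p1 ;; i1 ;; a \<boxplus> p2 ;; i2 ;; a = a" if "a : E \<rightharpoonup> X" for a
    using that comp_plus_left[of "p1 ;; i1" "p2 ;; i2" a] by simp
  then show ?thesis
    by (intro bij_betw_byWitness[where f' = "\<lambda>(a, b). p1 ;; a \<boxplus> p2 ;; b"])
      (auto simp: comp_plus_right)
next
  case False
  then have "Mor Y X = {}" for Y by auto
  then show ?thesis by (simp add: bij_betw_def)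
qed

text \<open>Orders of Hom sets multiply over a direct sum in every degree, so
  \<open>exact_sequence_card\<close> applies with all kernels equal to 1.\<close>

lemma hom_bracket_biprod_right:
  assumes bp: "biprod E A B i1 i2 p1 p2" and X: "X \<in> Obj C"
  shows "hom_bracket C X E = hom_bracket C X A * hom_bracket C X B"
proof -
  note [simp] = biprodD(10-12)[OF bp] X
  have "card (Mor Z E) = card (Mor Z A) * card (Mor Z B)" for Z
    using bij_betw_same_card[OF Mor_biprod_right[OF bp]] by (metis card_cartesian_product)
  then show ?thesis
    using exact_sequence_card[of X A X E X B "\<lambda>_. 1"] by (simp add: hom_bracket_nonzero)
qed

lemma hom_bracket_biprod_left:
  assumes bp: "biprod E A B i1 i2 p1 p2" and X: "X \<in> Obj C"
  shows "hom_bracket C E X = hom_bracket C A X * hom_bracket C B X"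
proof -
  note [simp] = biprodD(10-12)[OF bp] X
  have "card (Mor ((shift C ^^ n) E) X) = card (Mor ((shift C ^^ n) A) X) * card (Mor ((shift C ^^ n) B) X)" for n
    using iso_funpow_biprod[OF bp, of n] bij_betw_same_card[OF Mor_biprod_left] by (metis card_cartesian_product)
  then show ?thesis
    using exact_sequence_card[of A X E X B X "\<lambda>_. 1"] by (simp add: hom_bracket_nonzero del: funpow.simps)
qed

text \<open>In the first formula every factor except the count of maps is non-zero.\<close>

lemma hall_number_nonzero_iff:
  assumes "X \<in> Obj C" "Y \<in> Obj C" "L \<in> Obj C"
  shows "hall_number C X Y L \<noteq> 0 \<longleftrightarrow> (\<exists>f g h. tri f g h \<and> dm f = X \<and> cd f = L \<and> cd g = Y)"
proof -
  have "hall_number C X Y L \<noteq> 0 \<longleftrightarrow> cone_maps X L Y \<noteq> {}"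
    unfolding hall_number_eq(1)[OF assms] out_factor_def
    using hom_bracket_nonzero[of X L] hom_bracket_nonzero[of X X] card_aut_pos[of X] assms
    by (simp add: card_gt_0_iff)
  also have "\<dots> \<longleftrightarrow> (\<exists>f g h. tri f g h \<and> dm f = X \<and> cd f = L \<and> cd g = Y)"
    using cone_mapsD cone_mapsI by (metis ex_in_conv)
  finally show ?thesis .
qed

section \<open>Isomorphism classes and finiteness of products\<close>

lemma isomorphic_refl: "X \<in> Obj C \<Longrightarrow> isomorphic C X X"
  using isomorphic_iff[of X X] iso_ident[of X] by fastforce

lemma isomorphic_sym: "isomorphic C X Y \<Longrightarrow> X \<in> Obj C \<Longrightarrow> Y \<in> Obj C \<Longrightarrow> isomorphic C Y X"
  by (metis isomorphic_iff inverse_simps(2,3) iso_inverse)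

lemma isomorphic_trans:
  "isomorphic C X Y \<Longrightarrow> isomorphic C Y Z \<Longrightarrow> X \<in> Obj C \<Longrightarrow> Y \<in> Obj C \<Longrightarrow> Z \<in> Obj C \<Longrightarrow> isomorphic C X Z"
  by (metis isomorphic_iff iso_comp dm_cd_simps(1,2))

lemma equiv_iso_rel: "equiv (Obj C) (iso_rel C)"
  by (rule equivI)
    (auto simp: refl_on_def sym_def trans_def iso_rel_def intro: isomorphic_refl isomorphic_sym isomorphic_trans)

text \<open>The same choice as in \<open>class_hall_number\<close>, so that class constants are Hall
  numbers of representatives.\<close>

definition rep :: "'o set \<Rightarrow> 'o" where
  "rep l = (SOME L. L \<in> l)"

lemma rep_in:
  assumes "l \<in> iso_classes C"
  shows "rep l \<in> l" "rep l \<in> Obj C" "iso_class C (rep l) = l"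
proof -
  obtain X where X: "X \<in> Obj C" "l = iso_class C X"
    using assms unfolding iso_classes_def iso_class_def by (auto elim: quotientE)
  then have "X \<in> l" using isomorphic_refl by (simp add: iso_class_def iso_rel_def)
  then show r: "rep l \<in> l" unfolding rep_def by (rule someI)
  then show "rep l \<in> Obj C" using X by (simp add: iso_class_def iso_rel_def)
  have "(X, rep l) \<in> iso_rel C" using r X by (simp add: iso_class_def)
  then show "iso_class C (rep l) = l" unfolding X(2) iso_class_def using equiv_class_eq[OF equiv_iso_rel] by metis
qed

lemma iso_class_in: "X \<in> Obj C \<Longrightarrow> iso_class C X \<in> iso_classes C"
  by (simp add: iso_class_def iso_classes_def quotientI)

lemma iso_class_eq_iff: "X \<in> Obj C \<Longrightarrow> Y \<in> Obj C \<Longrightarrow> iso_class C X = iso_class C Y \<longleftrightarrow> isomorphic C X Y"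
  unfolding iso_class_def using eq_equiv_class_iff[OF equiv_iso_rel, of X Y] by (simp add: iso_rel_def)

lemma isomorphic_rep_eq:
  assumes "l \<in> iso_classes C" "m \<in> iso_classes C" "isomorphic C (rep l) (rep m)"
  shows "l = m"
  using iso_class_eq_iff[OF rep_in(2)[OF assms(1)] rep_in(2)[OF assms(2)]] assms(3)
    rep_in(3)[OF assms(1)] rep_in(3)[OF assms(2)] by simp

lemma rep_iso_class:
  assumes "X \<in> Obj C"
  shows "rep (iso_class C X) \<in> Obj C" "isomorphic C (rep (iso_class C X)) X"
  using rep_in[OF iso_class_in[OF assms]] iso_class_eq_iff[of "rep (iso_class C X)" X] assms by simp_all

lemma class_hall_number_rep: "class_hall_number C x y l = hall_number C (rep x) (rep y) (rep l)"
  by (simp add: class_hall_number_def rep_def)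

lemma class_hall_number_iso_class:
  assumes "X \<in> Obj C" "Y \<in> Obj C" "L \<in> Obj C"
  shows "class_hall_number C (iso_class C X) (iso_class C Y) (iso_class C L) = hall_number C X Y L"
  unfolding class_hall_number_rep using assms rep_iso_class by (intro hall_number_iso) auto

text \<open>The connecting map determines the middle term up to isomorphism, by uniqueness of
  cocones in the rotated triangles, and the set of connecting maps is finite.\<close>

lemma finite_middle_terms:
  assumes "X \<in> Obj C" "Y \<in> Obj C"
  shows "finite {l \<in> iso_classes C. hall_number C X Y (rep l) \<noteq> 0}" (is "finite ?A")
proof -
  define \<phi> where "\<phi> h = iso_class C (SOME L. \<exists>f g. tri f g h \<and> dm f = X \<and> cd f = L \<and> cd g = Y)" for h
  have "?A \<subseteq> \<phi> ` Mor Y (shift C X)"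
  proof
    fix l assume l: "l \<in> ?A"
    then obtain f g h where t: "tri f g h" "dm f = X" "cd f = rep l" "cd g = Y"
      using hall_number_nonzero_iff[OF assms] rep_in by blast
    define L where "L = (SOME L. \<exists>f g. tri f g h \<and> dm f = X \<and> cd f = L \<and> cd g = Y)"
    have "\<exists>f g. tri f g h \<and> dm f = X \<and> cd f = L \<and> cd g = Y"
      unfolding L_def by (rule someI_ex) (use t in blast)
    then obtain f' g' where t': "tri f' g' h" "dm f' = X" "cd f' = L" "cd g' = Y" by blast
    obtain a where "iso a" "dm a = dm g'" "cd a = dm g"
      using cocone_unique[OF tri_rotate[OF t(1)] tri_rotate[OF t'(1)]] by blast
    moreover have "L \<in> Obj C" "rep l \<in> Obj C" using tri_typed[OF t'(1)] tri_typed[OF t(1)] t t' arr_obj by metis+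
    ultimately have "isomorphic C L (rep l)" using tri_typed(4)[OF t(1)] tri_typed(4)[OF t'(1)] t t' isomorphic_iff by metis
    then have "iso_class C L = iso_class C (rep l)" using \<open>L \<in> Obj C\<close> \<open>rep l \<in> Obj C\<close> iso_class_eq_iff by blast
    also have "\<dots> = l" using l rep_in(3) by blast
    finally have "\<phi> h = l" unfolding \<phi>_def L_def[symmetric] .
    moreover have "h \<in> Mor Y (shift C X)" using tri_typed[OF t(1)] t by simp
    ultimately show "l \<in> \<phi> ` Mor Y (shift C X)" by blast
  qed
  then show ?thesis by (rule finite_subset) simp
qed

section \<open>Associativity of the structure constants\<close>

lemma cocone_maps_cong:
  assumes "iso a" "dm a = X" "cd a = X'"
  shows "cocone_maps X L Y = cocone_maps X' L Y"
proof -
  have "cocone_maps X' L Y \<subseteq> cocone_maps X L Y" if a: "iso a" "dm a = X" "cd a = X'" for a X X'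
  proof
    fix g assume "g \<in> cocone_maps X' L Y"
    then obtain f h where t: "tri f g h" "dm f = X'" "dm g = L" "cd g = Y" by (auto simp: cocone_maps_def)
    have "tri (a ;; f) g (h ;; inverse (sh a))" using tri_replace_cocone[OF t(1) a(1)] a t by simp
    from cocone_mapsI[OF this] show "g \<in> cocone_maps X L Y" using t a tri_typed(4)[OF t(1)] by simp
  qed
  from this[OF assms] this[of "inverse a" X' X] assms show ?thesis by auto
qed

text \<open>TR1 provides a cone. As the translation is only an equivalence, the cone is first
  replaced by an isomorphic object of the form \<open>X[1]\<close>.\<close>

lemma cocone_exists:
  assumes "arr g"
  obtains f h where "tri f g h"
proof -
  obtain y z where t: "tri g y z" using tri_complete[OF assms] by blast
  have o: "cd y \<in> Obj C" using tri_typed[OF t] by simp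
  obtain X where X: "X \<in> Obj C" "isomorphic C (shift C X) (cd y)" using shift_ess_surj[OF o] by blast
  obtain c where c: "iso c" "dm c = cd y" "cd c = shift C X"
    using isomorphicE[OF isomorphic_sym[OF X(2)]] X o by auto
  have "tri g (y ;; c) (inverse c ;; z)" using tri_replace_cone[OF t c(1,2)] .
  then have "\<exists>y z. tri g y z \<and> cd y = shift C X" using c by (metis dm_cd_simps(2))
  then show thesis using cocone_iff_cone[OF assms X(1)] that by blast
qed

text \<open>Each map has exactly one class of cones, which makes sorting maps by classes a
  partition.\<close>

lemma cone_maps_rep_iff:
  assumes t: "tri a b c" and a: "dm a = L" "cd a = E" and l: "l \<in> iso_classes C"
  shows "a \<in> cone_maps L E (rep l) \<longleftrightarrow> l = iso_class C (cd b)"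
proof
  have o: "cd b \<in> Obj C" using tri_typed[OF t] by simp
  assume "a \<in> cone_maps L E (rep l)"
  then obtain g h where g: "tri a g h" "cd g = rep l" by (auto simp: cone_maps_def)
  obtain u where "iso u" "dm u = cd g" "cd u = cd b" using cone_unique[OF g(1) t] by blast
  then have "isomorphic C (rep l) (cd b)" using isomorphic_iff[OF rep_in(2)[OF l] o] g(2) by auto
  then show "l = iso_class C (cd b)" using iso_class_eq_iff[OF rep_in(2)[OF l] o] rep_in(3)[OF l] by simp
next
  have o: "cd b \<in> Obj C" using tri_typed[OF t] by simp
  assume "l = iso_class C (cd b)"
  then obtain u where "iso u" "dm u = rep l" "cd u = cd b"
    using isomorphicE[OF rep_iso_class(2)[OF o] rep_iso_class(1)[OF o] o] by metis
  then show "a \<in> cone_maps L E (rep l)" using cone_mapsI[OF t] cone_maps_cong[of u] a by auto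
qed

lemma cocone_maps_rep_iff:
  assumes t: "tri a b c" and b: "dm b = E" "cd b = L" and l: "l \<in> iso_classes C"
  shows "b \<in> cocone_maps (rep l) E L \<longleftrightarrow> l = iso_class C (dm a)"
proof
  have o: "dm a \<in> Obj C" using tri_typed[OF t] by simp
  assume "b \<in> cocone_maps (rep l) E L"
  then obtain f h where f: "tri f b h" "dm f = rep l" by (auto simp: cocone_maps_def)
  obtain u where "iso u" "dm u = dm f" "cd u = dm a" using cocone_unique[OF t f(1)] by blast
  then have "isomorphic C (rep l) (dm a)" using isomorphic_iff[OF rep_in(2)[OF l] o] f(2) by auto
  then show "l = iso_class C (dm a)" using iso_class_eq_iff[OF rep_in(2)[OF l] o] rep_in(3)[OF l] by simp
next
  have o: "dm a \<in> Obj C" using tri_typed[OF t] by simp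
  assume "l = iso_class C (dm a)"
  then obtain u where "iso u" "dm u = rep l" "cd u = dm a"
    using isomorphicE[OF rep_iso_class(2)[OF o] rep_iso_class(1)[OF o] o] by metis
  then show "b \<in> cocone_maps (rep l) E L"
    using cocone_mapsI[OF t] cocone_maps_cong[of u] b tri_typed(4)[OF t] by auto
qed

text \<open>Both sides count homotopy cartesian squares with corners \<open>L\<close>, \<open>M\<close>, \<open>Y\<close>, \<open>L'\<close>, that is,
  triangles \<open>L \<rightarrow> M \<oplus> Y \<rightarrow> L' \<rightarrow> L[1]\<close>: the left side sorts them by the map out of \<open>L\<close>, the right
  side by the map into \<open>L'\<close>.\<close>

lemma hall_number_assoc:
  assumes [simp]: "X \<in> Obj C" "Y \<in> Obj C" "Z \<in> Obj C" "M \<in> Obj C"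
  shows "(\<Sum>l | l \<in> iso_classes C \<and> hall_number C X Y (rep l) \<noteq> 0. hall_number C X Y (rep l) * hall_number C (rep l) Z M)
    = (\<Sum>l' | l' \<in> iso_classes C \<and> hall_number C Y Z (rep l') \<noteq> 0. hall_number C X (rep l') M * hall_number C Y Z (rep l'))"
    (is "(\<Sum>l | ?I l. _) = (\<Sum>l' | ?I' l'. _)")
proof -
  obtain E i1 i2 p1 p2 where bp: "biprod E M Y i1 i2 p1 p2" using biprod_exists[OF assms(4,2)] by blast
  note [simp] = biprodD[OF bp]
  \<comment> \<open>\<open>P a\<close> asks the components \<open>L \<rightarrow> M\<close> and
    \<open>L \<rightarrow> Y\<close> of \<open>a\<close> to have cone \<open>Z\<close> and cocone
    \<open>X\<close>: one contribution to F(X, Y; L) F(L, Z; M). \<open>Q\<close> is the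
    corresponding condition on a map \<open>E \<rightarrow> L'\<close>.\<close>
  define P where "P a \<longleftrightarrow> (\<exists>g h. tri (a ;; p1) g h \<and> cd g = Z) \<and> (\<exists>f h. tri f (a ;; p2) h \<and> dm f = X)" for a
  define Q where "Q b \<longleftrightarrow> (\<exists>g h. tri (i2 ;; b) g h \<and> cd g = Z) \<and> (\<exists>f h. tri f (i1 ;; b) h \<and> dm f = X)" for b
  have PQ: "P a \<longleftrightarrow> Q b" if "tri a b c" "cd a = E" for a b c
    unfolding P_def Q_def using homotopy_cartesian_cone[OF bp that] homotopy_cartesian_cocone[OF bp that, of X] by simp
  \<comment> \<open>The constant common to both sides: it is part of \<open>in_factor L Y\<close> on
    the left and of \<open>out_factor Y L'\<close> on the right.\<close>
  define \<kappa> where "\<kappa> = 1 / (hom_bracket C Y Y * of_nat (card (aut Y)))"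
  \<comment> \<open>The formulas are mixed so that both brackets have \<open>L\<close> as first
    argument; they then multiply to the bracket of \<open>L\<close> and \<open>E\<close>.\<close>
  have left: "hall_number C X Y L * hall_number C L Z M = \<kappa> * (of_nat (card {a \<in> Mor L E. P a}) * out_factor L E)"
    if [simp]: "L \<in> Obj C" for L
  proof -
    have "{a \<in> Mor L E. P a} = {a \<in> Mor L E. (a ;; p1, a ;; p2) \<in> cone_maps L M Z \<times> cocone_maps X L Y}"
      by (auto simp: P_def cone_maps_def cocone_maps_def)
    then have "card {a \<in> Mor L E. P a} = card (cone_maps L M Z) * card (cocone_maps X L Y)"
      using card_preimage_Times[OF Mor_biprod_right[OF bp] cone_maps_subset cocone_maps_subset] by (simp only:)
    then show ?thesis
      unfolding hall_number_eq(2)[OF assms(1,2) that] hall_number_eq(1)[OF that assms(3,4)] \<kappa>_def out_factor_def in_factor_def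
        hom_bracket_biprod_right[OF bp that] by simp
  qed
  have right: "hall_number C X L M * hall_number C Y Z L = \<kappa> * (of_nat (card {b \<in> Mor E L. Q b}) * in_factor E L)"
    if [simp]: "L \<in> Obj C" for L
  proof -
    have "{b \<in> Mor E L. Q b} = {b \<in> Mor E L. (i1 ;; b, i2 ;; b) \<in> cocone_maps X M L \<times> cone_maps Y L Z}"
      by (auto simp: Q_def cone_maps_def cocone_maps_def)
    then have "card {b \<in> Mor E L. Q b} = card (cocone_maps X M L) * card (cone_maps Y L Z)"
      using card_preimage_Times[OF Mor_biprod_left[OF bp] cocone_maps_subset cone_maps_subset] by (simp only:)
    then show ?thesis
      unfolding hall_number_eq(2)[OF assms(1) that assms(4)] hall_number_eq(1)[OF assms(2,3) that] \<kappa>_def out_factor_def in_factor_def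
        hom_bracket_biprod_left[OF bp that] by (simp add: mult_ac)
  qed
  have fin: "finite {l. ?I l}" "finite {l'. ?I' l'}"
    using finite_middle_terms[of X Y] finite_middle_terms[of Y Z] by simp_all
  have splitL: "card {a \<in> Mor L E. P a} = (\<Sum>l' | ?I' l'. card {a \<in> cone_maps L E (rep l'). P a})"
    if "L \<in> Obj C" for L
  proof -
    have ex: "\<exists>!l'. l' \<in> {l'. ?I' l'} \<and> a \<in> cone_maps L E (rep l')" if a: "a \<in> {a \<in> Mor L E. P a}" for a
    proof -
      have [simp]: "a : L \<rightharpoonup> E" using a by simp
      obtain b c where t: "tri a b c" using tri_complete[of a] by auto
      note [simp] = tri_typed[OF t]
      have o: "cd b \<in> Obj C" by simp
      have "Q b" using PQ[OF t] a by simp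
      then obtain g h where gh: "tri (i2 ;; b) g h" "cd g = Z" unfolding Q_def by blast
      \<comment> \<open>\<open>Q b\<close> exhibits the cone of \<open>a\<close> as a middle term
        for \<open>Y\<close> and \<open>Z\<close>, so its class lies in the finite index
        set.\<close>
      have "hall_number C Y Z (cd b) \<noteq> 0"
        unfolding hall_number_nonzero_iff[OF assms(2,3) o] using gh
        by (intro exI[of _ "i2 ;; b"] exI[of _ g] exI[of _ h]) simp
      moreover have "hall_number C Y Z (rep (iso_class C (cd b))) = hall_number C Y Z (cd b)"
        using rep_iso_class[OF o] by (intro hall_number_iso isomorphic_refl) simp_all
      ultimately have "?I' (iso_class C (cd b))" using iso_class_in[OF o] by simp
      then show ?thesis using cone_maps_rep_iff[OF t, of L E] by auto
    qed
    have "card {a \<in> Mor L E. P a} = (\<Sum>l' | ?I' l'. card {a \<in> {a \<in> Mor L E. P a}. a \<in> cone_maps L E (rep l')})"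
      by (rule card_by_class[OF _ fin(2) ex]) simp_all
    also have "\<dots> = (\<Sum>l' | ?I' l'. card {a \<in> cone_maps L E (rep l'). P a})"
      by (intro sum.cong refl arg_cong[of _ _ card]) (use cone_maps_subset in blast)
    finally show ?thesis .
  qed
  have splitR: "card {b \<in> Mor E L. Q b} = (\<Sum>l | ?I l. card {b \<in> cocone_maps (rep l) E L. Q b})"
    if "L \<in> Obj C" for L
  proof -
    have ex: "\<exists>!l. l \<in> {l. ?I l} \<and> b \<in> cocone_maps (rep l) E L" if b: "b \<in> {b \<in> Mor E L. Q b}" for b
    proof -
      have [simp]: "b : E \<rightharpoonup> L" using b by simp
      obtain a c where t: "tri a b c" using cocone_exists[of b] by auto
      have E: "cd a = E" using tri_typed(4)[OF t] by simp
      note [simp] = tri_typed(1)[OF t] E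
      have o: "dm a \<in> Obj C" by simp
      have "P a" using PQ[OF t E] b by simp
      then obtain f h where fh: "tri f (a ;; p2) h" "dm f = X" unfolding P_def by blast
      have "cd f = dm a" using tri_typed(4)[OF fh(1)] by simp
      then have "hall_number C X Y (dm a) \<noteq> 0"
        unfolding hall_number_nonzero_iff[OF assms(1,2) o] using fh
        by (intro exI[of _ f] exI[of _ "a ;; p2"] exI[of _ h]) simp
      moreover have "hall_number C X Y (rep (iso_class C (dm a))) = hall_number C X Y (dm a)"
        using rep_iso_class[OF o] by (intro hall_number_iso isomorphic_refl) simp_all
      ultimately have "?I (iso_class C (dm a))" using iso_class_in[OF o] by simp
      then show ?thesis using cocone_maps_rep_iff[OF t, of E L] by auto
    qed
    have "card {b \<in> Mor E L. Q b} = (\<Sum>l | ?I l. card {b \<in> {b \<in> Mor E L. Q b}. b \<in> cocone_maps (rep l) E L})"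
      by (rule card_by_class[OF _ fin(1) ex]) simp_all
    also have "\<dots> = (\<Sum>l | ?I l. card {b \<in> cocone_maps (rep l) E L. Q b})"
      by (intro sum.cong refl arg_cong[of _ _ card]) (use cocone_maps_subset in blast)
    finally show ?thesis .
  qed
  \<comment> \<open>These are the two formulas for F(L, L'; E), restricted to the orbits singled out
    by \<open>P\<close> and \<open>Q\<close>.\<close>
  have swap: "of_nat (card {a \<in> cone_maps L E L'. P a}) * out_factor L E = of_nat (card {b \<in> cocone_maps L E L'. Q b}) * in_factor E L'"
    if "L \<in> Obj C" "L' \<in> Obj C" for L L'
    using that PQ by (intro card_cone_maps_cocone) simp_all
  have "(\<Sum>l | ?I l. hall_number C X Y (rep l) * hall_number C (rep l) Z M)
      = (\<Sum>l | ?I l. \<kappa> * (\<Sum>l' | ?I' l'. of_nat (card {a \<in> cone_maps (rep l) E (rep l'). P a}) * out_factor (rep l) E))"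
  proof (rule sum.cong[OF refl])
    fix l assume "l \<in> {l. ?I l}"
    then have o: "rep l \<in> Obj C" using rep_in(2) by blast
    show "hall_number C X Y (rep l) * hall_number C (rep l) Z M
        = \<kappa> * (\<Sum>l' | ?I' l'. of_nat (card {a \<in> cone_maps (rep l) E (rep l'). P a}) * out_factor (rep l) E)"
      unfolding left[OF o] splitL[OF o] of_nat_sum sum_distrib_right ..
  qed
  also have "\<dots> = (\<Sum>l | ?I l. \<kappa> * (\<Sum>l' | ?I' l'. of_nat (card {b \<in> cocone_maps (rep l) E (rep l'). Q b}) * in_factor E (rep l')))"
    by (intro sum.cong refl arg_cong[of _ _ "(*) \<kappa>"]) (simp add: swap rep_in)
  also have "\<dots> = \<kappa> * (\<Sum>l | ?I l. \<Sum>l' | ?I' l'. of_nat (card {b \<in> cocone_maps (rep l) E (rep l'). Q b}) * in_factor E (rep l'))"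
    by (simp add: sum_distrib_left)
  also have "\<dots> = \<kappa> * (\<Sum>l' | ?I' l'. \<Sum>l | ?I l. of_nat (card {b \<in> cocone_maps (rep l) E (rep l'). Q b}) * in_factor E (rep l'))"
    by (subst sum.swap) (rule refl)
  also have "\<dots> = (\<Sum>l' | ?I' l'. \<kappa> * (\<Sum>l | ?I l. of_nat (card {b \<in> cocone_maps (rep l) E (rep l'). Q b}) * in_factor E (rep l')))"
    by (simp add: sum_distrib_left)
  also have "\<dots> = (\<Sum>l' | ?I' l'. hall_number C X (rep l') M * hall_number C Y Z (rep l'))"
  proof (rule sum.cong[OF refl])
    fix l' assume "l' \<in> {l'. ?I' l'}"
    then have o: "rep l' \<in> Obj C" using rep_in(2) by blast
    show "\<kappa> * (\<Sum>l | ?I l. of_nat (card {b \<in> cocone_maps (rep l) E (rep l'). Q b}) * in_factor E (rep l'))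
        = hall_number C X (rep l') M * hall_number C Y Z (rep l')"
      unfolding right[OF o] splitR[OF o] of_nat_sum sum_distrib_right ..
  qed
  finally show ?thesis .
qed

section \<open>Multiplication by a zero object\<close>

lemma zero_objs_isomorphic:
  assumes "is_zero_obj C Z" "is_zero_obj C Z'"
  shows "isomorphic C Z Z'"
proof -
  note [simp] = zero_obj_obj[OF assms(1)] zero_obj_obj[OF assms(2)]
  have e: "ident Z = zr Z Z" "ident Z' = zr Z' Z'" using assms zero_obj_iff by blast+
  have "iso (zr Z Z')" by (rule isoI[of _ Z Z' "zr Z' Z"]) (simp_all add: e)
  then show ?thesis using isomorphic_iff[of Z Z'] by fastforce
qed

lemma Mor_zero:
  assumes "is_zero_obj C Z" "X \<in> Obj C"
  shows "Mor Z X = {zr Z X}" "Mor X Z = {zr X Z}"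
proof -
  note [simp] = zero_obj_obj[OF assms(1)] assms(2)
  have "a = zr Z X" if "a : Z \<rightharpoonup> X" for a using zero_obj_arrow(1)[OF assms(1), of a] that by simp
  moreover have "a = zr X Z" if "a : X \<rightharpoonup> Z" for a using zero_obj_arrow(2)[OF assms(1), of a] that by simp
  ultimately show "Mor Z X = {zr Z X}" "Mor X Z = {zr X Z}" by auto
qed

lemma hom_bracket_zero:
  assumes "is_zero_obj C Z" "X \<in> Obj C"
  shows "hom_bracket C Z X = 1" "hom_bracket C X Z = 1"
proof -
  have Z: "is_zero_obj C ((shift C ^^ n) Z)" for n
    by (induction n) (use assms zero_obj_shift in simp_all)
  have "card (mor C ((shift C ^^ n) Z) X) = 1" for n
    using Mor_zero(1)[OF Z assms(2)] card_Mor[OF zero_obj_obj[OF Z] assms(2)] by simp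
  then show "hom_bracket C Z X = 1" by (simp add: hom_bracket_def)
  have "card (mor C ((shift C ^^ n) X) Z) = 1" for n
    using Mor_zero(2)[OF assms(1), of "(shift C ^^ n) X"] card_Mor[of "(shift C ^^ n) X" Z] zero_obj_obj[OF assms(1)] assms(2)
    by simp
  then show "hom_bracket C X Z = 1" by (simp add: hom_bracket_def)
qed

lemma aut_zero:
  assumes "is_zero_obj C Z"
  shows "aut Z = {zr Z Z}"
proof -
  note [simp] = zero_obj_obj[OF assms]
  have "iso (zr Z Z)" using assms zero_obj_iff iso_ident[of Z] by simp
  moreover have "aut Z \<subseteq> Mor Z Z" by (auto simp: aut_def)
  ultimately show ?thesis using Mor_zero(1)[OF assms, of Z] by auto
qed

text \<open>In a triangle with a zero end the other end is isomorphic to the middle. The formula is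
  taken at the zero end, where there is at most one map to count and every bracket is 1.\<close>

lemma hall_number_zero:
  assumes Z: "is_zero_obj C Z" and [simp]: "X \<in> Obj C" "L \<in> Obj C"
  shows "hall_number C Z X L = (if isomorphic C X L then 1 else 0)"
    and "hall_number C X Z L = (if isomorphic C X L then 1 else 0)"
proof -
  note [simp] = zero_obj_obj[OF Z]
  have t1: "tri (zr Z L) (ident L) (zr L (shift C Z))"
    by (rule tri_unrotate) (use tri_ident[OF _ zero_obj_shift[OF Z], of L] in simp_all)
  have t2: "tri (ident L) (zr L Z) (zr Z (shift C L))" by (rule tri_ident) (use Z in simp_all)
  have "cone_maps Z L X = (if isomorphic C X L then {zr Z L} else {})"
  proof (cases "isomorphic C X L")
    case True
    then obtain c where c: "iso c" "dm c = X" "cd c = L" using isomorphicE[OF True] by auto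
    have "zr Z L \<in> cone_maps Z L X" unfolding cone_maps_cong[OF c] using cone_mapsI[OF t1] by simp
    moreover have "cone_maps Z L X \<subseteq> Mor Z L" by (auto simp: cone_maps_def)
    ultimately show ?thesis using True Mor_zero(1)[OF Z, of L] by auto
  next
    case False
    have "False" if "f \<in> cone_maps Z L X" for f
    proof -
      obtain g h where t: "tri f g h" "dm f = Z" "cd f = L" "cd g = X" "dm g = L" using cone_mapsD[OF \<open>f \<in> cone_maps Z L X\<close>] .
      have "f = zr Z L" using zero_obj_arrow(1)[OF Z, of f] t tri_typed[OF t(1)] by simp
      then have "tri (zr Z L) g h" using t(1) by simp
      then obtain c where "iso c" "dm c = cd g" "cd c = cd (ident L)" using cone_unique[OF _ t1] by blast
      then show False using False isomorphic_iff[of X L] t(4) by auto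
    qed
    then show ?thesis using False by auto
  qed
  then show "hall_number C Z X L = (if isomorphic C X L then 1 else 0)"
    using hom_bracket_zero[OF Z] aut_zero[OF Z] by (simp add: hall_number_eq(1) out_factor_def)
  have "cocone_maps X L Z = (if isomorphic C X L then {zr L Z} else {})"
  proof (cases "isomorphic C X L")
    case True
    then obtain c where c: "iso c" "dm c = X" "cd c = L" using isomorphicE[OF True] by auto
    have "zr L Z \<in> cocone_maps X L Z" unfolding cocone_maps_cong[OF c] using cocone_mapsI[OF t2] by simp
    moreover have "cocone_maps X L Z \<subseteq> Mor L Z" by (auto simp: cocone_maps_def)
    ultimately show ?thesis using True Mor_zero(2)[OF Z, of L] by auto
  next
    case False
    have "False" if g: "g \<in> cocone_maps X L Z" for g
    proof -
      obtain f h where t: "tri f g h" "dm f = X" "dm g = L" "cd g = Z" using g by (auto simp: cocone_maps_def)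
      have "g = zr L Z" using zero_obj_arrow(2)[OF Z, of g] t tri_typed[OF t(1)] by simp
      then have "tri f (zr L Z) h" using t(1) by simp
      then obtain c where "iso c" "dm c = dm f" "cd c = dm (ident L)" using cocone_unique[OF t2] by blast
      then show False using False isomorphic_iff[of X L] t(2) by auto
    qed
    then show ?thesis using False by auto
  qed
  then show "hall_number C X Z L = (if isomorphic C X L then 1 else 0)"
    using hom_bracket_zero[OF Z] aut_zero[OF Z] by (simp add: hall_number_eq(2) in_factor_def)
qed

subsection \<open>The algebra\<close>

abbreviation coeff where "coeff \<equiv> Poly_Mapping.lookup"
abbreviation supp where "supp \<equiv> Poly_Mapping.keys"
abbreviation scale :: "rat \<Rightarrow> ('o set \<Rightarrow>\<^sub>0 rat) \<Rightarrow> ('o set \<Rightarrow>\<^sub>0 rat)" where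
  "scale r \<equiv> Poly_Mapping.map ((*) r)"

lemma finite_class_products:
  assumes "x \<in> iso_classes C" "y \<in> iso_classes C"
  shows "finite {l \<in> iso_classes C. class_hall_number C x y l \<noteq> 0}"
  unfolding class_hall_number_rep using finite_middle_terms rep_in(2) assms by blast

lemma coeff_hall_mult:
  assumes "supp p \<subseteq> iso_classes C" "supp q \<subseteq> iso_classes C"
  shows "coeff (hall_mult C p q) l =
    (if l \<in> iso_classes C then \<Sum>x\<in>supp p. \<Sum>y\<in>supp q.
       coeff p x * coeff q y * class_hall_number C x y l else 0)"
proof -
  have "(\<Sum>l' | l' \<in> iso_classes C \<and> class_hall_number C x y l' \<noteq> 0.
      coeff (Poly_Mapping.single l' (r * class_hall_number C x y l')) l)
    = (if l \<in> iso_classes C then r * class_hall_number C x y l else 0)"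
    if "x \<in> iso_classes C" "y \<in> iso_classes C" for x y r
    using finite_class_products[OF that] by (auto simp: lookup_single when_def sum.delta)
  then show ?thesis
    using assms unfolding hall_mult_def lookup_sum
    by (simp add: subset_iff cong: sum.cong)
qed

text \<open>Terms outside the supports vanish, so several products can be expanded over common
  finite index sets.\<close>

lemma coeff_hall_mult_superset:
  assumes "supp p \<subseteq> S" "supp q \<subseteq> T" "finite S" "finite T"
    and "S \<subseteq> iso_classes C" "T \<subseteq> iso_classes C" "l \<in> iso_classes C"
  shows "coeff (hall_mult C p q) l =
    (\<Sum>x\<in>S. \<Sum>y\<in>T. coeff p x * coeff q y * class_hall_number C x y l)"
proof -
  have "(\<Sum>x\<in>supp p. \<Sum>y\<in>supp q. coeff p x * coeff q y * class_hall_number C x y l)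
      = (\<Sum>x\<in>supp p. \<Sum>y\<in>T. coeff p x * coeff q y * class_hall_number C x y l)"
    by (intro sum.cong refl sum.mono_neutral_left) (use assms in \<open>auto simp: in_keys_iff\<close>)
  also have "\<dots> = (\<Sum>x\<in>S. \<Sum>y\<in>T. coeff p x * coeff q y * class_hall_number C x y l)"
    by (intro sum.mono_neutral_left) (use assms in \<open>auto simp: in_keys_iff\<close>)
  finally show ?thesis using assms by (simp add: coeff_hall_mult order_trans)
qed

lemma supp_hall_mult:
  assumes "supp p \<subseteq> iso_classes C" "supp q \<subseteq> iso_classes C"
  shows "supp (hall_mult C p q) \<subseteq> iso_classes C"
  using assms by (auto simp: in_keys_iff coeff_hall_mult split: if_splits)

lemma class_hall_number_assoc:
  assumes "x \<in> iso_classes C" "y \<in> iso_classes C" "z \<in> iso_classes C" "m \<in> iso_classes C"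
    and "finite S" "{l \<in> iso_classes C. class_hall_number C x y l \<noteq> 0} \<subseteq> S"
    and "finite T" "{l \<in> iso_classes C. class_hall_number C y z l \<noteq> 0} \<subseteq> T"
    and "S \<subseteq> iso_classes C" "T \<subseteq> iso_classes C"
  shows "(\<Sum>l\<in>S. class_hall_number C x y l * class_hall_number C l z m)
    = (\<Sum>l\<in>T. class_hall_number C x l m * class_hall_number C y z l)"
proof -
  have "(\<Sum>l\<in>S. class_hall_number C x y l * class_hall_number C l z m)
      = (\<Sum>l | l \<in> iso_classes C \<and> class_hall_number C x y l \<noteq> 0. class_hall_number C x y l * class_hall_number C l z m)"
    by (rule sum.mono_neutral_right) (use assms in auto)
  also have "\<dots> = (\<Sum>l | l \<in> iso_classes C \<and> class_hall_number C y z l \<noteq> 0. class_hall_number C x l m * class_hall_number C y z l)"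
    unfolding class_hall_number_rep using assms(1-4) rep_in(2) by (intro hall_number_assoc) auto
  also have "\<dots> = (\<Sum>l\<in>T. class_hall_number C x l m * class_hall_number C y z l)"
    by (rule sum.mono_neutral_left) (use assms in auto)
  finally show ?thesis .
qed

lemma hall_mult_assoc:
  assumes p: "supp p \<subseteq> iso_classes C" and q: "supp q \<subseteq> iso_classes C"
    and r: "supp r \<subseteq> iso_classes C"
  shows "hall_mult C (hall_mult C p q) r = hall_mult C p (hall_mult C q r)"
proof (rule poly_mapping_eqI)
  fix m
  let ?P = "supp p" and ?Q = "supp q" and ?R = "supp r"
  let ?p = "coeff p" and ?q = "coeff q" and ?r = "coeff r"
  let ?c = "class_hall_number C"
  show "coeff (hall_mult C (hall_mult C p q) r) m = coeff (hall_mult C p (hall_mult C q r)) m"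
  proof (cases "m \<in> iso_classes C")
    case True
    \<comment> \<open>\<open>S\<close> contains the middle terms of all products of basis elements
      as well as the support of \<open>hall_mult C p q\<close>, so it is a valid index set for both
      expansions.\<close>
    define S where "S = (\<Union>x\<in>?P. \<Union>y\<in>?Q. {l \<in> iso_classes C. ?c x y l \<noteq> 0}) \<union> supp (hall_mult C p q)"
    define T where "T = (\<Union>y\<in>?Q. \<Union>z\<in>?R. {l \<in> iso_classes C. ?c y z l \<noteq> 0}) \<union> supp (hall_mult C q r)"
    have S: "finite S" "S \<subseteq> iso_classes C" and T: "finite T" "T \<subseteq> iso_classes C"
      using finite_class_products[OF subsetD[OF p] subsetD[OF q]] finite_class_products[OF subsetD[OF q] subsetD[OF r]]
        supp_hall_mult[OF p q] supp_hall_mult[OF q r]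
      unfolding S_def T_def by auto
    have "coeff (hall_mult C (hall_mult C p q) r) m
        = (\<Sum>l\<in>S. \<Sum>z\<in>?R. coeff (hall_mult C p q) l * ?r z * ?c l z m)"
      by (rule coeff_hall_mult_superset) (use S r True in \<open>auto simp: S_def\<close>)
    also have "\<dots> = (\<Sum>l\<in>S. \<Sum>z\<in>?R. \<Sum>x\<in>?P. \<Sum>y\<in>?Q. ?p x * ?q y * ?r z * (?c x y l * ?c l z m))"
      using S(2) by (intro sum.cong refl) (auto simp: coeff_hall_mult[OF p q] sum_distrib_right sum_distrib_left mult_ac)
    also have "\<dots> = (\<Sum>z\<in>?R. \<Sum>x\<in>?P. \<Sum>y\<in>?Q. \<Sum>l\<in>S. ?p x * ?q y * ?r z * (?c x y l * ?c l z m))"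
      by (subst sum.swap, rule sum.cong[OF refl], subst sum.swap, rule sum.cong[OF refl], subst sum.swap) (rule refl)
    also have "\<dots> = (\<Sum>z\<in>?R. \<Sum>x\<in>?P. \<Sum>y\<in>?Q. \<Sum>l\<in>T. ?p x * ?q y * ?r z * (?c x l m * ?c y z l))"
    proof (rule sum.cong[OF refl], rule sum.cong[OF refl], rule sum.cong[OF refl])
      fix z x y assume xyz: "z \<in> ?R" "x \<in> ?P" "y \<in> ?Q"
      have "(\<Sum>l\<in>S. ?c x y l * ?c l z m) = (\<Sum>l\<in>T. ?c x l m * ?c y z l)"
        by (rule class_hall_number_assoc) (use xyz p q r True S T in \<open>auto simp: S_def T_def\<close>)
      then show "(\<Sum>l\<in>S. ?p x * ?q y * ?r z * (?c x y l * ?c l z m)) = (\<Sum>l\<in>T. ?p x * ?q y * ?r z * (?c x l m * ?c y z l))"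
        unfolding sum_distrib_left[symmetric] by simp
    qed
    also have "\<dots> = (\<Sum>x\<in>?P. \<Sum>z\<in>?R. \<Sum>l\<in>T. \<Sum>y\<in>?Q. ?p x * ?q y * ?r z * (?c x l m * ?c y z l))"
      by (subst sum.swap, rule sum.cong[OF refl], rule sum.cong[OF refl], subst sum.swap) (rule refl)
    also have "\<dots> = (\<Sum>x\<in>?P. \<Sum>l\<in>T. \<Sum>y\<in>?Q. \<Sum>z\<in>?R. ?p x * ?q y * ?r z * (?c x l m * ?c y z l))"
      by (rule sum.cong[OF refl], subst sum.swap, rule sum.cong[OF refl], subst sum.swap) (rule refl)
    also have "\<dots> = (\<Sum>x\<in>?P. \<Sum>l\<in>T. ?p x * coeff (hall_mult C q r) l * ?c x l m)"
      using T(2) by (intro sum.cong refl) (auto simp: coeff_hall_mult[OF q r] sum_distrib_right sum_distrib_left mult_ac)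
    also have "\<dots> = coeff (hall_mult C p (hall_mult C q r)) m"
      by (rule coeff_hall_mult_superset[symmetric]) (use T p True in \<open>auto simp: T_def\<close>)
    finally show ?thesis .
  next
    case False
    then show ?thesis using p q r supp_hall_mult by (simp add: coeff_hall_mult)
  qed
qed

lemma class_hall_number_zero:
  assumes "is_zero_obj C Z" "y \<in> iso_classes C" "l \<in> iso_classes C"
  shows "class_hall_number C (iso_class C Z) y l = (if y = l then 1 else 0)"
    and "class_hall_number C y (iso_class C Z) l = (if y = l then 1 else 0)"
proof -
  note Z = zero_obj_obj[OF assms(1)]
  have i: "isomorphic C (rep y) (rep l) \<longleftrightarrow> y = l"
    using isomorphic_rep_eq[OF assms(2,3)] isomorphic_refl rep_in(2)[OF assms(2)] by auto
  show "class_hall_number C (iso_class C Z) y l = (if y = l then 1 else 0)"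
    using class_hall_number_iso_class[OF Z rep_in(2)[OF assms(2)] rep_in(2)[OF assms(3)]]
      hall_number_zero(1)[OF assms(1) rep_in(2)[OF assms(2)] rep_in(2)[OF assms(3)]] i
    by (simp add: rep_in(3) assms)
  show "class_hall_number C y (iso_class C Z) l = (if y = l then 1 else 0)"
    using class_hall_number_iso_class[OF rep_in(2)[OF assms(2)] Z rep_in(2)[OF assms(3)]]
      hall_number_zero(2)[OF assms(1) rep_in(2)[OF assms(2)] rep_in(2)[OF assms(3)]] i
    by (simp add: rep_in(3) assms)
qed

lemma hall_mult_unit:
  assumes "is_zero_obj C Z" and p: "supp p \<subseteq> iso_classes C"
  shows "hall_mult C (hall_basis C Z) p = p" "hall_mult C p (hall_basis C Z) = p"
proof -
  have Z: "iso_class C Z \<in> iso_classes C" using iso_class_in[OF zero_obj_obj[OF assms(1)]] .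
  then have k: "supp (hall_basis C Z) = {iso_class C Z}" by (simp add: hall_basis_def)
  have z: "coeff p l = 0" if "l \<notin> iso_classes C" for l using p that by (auto simp: in_keys_iff)
  have s: "(\<Sum>y\<in>supp p. coeff p y * (if y = l then 1 else 0)) = coeff p l" for l
  proof -
    have "(\<Sum>y\<in>supp p. coeff p y * (if y = l then 1 else 0))
        = (\<Sum>y\<in>supp p. if y = l then coeff p y else 0)"
      by (intro sum.cong) auto
    also have "\<dots> = coeff p l" by (simp add: sum.delta in_keys_iff)
    finally show ?thesis .
  qed
  show "hall_mult C (hall_basis C Z) p = p"
  proof (rule poly_mapping_eqI)
    fix l
    show "coeff (hall_mult C (hall_basis C Z) p) l = coeff p l"
      using p Z s[of l] z[of l] class_hall_number_zero(1)[OF assms(1)]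
      by (simp add: coeff_hall_mult k hall_basis_def subset_iff cong: sum.cong)
  qed
  show "hall_mult C p (hall_basis C Z) = p"
  proof (rule poly_mapping_eqI)
    fix l
    show "coeff (hall_mult C p (hall_basis C Z)) l = coeff p l"
      using p Z s[of l] z[of l] class_hall_number_zero(2)[OF assms(1)]
      by (simp add: coeff_hall_mult k hall_basis_def subset_iff cong: sum.cong)
  qed
qed

lemma coeff_scale: "coeff (scale r p) x = r * coeff p x"
  by (simp add: Poly_Mapping.map.rep_eq when_def)

lemma supp_scale: "supp (scale r p) \<subseteq> supp p"
  by (auto simp: in_keys_iff coeff_scale)

text \<open>One combined form: the scalar 1 yields distributivity, and \<open>q = 0\<close> yields
  compatibility with scalars.\<close>

lemma hall_mult_linear:
  assumes p: "supp p \<subseteq> iso_classes C" and q: "supp q \<subseteq> iso_classes C" and t: "supp t \<subseteq> iso_classes C"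
  shows "hall_mult C (scale r p + q) t = scale r (hall_mult C p t) + hall_mult C q t"
    and "hall_mult C t (scale r p + q) = scale r (hall_mult C t p) + hall_mult C t q"
proof -
  let ?S = "supp p \<union> supp q" and ?u = "scale r p + q"
  have u: "supp ?u \<subseteq> ?S" using Poly_Mapping.keys_add[of "scale r p" q] supp_scale[of r p] by blast
  then have u': "supp ?u \<subseteq> iso_classes C" using p q by blast
  show "hall_mult C ?u t = scale r (hall_mult C p t) + hall_mult C q t"
  proof (rule poly_mapping_eqI)
    fix l
    show "coeff (hall_mult C ?u t) l = coeff (scale r (hall_mult C p t) + hall_mult C q t) l"
    proof (cases "l \<in> iso_classes C")
      case True
      have "coeff (hall_mult C v t) l = (\<Sum>x\<in>?S. \<Sum>y\<in>supp t. coeff v x * coeff t y * class_hall_number C x y l)"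
        if "supp v \<subseteq> ?S" for v
        by (rule coeff_hall_mult_superset) (use that p q t True in auto)
      from this[OF u] this[OF Un_upper1] this[OF Un_upper2] show ?thesis
        by (simp add: lookup_add coeff_scale distrib_left distrib_right sum.distrib sum_distrib_left mult_ac)
    qed (use p q t u' in \<open>simp add: lookup_add coeff_scale coeff_hall_mult\<close>)
  qed
  show "hall_mult C t ?u = scale r (hall_mult C t p) + hall_mult C t q"
  proof (rule poly_mapping_eqI)
    fix l
    show "coeff (hall_mult C t ?u) l = coeff (scale r (hall_mult C t p) + hall_mult C t q) l"
    proof (cases "l \<in> iso_classes C")
      case True
      have "coeff (hall_mult C t v) l = (\<Sum>x\<in>supp t. \<Sum>y\<in>?S. coeff t x * coeff v y * class_hall_number C x y l)"
        if "supp v \<subseteq> ?S" for v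
        by (rule coeff_hall_mult_superset) (use that p q t True in auto)
      from this[OF u] this[OF Un_upper1] this[OF Un_upper2] show ?thesis
        by (simp add: lookup_add coeff_scale distrib_left distrib_right sum.distrib sum_distrib_left mult_ac)
    qed (use p q t u' in \<open>simp add: lookup_add coeff_scale coeff_hall_mult\<close>)
  qed
qed

lemma scale_one: "scale 1 p = p"
  by (rule poly_mapping_eqI) (simp add: coeff_scale)

lemma hall_mult_zero: "hall_mult C 0 p = 0" "hall_mult C p 0 = 0"
  by (simp_all add: hall_mult_def)

lemma hall_basis_zero:
  assumes "is_zero_obj C Z" "is_zero_obj C Z'"
  shows "hall_basis C Z = hall_basis C Z'"
  using iso_class_eq_iff[OF zero_obj_obj[OF assms(1)] zero_obj_obj[OF assms(2)]] zero_objs_isomorphic[OF assms]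
  by (simp add: hall_basis_def)

lemma some_zero: "is_zero_obj C (SOME Z. is_zero_obj C Z)"
  using zero_obj_ex by (rule someI_ex)

lemma hall_algebra_simps:
  "carrier (hall_algebra C) = {p. supp p \<subseteq> iso_classes C}"
  "p \<otimes>\<^bsub>hall_algebra C\<^esub> q = hall_mult C p q"
  "p \<oplus>\<^bsub>hall_algebra C\<^esub> q = p + q"
  "\<zero>\<^bsub>hall_algebra C\<^esub> = 0"
  "\<one>\<^bsub>hall_algebra C\<^esub> = hall_basis C (SOME Z. is_zero_obj C Z)"
  "r \<odot>\<^bsub>hall_algebra C\<^esub> p = scale r p"
  by (simp_all add: hall_algebra_def)

lemma abelian_group_hall_algebra: "abelian_group (hall_algebra C)"
proof (rule abelian_groupI)
  fix p q assume "p \<in> carrier (hall_algebra C)" "q \<in> carrier (hall_algebra C)"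
  then show "p \<oplus>\<^bsub>hall_algebra C\<^esub> q \<in> carrier (hall_algebra C)"
    using Poly_Mapping.keys_add[of p q] by (auto simp: hall_algebra_simps)
next
  fix p assume "p \<in> carrier (hall_algebra C)"
  then show "\<exists>q\<in>carrier (hall_algebra C). q \<oplus>\<^bsub>hall_algebra C\<^esub> p = \<zero>\<^bsub>hall_algebra C\<^esub>"
    by (intro bexI[of _ "- p"]) (simp_all add: hall_algebra_simps)
qed (simp_all add: hall_algebra_simps add_ac)

lemma ring_hall_algebra: "ring (hall_algebra C)"
proof (rule ringI[OF abelian_group_hall_algebra])
  show "monoid (hall_algebra C)"
  proof (rule monoidI)
    show "\<one>\<^bsub>hall_algebra C\<^esub> \<in> carrier (hall_algebra C)"
      using iso_class_in[OF zero_obj_obj[OF some_zero]] by (simp add: hall_algebra_simps hall_basis_def)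
  qed (use some_zero in \<open>simp_all add: hall_algebra_simps supp_hall_mult hall_mult_assoc hall_mult_unit\<close>)
qed (use hall_mult_linear[of _ _ _ 1] in \<open>simp_all add: hall_algebra_simps scale_one\<close>)

lemma vectorspace_hall_algebra: "vectorspace (class_ring :: rat ring) (hall_algebra C)"
proof -
  have "Module.module (class_ring :: rat ring) (hall_algebra C)"
  proof (rule Module.moduleI[OF class_cring.is_cring abelian_group_hall_algebra])
    fix r p assume "p \<in> carrier (hall_algebra C)"
    then show "r \<odot>\<^bsub>hall_algebra C\<^esub> p \<in> carrier (hall_algebra C)"
      using supp_scale[of r p] by (auto simp: hall_algebra_simps)
  qed (auto simp: hall_algebra_simps coeff_scale lookup_add algebra_simps intro!: poly_mapping_eqI)
  then show ?thesis by (simp add: vectorspace_def class_field)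
qed

lemma unital_assoc_algebra_hall: "unital_assoc_algebra (class_ring :: rat ring) (hall_algebra C)"
  by (intro unital_assoc_algebra.intro vectorspace_hall_algebra ring_hall_algebra unital_assoc_algebra_axioms.intro)
    (use hall_mult_linear[of _ 0] in \<open>simp_all add: hall_algebra_simps hall_mult_zero\<close>)

lemma coeff_hall_basis_mult:
  assumes "X \<in> Obj C" "Y \<in> Obj C" "L \<in> Obj C"
  shows "coeff (hall_basis C X \<otimes>\<^bsub>hall_algebra C\<^esub> hall_basis C Y) (iso_class C L) = hall_number C X Y L"
  using assms iso_class_in class_hall_number_iso_class[OF assms]
  by (simp add: hall_algebra_simps coeff_hall_mult hall_basis_def)

end

section \<open>Finite dimension in terms of cardinality\<close>

lemma (in vectorspace) finite_carrier:
  assumes "finite (carrier K)" "fin_dim"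
  shows "finite (carrier V)"
proof -
  obtain A where A: "finite A" "A \<subseteq> carrier V" "span A = carrier V"
    using assms(2) unfolding fin_dim_def by blast
  have "carrier V \<subseteq> (\<lambda>a. lincomb a A) ` (A \<rightarrow>\<^sub>E carrier K)"
  proof
    fix v assume "v \<in> carrier V"
    then obtain a where a: "v = lincomb a A" "a \<in> A \<rightarrow> carrier K"
      using finite_span[OF A(1,2)] A(3) by auto
    \<comment> \<open>Restriction makes the coefficients extensional, so that they range over a
      finite function space.\<close>
    have "lincomb (restrict a A) A = lincomb a A"
      unfolding lincomb_def using a(2) A(2) by (intro finsum_cong') auto
    then show "v \<in> (\<lambda>a. lincomb a A) ` (A \<rightarrow>\<^sub>E carrier K)"
      using a by (intro image_eqI[of _ _ "restrict a A"]) auto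
  qed
  then show ?thesis using finite_PiE[OF A(1)] assms(1) by (metis finite_imageI finite_subset)
qed

text \<open>\<open>dim\<close> is the least cardinality of a finite generating set, and it is
  attained; in dimension 0 the empty set generates.\<close>

lemma (in vectorspace) card_carrier_dim_0:
  assumes "fin_dim" "dim = 0"
  shows "card (carrier V) = 1"
proof -
  let ?Q = "\<lambda>n. \<exists>A. finite A \<and> card A = n \<and> A \<subseteq> carrier V \<and> gen_set A"
  have "\<exists>n. ?Q n" using assms(1) unfolding fin_dim_def by blast
  then have "?Q dim" unfolding dim_def by (rule LeastI_ex)
  then have "span {} = carrier V" using assms(2) by auto
  then show ?thesis using span_empty by (metis card_1_singleton_iff One_nat_def)
qed

theorem theorem3p6:
  fixes k :: "'k ring" and C :: "('o, 'm, 'k) tri_data"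
  assumes "field k" and "finite (carrier k)"
    and "triangulated_category k C"
    and "\<forall>X \<in> Obj C. \<forall>Y \<in> Obj C. vectorspace.fin_dim k (Hom C X Y)"
    and "\<forall>X. indecomposable C X \<longrightarrow>
           vectorspace.fin_dim k (End_ring C X) \<and> local_ring (End_ring C X)"
    and "\<forall>X \<in> Obj C. \<forall>Y \<in> Obj C.
           summable (\<lambda>i. real (vectorspace.dim k (Hom C ((shift C ^^ i) X) Y)))"
  shows "unital_assoc_algebra (class_ring :: rat ring) (hall_algebra C)
    \<and> (\<forall>X \<in> Obj C. \<forall>Y \<in> Obj C.
          finite {l \<in> iso_classes C. class_hall_number C (iso_class C X) (iso_class C Y) l \<noteq> 0}
        \<and> (\<forall>L \<in> Obj C. Poly_Mapping.lookup
              (hall_basis C X \<otimes>\<^bsub>hall_algebra C\<^esub> hall_basis C Y) (iso_class C L)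
              = hall_number C X Y L))
    \<and> (\<forall>Z. is_zero_obj C Z \<longrightarrow> \<one>\<^bsub>hall_algebra C\<^esub> = hall_basis C Z)"
proof -
  interpret triangulated_arrows k C using assms(3) by (simp add: triangulated_arrows_def)
  interpret finitary_triangulated k C
  proof
    fix X Y assume XY: "X \<in> Obj C" "Y \<in> Obj C"
    interpret V: vectorspace k "Hom C X Y" using hom_vectorspace XY .
    show "finite (mor C X Y)" using V.finite_carrier assms(2,4) XY by blast
  next
    fix X assume "indecomposable C X"
    then show "local_ring (End_ring C X)" using assms(5) by blast
  next
    fix X Y assume XY: "X \<in> Obj C" "Y \<in> Obj C"
    let ?H = "\<lambda>i. Hom C ((shift C ^^ i) X) Y"
    have o: "(shift C ^^ i) X \<in> Obj C" for i by (induction i) (simp_all add: XY)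
    \<comment> \<open>Dimensions are natural numbers, so once the terms of the convergent series
      fall below 1 they are 0.\<close>
    have "(\<lambda>i. real (vectorspace.dim k (?H i))) \<longlonglongrightarrow> 0"
      using assms(6) XY by (intro summable_LIMSEQ_zero) blast
    then have "\<forall>\<^sub>F i in sequentially. real (vectorspace.dim k (?H i)) < 1"
      by (rule order_tendstoD) simp
    then obtain N where N: "\<And>n. n \<ge> N \<Longrightarrow> vectorspace.dim k (?H n) = 0"
      unfolding eventually_sequentially by auto
    have "card (mor C ((shift C ^^ n) X) Y) = 1" if "n \<ge> N" for n
    proof -
      interpret V: vectorspace k "?H n" using hom_vectorspace o XY(2) .
      show ?thesis using V.card_carrier_dim_0 N[OF that] assms(4) o XY(2) by blast
    qed
    then show "\<exists>N. \<forall>n\<ge>N. card (mor C ((shift C ^^ n) X) Y) = 1" by blast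
  qed
  show ?thesis
    using unital_assoc_algebra_hall coeff_hall_basis_mult finite_class_products[OF iso_class_in iso_class_in]
      hall_basis_zero[OF some_zero] by (simp add: hall_algebra_simps(5))
qed

end
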